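(* Let $d\ge2$, let $\mathcal{O}\subset\mathbb{R}^d$ be an open, bounded domain with smooth boundary and outer unit normal $\nu$ on $\partial\mathcal{O}$, let $N\ge1$, and let $b_1,\dots,b_N\in C^2(\overline{\mathcal{O}};\mathbb{R}^d)$ satisfy conditions (i)–(iv) listed in the context. Then for every $1\le i\le N$ there exists a linear subspace $\mathcal{D}\subset\operatorname{dom}(-\Delta)$ such that: (a) $\Delta(\mathcal{D})\subseteq\operatorname{dom}(B_i)$; (b) $B_i(\mathcal{D})\subseteq\operatorname{dom}(-\Delta)$; (c) $\mathcal{D}$ is a core for $(-\Delta,\operatorname{dom}(-\Delta))$; (d) $\operatorname{dom}(-\Delta)\subseteq\operatorname{dom}(B_i)$ and $\operatorname{dom}(-\Delta)\subseteq\operatorname{dom}(B_i^* )$; (e) for any $u\in\mathcal{D}$, $B_i\Delta u=\Delta B_iu$.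
   Context: $\langle\cdot,\cdot\rangle$ is the Euclidean scalar product of $\mathbb{R}^d$ and $b_i=(b_i^1,\dots,b_i^d)$. Conditions on the fields: (i) $\langle b_i,\nu\rangle=0$ on $\partial\mathcal{O}$ for all $1\le i\le N$. (ii) Either $N=1$, or $b_i^k\partial_kb_l^j=b_l^k\partial_kb_i^j$ on $\overline{\mathcal{O}}$ for all $1\le k,j\le d$ and all $1\le i,l\le N$, $i\ne l$. (iii) $\operatorname{div}b_i=0$ and $\langle\Delta b_i,b_i\rangle=0$ on $\overline{\mathcal{O}}$ for all $1\le i\le N$ (the Laplacian acting componentwise). (iv) $\langle\langle\nabla b_i,\nu\rangle,b_i\rangle+\langle\langle\nabla b_i,b_i\rangle,\nu\rangle=0$ on $\partial\mathcal{O}$ for all $1\le i\le N$ (the gradient acting componentwise, i.e. $\langle\nabla b_i,v\rangle$ is the vector with $j$-th component $\langle\nabla b_i^j,v\rangle$). $B_i$ is the linear operator on $L^2(\mathcal{O})$ with domain $\operatorname{dom}(B_i)=H^1(\mathcal{O})$ given by $B_iu=\langle b_i,\nabla u\rangle$, and $B_i^*$ is its adjoint in $L^2(\mathcal{O})$. $-\Delta$ is the Neumann Laplacian: $\operatorname{dom}(-\Delta)$ consists of all $u\in H^1(\mathcal{O})$ such that $\Delta u\in L^2(\mathcal{O})$ and $\int_{\mathcal{O}}v\Delta u\,d\xi=-\int_{\mathcal{O}}\langle\nabla v,\nabla u\rangle\,d\xi$ for all $v\in H^1(\mathcal{O})$. A subspace is a core if it is dense in $\operatorname{dom}(-\Delta)$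 with respect to the graph norm $\|u\|_{\operatorname{dom}(-\Delta)}^2=\int_{\mathcal{O}}(|\Delta u|^2+|u|^2)\,d\xi$. *)

theory Defs
  imports "HOL-Analysis.Analysis"
begin

section \<open>Classical differentiability\<close>

definition partial_deriv :: "'n::finite \<Rightarrow> (real^'n \<Rightarrow> real) \<Rightarrow> real^'n \<Rightarrow> real" where
  "partial_deriv j f x = frechet_derivative f (at x) (axis j 1)"

definition gradient :: "(real^'n::finite \<Rightarrow> real) \<Rightarrow> real^'n \<Rightarrow> real^'n" where
  "gradient f x = (\<chi> j. partial_deriv j f x)"

definition laplacian :: "(real^'n::finite \<Rightarrow> real) \<Rightarrow> real^'n \<Rightarrow> real" where
  "laplacian f x = (\<Sum>j\<in>UNIV. partial_deriv j (partial_deriv j f) x)"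

text \<open>Meant for open \<open>U\<close>, since it uses derivatives in the whole space.\<close>

primrec Ck_on :: "nat \<Rightarrow> (real^'n::finite) set \<Rightarrow> (real^'n \<Rightarrow> real) \<Rightarrow> bool" where
  "Ck_on 0 U f \<longleftrightarrow> continuous_on U f"
| "Ck_on (Suc k) U f \<longleftrightarrow> continuous_on U f \<and> f differentiable_on U \<and>
     (\<forall>j. Ck_on k U (partial_deriv j f))"

definition smooth_on :: "(real^'n::finite) set \<Rightarrow> (real^'n \<Rightarrow> real) \<Rightarrow> bool" where
  "smooth_on U f \<longleftrightarrow> (\<forall>k. Ck_on k U f)"


section \<open>Differentiability up to the boundary\<close>

text \<open>
  A function is of class \<open>C\<^sup>k\<close> on the closure of an open set \<open>\<Omega>\<close> if all its partial
  derivatives of order at most \<open>k\<close> in \<open>\<Omega>\<close> extend continuously to the closure. The boundary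
  values of a derivative are those of this extension, i.e. its limits from inside \<open>\<Omega>\<close>.
\<close>

definition cpartial :: "(real^'n::finite) set \<Rightarrow> 'n \<Rightarrow> (real^'n \<Rightarrow> real) \<Rightarrow> real^'n \<Rightarrow> real" where
  "cpartial \<Omega> j f x =
     (if x \<in> \<Omega> then partial_deriv j f x else Lim (at x within \<Omega>) (partial_deriv j f))"

primrec Ck_closure :: "nat \<Rightarrow> (real^'n::finite) set \<Rightarrow> (real^'n \<Rightarrow> real) \<Rightarrow> bool" where
  "Ck_closure 0 \<Omega> f \<longleftrightarrow> continuous_on (closure \<Omega>) f"
| "Ck_closure (Suc k) \<Omega> f \<longleftrightarrow> continuous_on (closure \<Omega>) f \<and> f differentiable_on \<Omega> \<and>
     (\<forall>j. Ck_closure k \<Omega> (cpartial \<Omega> j f))"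

definition Ck_closure_field ::
    "nat \<Rightarrow> (real^'n::finite) set \<Rightarrow> (real^'n \<Rightarrow> real^'n) \<Rightarrow> bool" where
  "Ck_closure_field k \<Omega> b \<longleftrightarrow> (\<forall>j. Ck_closure k \<Omega> (\<lambda>x. b x $ j))"

definition cdivergence :: "(real^'n::finite) set \<Rightarrow> (real^'n \<Rightarrow> real^'n) \<Rightarrow> real^'n \<Rightarrow> real" where
  "cdivergence \<Omega> b x = (\<Sum>k\<in>UNIV. cpartial \<Omega> k (\<lambda>y. b y $ k) x)"

definition claplacian_field ::
    "(real^'n::finite) set \<Rightarrow> (real^'n \<Rightarrow> real^'n) \<Rightarrow> real^'n \<Rightarrow> real^'n" where
  "claplacian_field \<Omega> b x =
     (\<chi> j. \<Sum>k\<in>UNIV. cpartial \<Omega> k (cpartial \<Omega> k (\<lambda>y. b y $ j)) x)"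

definition cgradient :: "(real^'n::finite) set \<Rightarrow> (real^'n \<Rightarrow> real) \<Rightarrow> real^'n \<Rightarrow> real^'n" where
  "cgradient \<Omega> f x = (\<chi> k. cpartial \<Omega> k f x)"

text \<open>The vector \<open>\<langle>\<nabla>b, v\<rangle>\<close> at \<open>x\<close>, with components \<open>\<langle>\<nabla>b\<^sup>j, v\<rangle>\<close>.\<close>

definition cgradient_field ::
    "(real^'n::finite) set \<Rightarrow> (real^'n \<Rightarrow> real^'n) \<Rightarrow> real^'n \<Rightarrow> real^'n \<Rightarrow> real^'n" where
  "cgradient_field \<Omega> b x v = (\<chi> j. cgradient \<Omega> (\<lambda>y. b y $ j) x \<bullet> v)"


section \<open>Domains with smooth boundary\<close>

text \<open>
  \<open>\<rho>\<close> is a defining function of \<open>\<Omega>\<close> on the open set \<open>U\<close>. The first set equation makes \<open>\<Omega>\<close> lie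
  locally on one side of its boundary, and \<open>\<nabla>\<rho>\<close> point out of \<open>\<Omega>\<close>.
\<close>

definition defining_function ::
    "(real^'n::finite) set \<Rightarrow> (real^'n) set \<Rightarrow> (real^'n \<Rightarrow> real) \<Rightarrow> bool" where
  "defining_function \<Omega> U \<rho> \<longleftrightarrow> open U \<and> smooth_on U \<rho> \<and>
     \<Omega> \<inter> U = {y \<in> U. \<rho> y < 0} \<and> frontier \<Omega> \<inter> U = {y \<in> U. \<rho> y = 0} \<and>
     (\<forall>y \<in> frontier \<Omega> \<inter> U. gradient \<rho> y \<noteq> 0)"

definition smooth_boundary :: "(real^'n::finite) set \<Rightarrow> bool" where
  "smooth_boundary \<Omega> \<longleftrightarrow> (\<forall>x \<in> frontier \<Omega>. \<exists>U \<rho>. x \<in> U \<and> defining_function \<Omega> U \<rho>)"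

text \<open>The normal at a boundary point does not depend on the choice of the defining function.\<close>

definition outer_unit_normal :: "(real^'n::finite) set \<Rightarrow> (real^'n \<Rightarrow> real^'n) \<Rightarrow> bool" where
  "outer_unit_normal \<Omega> \<nu> \<longleftrightarrow> (\<forall>x \<in> frontier \<Omega>. \<exists>U \<rho>. x \<in> U \<and> defining_function \<Omega> U \<rho> \<and>
     \<nu> x = gradient \<rho> x /\<^sub>R norm (gradient \<rho> x))"


section \<open>The Hilbert space \<open>L\<^sup>2(\<Omega>)\<close>\<close>

text \<open>
  Elements of \<open>L\<^sup>2(\<Omega>)\<close> are represented by functions on the whole space, of which only the
  restriction to \<open>\<Omega>\<close> up to null sets matters. Equality in \<open>L\<^sup>2(\<Omega>)\<close> is \<open>ae_eq\<close>, and subspaces of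
  \<open>L\<^sup>2(\<Omega>)\<close> are represented by sets of functions saturated with respect to \<open>ae_eq\<close>.
\<close>

definition L2 :: "(real^'n::finite) set \<Rightarrow> (real^'n \<Rightarrow> real) set" where
  "L2 \<Omega> = {u. u \<in> borel_measurable (lebesgue_on \<Omega>) \<and> integrable (lebesgue_on \<Omega>) (\<lambda>x. (u x)\<^sup>2)}"

definition ae_eq :: "(real^'n::finite) set \<Rightarrow> (real^'n \<Rightarrow> real) \<Rightarrow> (real^'n \<Rightarrow> real) \<Rightarrow> bool" where
  "ae_eq \<Omega> u v \<longleftrightarrow> (AE x in lebesgue_on \<Omega>. u x = v x)"

definition L2_inner :: "(real^'n::finite) set \<Rightarrow> (real^'n \<Rightarrow> real) \<Rightarrow> (real^'n \<Rightarrow> real) \<Rightarrow> real" where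
  "L2_inner \<Omega> u v = (\<integral>x. u x * v x \<partial>lebesgue_on \<Omega>)"

definition L2_subspace :: "(real^'n::finite) set \<Rightarrow> (real^'n \<Rightarrow> real) set \<Rightarrow> bool" where
  "L2_subspace \<Omega> D \<longleftrightarrow> D \<subseteq> L2 \<Omega> \<and> (\<lambda>x. 0) \<in> D \<and>
     (\<forall>u\<in>D. \<forall>v\<in>D. (\<lambda>x. u x + v x) \<in> D) \<and>
     (\<forall>c. \<forall>u\<in>D. (\<lambda>x. c * u x) \<in> D) \<and>
     (\<forall>u\<in>D. \<forall>v\<in>L2 \<Omega>. ae_eq \<Omega> u v \<longrightarrow> v \<in> D)"

text \<open>Domain of the Hilbert space adjoint of a densely defined operator \<open>A\<close> with domain \<open>X\<close>.\<close>

definition adjoint_dom ::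
    "(real^'n::finite) set \<Rightarrow> (real^'n \<Rightarrow> real) set \<Rightarrow> ((real^'n \<Rightarrow> real) \<Rightarrow> (real^'n \<Rightarrow> real)) \<Rightarrow>
     (real^'n \<Rightarrow> real) set" where
  "adjoint_dom \<Omega> X A =
     {v \<in> L2 \<Omega>. \<exists>w \<in> L2 \<Omega>. \<forall>u \<in> X. L2_inner \<Omega> (A u) v = L2_inner \<Omega> u w}"


section \<open>Weak derivatives and Sobolev spaces\<close>

definition test_functions :: "(real^'n::finite) set \<Rightarrow> (real^'n \<Rightarrow> real) set" where
  "test_functions \<Omega> = {\<phi>. smooth_on UNIV \<phi> \<and> compact (closure {x. \<phi> x \<noteq> 0}) \<and>
     closure {x. \<phi> x \<noteq> 0} \<subseteq> \<Omega>}"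

definition is_weak_gradient ::
    "(real^'n::finite) set \<Rightarrow> (real^'n \<Rightarrow> real) \<Rightarrow> (real^'n \<Rightarrow> real^'n) \<Rightarrow> bool" where
  "is_weak_gradient \<Omega> u g \<longleftrightarrow> (\<forall>j. (\<lambda>x. g x $ j) \<in> L2 \<Omega>) \<and>
     (\<forall>\<phi> \<in> test_functions \<Omega>. \<forall>j.
        (\<integral>x. u x * partial_deriv j \<phi> x \<partial>lebesgue_on \<Omega>) = - (\<integral>x. g x $ j * \<phi> x \<partial>lebesgue_on \<Omega>))"

definition H1 :: "(real^'n::finite) set \<Rightarrow> (real^'n \<Rightarrow> real) set" where
  "H1 \<Omega> = {u \<in> L2 \<Omega>. \<exists>g. is_weak_gradient \<Omega> u g}"

text \<open>
  Weak derivatives are unique up to null sets; \<open>weak_gradient\<close> and \<open>weak_laplacian\<close> choose a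
  representative. They are meaningful only where a weak derivative in \<open>L\<^sup>2(\<Omega>)\<close> exists.
\<close>

definition weak_gradient :: "(real^'n::finite) set \<Rightarrow> (real^'n \<Rightarrow> real) \<Rightarrow> real^'n \<Rightarrow> real^'n" where
  "weak_gradient \<Omega> u = (SOME g. is_weak_gradient \<Omega> u g)"

definition is_weak_laplacian ::
    "(real^'n::finite) set \<Rightarrow> (real^'n \<Rightarrow> real) \<Rightarrow> (real^'n \<Rightarrow> real) \<Rightarrow> bool" where
  "is_weak_laplacian \<Omega> u w \<longleftrightarrow> w \<in> L2 \<Omega> \<and>
     (\<forall>\<phi> \<in> test_functions \<Omega>.
        (\<integral>x. u x * laplacian \<phi> x \<partial>lebesgue_on \<Omega>) = (\<integral>x. w x * \<phi> x \<partial>lebesgue_on \<Omega>))"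

definition weak_laplacian :: "(real^'n::finite) set \<Rightarrow> (real^'n \<Rightarrow> real) \<Rightarrow> real^'n \<Rightarrow> real" where
  "weak_laplacian \<Omega> u = (SOME w. is_weak_laplacian \<Omega> u w)"


section \<open>The operators\<close>

text \<open>The operator \<open>u \<mapsto> \<langle>b, \<nabla>u\<rangle>\<close> in \<open>L\<^sup>2(\<Omega>)\<close> and its domain.\<close>

definition B_dom :: "(real^'n::finite) set \<Rightarrow> (real^'n \<Rightarrow> real^'n) \<Rightarrow> (real^'n \<Rightarrow> real) set" where
  "B_dom \<Omega> b = H1 \<Omega>"

definition B_op ::
    "(real^'n::finite) set \<Rightarrow> (real^'n \<Rightarrow> real^'n) \<Rightarrow> (real^'n \<Rightarrow> real) \<Rightarrow> real^'n \<Rightarrow> real" where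
  "B_op \<Omega> b u = (\<lambda>x. b x \<bullet> weak_gradient \<Omega> u x)"

definition neumann_dom :: "(real^'n::finite) set \<Rightarrow> (real^'n \<Rightarrow> real) set" where
  "neumann_dom \<Omega> = {u \<in> H1 \<Omega>. (\<exists>w. is_weak_laplacian \<Omega> u w) \<and>
     (\<forall>v \<in> H1 \<Omega>. (\<integral>x. v x * weak_laplacian \<Omega> u x \<partial>lebesgue_on \<Omega>) =
        - (\<integral>x. weak_gradient \<Omega> v x \<bullet> weak_gradient \<Omega> u x \<partial>lebesgue_on \<Omega>))}"

definition neumann_graph_norm :: "(real^'n::finite) set \<Rightarrow> (real^'n \<Rightarrow> real) \<Rightarrow> real" where
  "neumann_graph_norm \<Omega> u = sqrt (\<integral>x. (weak_laplacian \<Omega> u x)\<^sup>2 + (u x)\<^sup>2 \<partial>lebesgue_on \<Omega>)"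

definition neumann_core :: "(real^'n::finite) set \<Rightarrow> (real^'n \<Rightarrow> real) set \<Rightarrow> bool" where
  "neumann_core \<Omega> D \<longleftrightarrow> L2_subspace \<Omega> D \<and> D \<subseteq> neumann_dom \<Omega> \<and>
     (\<forall>u \<in> neumann_dom \<Omega>. \<forall>\<epsilon>>0. \<exists>v \<in> D. neumann_graph_norm \<Omega> (\<lambda>x. u x - v x) < \<epsilon>)"

end

theory Submission
  imports Defs "HOL-Real_Asymp.Real_Asymp"
begin

text \<open>
  Let \<open>b\<close> be one of the fields. The hypotheses force \<open>b\<close> to generate a flow of isometries of \<open>\<Omega>\<close>, and
  everything commutes with isometries.

  The field is affine with a skew linear part. Let \<open>S\<close> be the symmetric gradient of \<open>b\<close>, with entries
  \<open>\<partial>\<^sub>i b\<^sup>j + \<partial>\<^sub>j b\<^sup>i\<close>. Because of \<open>cond_iii\<close> the divergence of \<open>S b\<close> is \<open>\<bar>S\<bar>\<^sup>2 / 2\<close>, and \<open>cond_iv\<close> says that \<open>S b\<close> is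
  tangential to the boundary, so the divergence theorem gives \<open>S = 0\<close> (\<open>symmetric_gradient_vanishes\<close>). On
  a connected set this means \<open>b x = A x + c\<close> with \<open>A\<close> skew (\<open>killing_imp_affine\<close>).
  The divergence theorem is needed for tangential fields \<open>F\<close> only (\<open>divergence_theorem_tangential\<close>). It is
  obtained with cutoffs that vanish near the boundary, whose derivatives along \<open>F\<close> stay bounded because
  the product of \<open>F\<close> with the gradient of a defining function \<open>\<rho>\<close> is bounded by \<open>C * \<bar>\<rho>\<bar>\<close> (\<open>boundary_estimate\<close>).

  The flow of \<open>b\<close> acts by isometries on \<open>\<Omega>\<close>. It consists of isometries because \<open>A\<close> is skew, and by
  \<open>cond_i\<close> it does not leave \<open>\<Omega>\<close>: the same estimate is a differential inequality for \<open>\<rho>\<close> along a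
  trajectory (\<open>tangential_curve_stays\<close>). So the operators \<open>T t u = u \<circ> flow t\<close> form a group that preserves
  the inner products of \<open>L\<^sup>2(\<Omega>)\<close> and of \<open>H\<^sup>1(\<Omega>)\<close> (\<open>T_inner\<close>, \<open>T_h1\<close>), and the derivative of \<open>T t u\<close> at \<open>t = 0\<close> is, weakly, \<open>B u\<close>
  for every \<open>u\<close> in \<open>H\<^sup>1(\<Omega>)\<close> (\<open>T_H1_DERIV\<close>). Consequently \<open>B\<close> is skew symmetric on \<open>H\<^sup>1(\<Omega>)\<close>, so \<open>H\<^sup>1(\<Omega>)\<close> is contained in the domain of its adjoint.

  Let \<open>R = (1 - \<Delta>)\<^sup>-\<^sup>1\<close> be the resolvent of the Neumann Laplacian, given by Riesz' theorem in \<open>H\<^sup>1(\<Omega>)\<close>. It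
  commutes with \<open>T t\<close>, and differentiating gives \<open>B R f = R B f\<close> for test functions \<open>f\<close>
  (\<open>B_commutes_with_resolvent\<close>). As \<open>\<Delta>R f = R f - f\<close>, this says \<open>B \<Delta>u = \<Delta>B u\<close> for \<open>u = R f\<close>. The subspace
  is the set of all \<open>u\<close> for which both sides make sense and agree. It contains \<open>R f\<close> for all test
  functions \<open>f\<close>; these are dense in \<open>L\<^sup>2(\<Omega>)\<close>, and \<open>R\<close> maps \<open>L\<^sup>2(\<Omega>)\<close> continuously onto the domain of the
  Laplacian with its graph norm, so the subspace is a core (\<open>core_dense\<close>).
\<close>

section \<open>Smooth functions\<close>

lemma continuous_on_compact_bounded:
  fixes f :: "'a::topological_space \<Rightarrow> 'b::real_normed_vector"
  assumes "compact S" "continuous_on S f"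
  obtains B where "B > 0" "\<And>x. x \<in> S \<Longrightarrow> norm (f x) \<le> B"
  using compact_imp_bounded[OF compact_continuous_image[OF assms(2,1)]] by (force simp: bounded_pos)

lemma partial_deriv_eq:
  assumes "(f has_derivative f') (at x)"
  shows "partial_deriv j f x = f' (axis j 1)"
  using frechet_derivative_at[OF assms] by (simp add: partial_deriv_def)

lemma linear_eq_inner:
  fixes f :: "real^'n::finite \<Rightarrow> real"
  assumes "linear f"
  shows "f h = (\<chi> j. f (axis j 1)) \<bullet> h"
proof -
  have "f h = f (\<Sum>j\<in>UNIV. h $ j *\<^sub>R axis j 1)"
    by (simp add: basis_expansion flip: scalar_mult_eq_scaleR)
  also have "\<dots> = (\<Sum>j\<in>UNIV. h $ j * f (axis j 1))"
    using assms by (simp add: linear_sum linear_scale)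
  finally show ?thesis by (simp add: inner_vec_def mult.commute)
qed

lemma gradient_has_derivative:
  assumes "f differentiable (at x)"
  shows "(f has_derivative (\<lambda>h. gradient f x \<bullet> h)) (at x)"
proof -
  have d: "(f has_derivative frechet_derivative f (at x)) (at x)"
    using assms by (simp add: frechet_derivative_works)
  have "linear (frechet_derivative f (at x))"
    using d by (rule has_derivative_linear)
  then have "frechet_derivative f (at x) = (\<lambda>h. gradient f x \<bullet> h)"
    unfolding gradient_def partial_deriv_def by (intro ext linear_eq_inner)
  with d show ?thesis by simp
qed

lemma partial_deriv_cong_open:
  assumes "open U" "x \<in> U" "\<And>y. y \<in> U \<Longrightarrow> f y = g y"
  shows "partial_deriv j f x = partial_deriv j g x"
proof -
  have "(f has_derivative D) (at x) = (g has_derivative D) (at x)" for D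
  proof
    assume "(f has_derivative D) (at x)"
    then show "(g has_derivative D) (at x)"
      by (rule has_derivative_transform_within_open[OF _ assms(1,2)]) (use assms(3) in simp)
  next
    assume "(g has_derivative D) (at x)"
    then show "(f has_derivative D) (at x)"
      by (rule has_derivative_transform_within_open[OF _ assms(1,2)]) (use assms(3) in simp)
  qed
  then show ?thesis by (simp add: partial_deriv_def frechet_derivative_def)
qed

lemma differentiable_cong_open:
  assumes "open U" "x \<in> U" "\<And>y. y \<in> U \<Longrightarrow> f y = g y" "f differentiable (at x)"
  shows "g differentiable (at x)"
proof -
  obtain D where "(f has_derivative D) (at x)" using assms(4) unfolding differentiable_def by blast
  then have "(g has_derivative D) (at x)"
    by (rule has_derivative_transform_within_open[OF _ assms(1,2)]) (use assms(3) in simp)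
  then show ?thesis by (rule differentiableI)
qed

lemma has_derivative_matrix:
  fixes F :: "real^'n::finite \<Rightarrow> real^'m::finite"
  assumes "\<And>i. ((\<lambda>x. F x $ i) has_derivative (\<lambda>h. D $ i \<bullet> h)) (at x)"
  shows "(F has_derivative (\<lambda>h. D *v h)) (at x)"
  unfolding has_derivative_componentwise_within[of F]
proof
  fix e :: "real^'m" assume "e \<in> Basis"
  then obtain i where "e = axis i 1" by (auto simp: Basis_vec_def)
  then show "((\<lambda>x. F x \<bullet> e) has_derivative (\<lambda>h. (D *v h) \<bullet> e)) (at x)"
    using assms[of i] by (simp add: inner_axis matrix_vector_mul_component)
qed

lemma norm_matrix_vector_le:
  fixes A :: "real^'n::finite^'m::finite"
  shows "norm (A *v h) \<le> real CARD('m) * norm A * norm h"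
proof -
  have "norm (A *v h) \<le> (\<Sum>i\<in>UNIV. \<bar>(A *v h) $ i\<bar>)" by (rule norm_le_l1_cart)
  also have "\<dots> \<le> (\<Sum>i\<in>(UNIV::'m set). norm A * norm h)"
  proof (rule sum_mono)
    fix i
    have "\<bar>(A *v h) $ i\<bar> \<le> norm (A $ i) * norm h"
      unfolding matrix_vector_mul_component by (rule Cauchy_Schwarz_ineq2)
    also have "\<dots> \<le> norm A * norm h" by (intro mult_right_mono Finite_Cartesian_Product.norm_nth_le norm_ge_zero)
    finally show "\<bar>(A *v h) $ i\<bar> \<le> norm A * norm h" .
  qed
  finally show ?thesis by simp
qed

lemma line_has_derivative:
  fixes f :: "real^'n::finite \<Rightarrow> real"
  assumes "f differentiable (at (x + s *\<^sub>R h))"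
  shows "((\<lambda>s. f (x + s *\<^sub>R h)) has_real_derivative gradient f (x + s *\<^sub>R h) \<bullet> h) (at s)"
proof -
  have "((\<lambda>s. x + s *\<^sub>R h) has_derivative (\<lambda>t. t *\<^sub>R h)) (at s)"
    by (auto intro!: derivative_eq_intros)
  from diff_chain_at[OF this gradient_has_derivative[OF assms]] show ?thesis
    by (simp add: o_def has_field_derivative_def mult.commute[of _ "gradient f _ \<bullet> h"])
qed

lemma partial_line:
  fixes f :: "real^'n::finite \<Rightarrow> real"
  assumes "f differentiable (at (x + s *\<^sub>R axis i 1))"
  shows "((\<lambda>s. f (x + s *\<^sub>R axis i 1)) has_real_derivative partial_deriv i f (x + s *\<^sub>R axis i 1)) (at s)"
  using line_has_derivative[OF assms] by (simp add: inner_axis gradient_def)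

lemma Ck_on_Suc_UNIV:
  "Ck_on (Suc k) UNIV f \<longleftrightarrow> (\<forall>x. f differentiable (at x)) \<and> (\<forall>j. Ck_on k UNIV (partial_deriv j f))"
  by (auto simp: differentiable_on_def intro!: continuous_at_imp_continuous_on differentiable_imp_continuous_within)

lemma Ck_on_mono_Suc: "Ck_on (Suc k) U f \<Longrightarrow> Ck_on k U f"
  by (induction k arbitrary: f) auto

lemma Ck_on_const: "Ck_on k UNIV (\<lambda>x::real^'n::finite. c)"
proof (induction k arbitrary: c)
  case (Suc k)
  have "partial_deriv j (\<lambda>x::real^'n. c) = (\<lambda>x. 0)" for j
    by (intro ext) (subst partial_deriv_eq[OF has_derivative_const], simp)
  with Suc show ?case by simp
qed simp

lemma partial_deriv_add:
  assumes "f differentiable (at x)" "g differentiable (at x)"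
  shows "partial_deriv j (\<lambda>x. f x + g x) x = partial_deriv j f x + partial_deriv j g x"
  using has_derivative_add[OF assms[THEN gradient_has_derivative]]
  by (subst partial_deriv_eq, assumption) (simp add: inner_axis gradient_def)

lemma partial_deriv_mult:
  assumes "f differentiable (at x)" "g differentiable (at x)"
  shows "partial_deriv j (\<lambda>x. f x * g x) x = f x * partial_deriv j g x + partial_deriv j f x * g x"
  using has_derivative_mult[OF assms[THEN gradient_has_derivative]]
  by (subst partial_deriv_eq, assumption) (simp add: inner_axis gradient_def)

lemma Ck_on_add: "Ck_on k UNIV f \<Longrightarrow> Ck_on k UNIV g \<Longrightarrow> Ck_on k UNIV (\<lambda>x. f x + g x)"
proof (induction k arbitrary: f g)
  case (Suc k)
  then have d: "f differentiable (at x)" "g differentiable (at x)" for x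
    unfolding Ck_on_Suc_UNIV by auto
  have "partial_deriv j (\<lambda>x. f x + g x) = (\<lambda>x. partial_deriv j f x + partial_deriv j g x)" for j
    using d by (intro ext partial_deriv_add)
  with Suc d show ?case unfolding Ck_on_Suc_UNIV by simp
qed (auto intro: continuous_intros)

lemma Ck_on_mult: "Ck_on k UNIV f \<Longrightarrow> Ck_on k UNIV g \<Longrightarrow> Ck_on k UNIV (\<lambda>x. f x * g x)"
proof (induction k arbitrary: f g)
  case (Suc k)
  then have d: "f differentiable (at x)" "g differentiable (at x)" for x
    unfolding Ck_on_Suc_UNIV by auto
  have "partial_deriv j (\<lambda>x. f x * g x) = (\<lambda>x. f x * partial_deriv j g x + partial_deriv j f x * g x)" for j
    using d by (intro ext partial_deriv_mult)
  moreover have "Ck_on k UNIV f" "Ck_on k UNIV g" using Suc.prems by (auto intro: Ck_on_mono_Suc)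
  ultimately show ?case using Suc d unfolding Ck_on_Suc_UNIV by (auto intro!: Ck_on_add)
qed (auto intro: continuous_intros)

lemma smooth_const: "smooth_on UNIV (\<lambda>x. c)"
  by (simp add: smooth_on_def Ck_on_const)

lemma smooth_add: "smooth_on UNIV f \<Longrightarrow> smooth_on UNIV g \<Longrightarrow> smooth_on UNIV (\<lambda>x. f x + g x)"
  by (simp add: smooth_on_def Ck_on_add)

lemma smooth_mult: "smooth_on UNIV f \<Longrightarrow> smooth_on UNIV g \<Longrightarrow> smooth_on UNIV (\<lambda>x. f x * g x)"
  by (simp add: smooth_on_def Ck_on_mult)

lemma smooth_sum: "(\<And>i. i \<in> I \<Longrightarrow> smooth_on UNIV (f i)) \<Longrightarrow> smooth_on UNIV (\<lambda>x. \<Sum>i\<in>I. f i x)"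
  by (induction I rule: infinite_finite_induct) (auto intro: smooth_const smooth_add)

lemma smooth_power: "smooth_on UNIV f \<Longrightarrow> smooth_on UNIV (\<lambda>x. f x ^ m)"
  by (induction m) (auto intro: smooth_const smooth_mult)

lemma smooth_on_differentiable: "smooth_on UNIV f \<Longrightarrow> f differentiable (at x)"
  unfolding smooth_on_def using Ck_on_Suc_UNIV by blast

lemma smooth_on_continuous: "smooth_on U f \<Longrightarrow> continuous_on U f"
  unfolding smooth_on_def by (metis Ck_on.simps(1))

lemma smooth_partial: "smooth_on U f \<Longrightarrow> smooth_on U (partial_deriv j f)"
  unfolding smooth_on_def by (metis Ck_on.simps(2))

lemma smooth_on_differentiable_at:
  assumes "smooth_on U f" "open U" "x \<in> U"
  shows "f differentiable (at x)"
proof -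
  have "Ck_on (Suc 0) U f" using assms(1) by (simp add: smooth_on_def del: Ck_on.simps)
  then have "f differentiable_on U" by simp
  then show ?thesis using assms(2,3) by (simp add: differentiable_on_eq_differentiable_at)
qed

lemma smooth_on_gradient_continuous: "smooth_on U f \<Longrightarrow> continuous_on U (gradient f)"
  unfolding gradient_def by (intro continuous_on_vec_lambda smooth_on_continuous smooth_partial)

lemma smooth_nth: "smooth_on UNIV (\<lambda>x::real^'n::finite. x $ i)"
proof -
  have d: "((\<lambda>x::real^'n. x $ i) has_derivative (\<lambda>h. h $ i)) (at x)" for x
    by (rule bounded_linear_imp_has_derivative) (rule bounded_linear_vec_nth)
  have "Ck_on k UNIV (\<lambda>x::real^'n. x $ i)" for k
  proof (cases k)
    case (Suc l)
    have "partial_deriv j (\<lambda>x::real^'n. x $ i) = (\<lambda>x. axis j 1 $ i)" for j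
      by (intro ext) (rule partial_deriv_eq[OF d])
    then show ?thesis unfolding Suc Ck_on_Suc_UNIV
      using differentiableI[OF d] by (auto intro: Ck_on_const)
  qed (auto intro: continuous_intros)
  then show ?thesis by (simp add: smooth_on_def)
qed

lemma has_derivative_affine:
  fixes P :: "real^'n::finite^'m::finite"
  shows "((\<lambda>x. P *v x + q) has_derivative (\<lambda>h. P *v h)) (at x)"
  by (auto intro!: derivative_eq_intros bounded_linear_imp_has_derivative simp: matrix_vector_mul_bounded_linear)

lemma partial_deriv_affine:
  fixes P :: "real^'n::finite^'m::finite"
  assumes "f differentiable (at (P *v x + q))"
  shows "partial_deriv j (\<lambda>x. f (P *v x + q)) x = (\<Sum>k\<in>UNIV. P $ k $ j * partial_deriv k f (P *v x + q))"
proof -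
  have "((\<lambda>x. f (P *v x + q)) has_derivative (\<lambda>h. gradient f (P *v x + q) \<bullet> (P *v h))) (at x)"
    using diff_chain_at[OF has_derivative_affine gradient_has_derivative[OF assms]] by (simp add: o_def)
  then show ?thesis
    by (subst partial_deriv_eq, assumption)
      (simp add: inner_vec_def gradient_def matrix_vector_mult_basis column_def mult.commute)
qed

text \<open>
  The chain rule writes the derivatives of the composition as combinations of compositions of the
  derivatives of \<open>f\<close> with the same affine map, so the order of differentiability is lifted by
  induction over all \<open>f\<close> at once.
\<close>

lemma smooth_affine:
  fixes P :: "real^'n::finite^'m::finite"
  assumes "smooth_on UNIV f"
  shows "smooth_on UNIV (\<lambda>x. f (P *v x + q))"
proof -
  have "Ck_on k UNIV (\<lambda>x. f (P *v x + q))" if "smooth_on UNIV f" for k f using that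
  proof (induction k arbitrary: f)
    case 0
    have "continuous_on UNIV (\<lambda>x. P *v x + q)"
      by (intro continuous_intros matrix_vector_mult_linear_continuous_on)
    with 0 show ?case using continuous_on_compose2[OF smooth_on_continuous[OF 0]] by auto
  next
    case (Suc k)
    have d: "f differentiable (at x)" for x using Suc.prems smooth_on_differentiable by blast
    have p: "partial_deriv j (\<lambda>x. f (P *v x + q)) = (\<lambda>x. \<Sum>k\<in>UNIV. P $ k $ j * partial_deriv k f (P *v x + q))" for j
      by (intro ext partial_deriv_affine d)
    have "(\<lambda>x. f (P *v x + q)) differentiable (at x)" for x
      using differentiable_chain_at[OF differentiableI[OF has_derivative_affine] d] by (simp add: o_def)
    moreover have "Ck_on k UNIV (\<lambda>x. \<Sum>i\<in>I. P $ i $ j * partial_deriv i f (P *v x + q))" if "finite I" for j I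
      using that
    proof (induction I)
      case (insert i I)
      then show ?case
        using Suc.IH[OF smooth_partial[OF Suc.prems]] by (simp add: Ck_on_add Ck_on_const Ck_on_mult)
    qed (simp add: Ck_on_const)
    ultimately show ?case unfolding Ck_on_Suc_UNIV p by auto
  qed
  with assms show ?thesis by (simp add: smooth_on_def)
qed

section \<open>Bump functions\<close>

text \<open>
  All derivatives of \<open>exp (- 1 / s)\<close>, extended by \<open>0\<close> to \<open>s \<le> 0\<close>, are linear combinations of
  these functions. With the whole family at hand, smoothness is an induction on the order.
\<close>

definition flat :: "nat \<Rightarrow> real \<Rightarrow> real" where
  "flat m s = (if s \<le> 0 then 0 else inverse s ^ m * exp (- inverse s))"

lemma flat_tendsto_0: "(flat m \<longlongrightarrow> 0) (at_right 0)"
proof -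
  have "((\<lambda>y::real. y ^ m / exp y) \<longlongrightarrow> 0) at_top" by (rule tendsto_power_div_exp_0)
  then have "((\<lambda>s::real. inverse s ^ m / exp (inverse s)) \<longlongrightarrow> 0) (at_right 0)"
    using filterlim_inverse_at_top_right by (rule filterlim_compose)
  then show ?thesis
    by (rule Lim_transform_eventually)
      (auto simp: flat_def exp_minus divide_inverse eventually_at_filter)
qed

lemma flat_DERIV: "(flat m has_real_derivative (- real m * flat (m+1) s + flat (m+2) s)) (at s)"
proof -
  consider "s < 0" | "s > 0" | "s = 0" by linarith
  then show ?thesis
  proof cases
    case 1
    have "((\<lambda>s::real. 0) has_real_derivative 0) (at s)" by simp
    then show ?thesis
      using has_field_derivative_transform_within_open[of "\<lambda>_. 0" 0 s "{..<0}" "flat m"] 1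
      by (auto simp: flat_def)
  next
    case 2
    have "((\<lambda>s::real. inverse s ^ m * exp (- inverse s)) has_real_derivative
       (real m * inverse s ^ (m - 1) * (- (inverse s ^ 2)) * exp (- inverse s) + inverse s ^ m * (exp (- inverse s) * inverse s ^ 2))) (at s)"
      using 2 by (auto intro!: derivative_eq_intros simp: power2_eq_square)
    moreover have e: "real m * inverse s ^ (m - 1) * (- (inverse s ^ 2)) = - real m * inverse s ^ (m+1)"
      by (cases m) (auto simp: power2_eq_square algebra_simps)
    moreover have "- real m * flat (m+1) s + flat (m+2) s = - real m * inverse s ^ (m+1) * exp (- inverse s) + inverse s ^ m * (exp (- inverse s) * inverse s ^ 2)"
      using 2 by (simp add: flat_def power2_eq_square algebra_simps)
    ultimately have "((\<lambda>s::real. inverse s ^ m * exp (- inverse s)) has_real_derivative (- real m * flat (m+1) s + flat (m+2) s)) (at s)"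
      by (simp only:)
    then show ?thesis
      by (rule has_field_derivative_transform_within_open[where S="{0<..}"]) (use 2 in \<open>auto simp: flat_def\<close>)
  next
    case 3
    have "((\<lambda>y. (flat m y - flat m 0) / (y - 0)) \<longlongrightarrow> 0) (at_right 0)"
      using flat_tendsto_0[of "m+1"]
      by (rule Lim_transform_eventually) (auto simp: flat_def eventually_at_filter field_simps)
    moreover have "((\<lambda>y. (flat m y - flat m 0) / (y - 0)) \<longlongrightarrow> 0) (at_left 0)"
      by (rule Lim_transform_eventually[where f="\<lambda>_. 0"]) (auto simp: flat_def eventually_at_filter)
    ultimately have "((\<lambda>y. (flat m y - flat m 0) / (y - 0)) \<longlongrightarrow> 0) (at 0)"
      by (simp add: filterlim_split_at)
    then show ?thesis using 3 by (simp add: has_field_derivative_iff flat_def)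
  qed
qed

lemma smooth_flat_compose:
  fixes q :: "real^'n::finite \<Rightarrow> real"
  assumes "smooth_on UNIV q"
  shows "smooth_on UNIV (\<lambda>x. flat m (q x))"
proof -
  have d: "((\<lambda>x. flat m (q x)) has_derivative (\<lambda>h. (- real m * flat (m+1) (q x) + flat (m+2) (q x)) * (gradient q x \<bullet> h))) (at x)" for m x
    using diff_chain_at[OF gradient_has_derivative[OF smooth_on_differentiable[OF assms]] flat_DERIV[unfolded has_field_derivative_def]]
    by (simp add: o_def)
  have p: "partial_deriv j (\<lambda>x. flat m (q x)) = (\<lambda>x. (- real m * flat (m+1) (q x) + flat (m+2) (q x)) * partial_deriv j q x)" for j m
    by (intro ext, subst partial_deriv_eq[OF d]) (simp add: inner_axis gradient_def)
  have "Ck_on k UNIV (\<lambda>x. flat m (q x))" for k m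
  proof (induction k arbitrary: m)
    case 0
    show ?case using d by (auto intro!: continuous_at_imp_continuous_on dest: has_derivative_continuous)
  next
    case (Suc k)
    have "Ck_on k UNIV (partial_deriv j q)" for j
      using smooth_partial[OF assms] by (simp add: smooth_on_def)
    moreover have "Ck_on k UNIV (\<lambda>x. - real m * flat (m+1) (q x) + flat (m+2) (q x))"
      by (intro Ck_on_add Ck_on_mult Ck_on_const Suc)
    ultimately show ?case unfolding Ck_on_Suc_UNIV p using differentiableI[OF d] Ck_on_mult by blast
  qed
  then show ?thesis by (simp add: smooth_on_def)
qed

lemma smooth_bump:
  fixes a :: "real^'n::finite"
  obtains \<beta> where "smooth_on UNIV \<beta>" "\<And>x. 0 \<le> \<beta> x" "\<And>x. \<beta> x \<le> 1" "\<And>x. \<beta> x \<noteq> 0 \<longleftrightarrow> x \<in> ball a r"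
proof (cases "r > 0")
  case True
  have n: "(norm (x - a))\<^sup>2 = (\<Sum>i\<in>UNIV. (x $ i + - a $ i)^2)" for x
    unfolding power2_norm_eq_inner inner_vec_def by (simp add: power2_eq_square)
  have "smooth_on UNIV (\<lambda>x. flat 0 (r^2 + (-1) * (\<Sum>i\<in>UNIV. (x $ i + - a $ i)^2)))"
    by (intro smooth_flat_compose smooth_add smooth_const smooth_mult smooth_sum smooth_power smooth_nth)
  then have s: "smooth_on UNIV (\<lambda>x. flat 0 (r^2 - (norm (x - a))\<^sup>2))" by (simp add: n)
  have "flat 0 s \<ge> 0" "flat 0 s \<le> 1" "flat 0 s \<noteq> 0 \<longleftrightarrow> s > 0" for s by (auto simp: flat_def)
  moreover have "r^2 - (norm (x - a))\<^sup>2 > 0 \<longleftrightarrow> x \<in> ball a r" for x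
  proof -
    have "r^2 - (norm (x - a))\<^sup>2 > 0 \<longleftrightarrow> norm (x - a) < r"
      using True power_strict_mono[of "norm (x - a)" r 2] power2_less_imp_less[of "norm (x - a)" r] by auto
    then show ?thesis by (simp add: dist_norm norm_minus_commute)
  qed
  ultimately show ?thesis using that[OF s] by auto
next
  case False
  then have "\<not> dist a x < r" for x using zero_le_dist[of a x] by linarith
  then show ?thesis using that[of "\<lambda>x. 0", OF smooth_const] by simp
qed

section \<open>Test functions\<close>

lemma test_functionsI:
  assumes "smooth_on UNIV \<phi>" "compact K" "K \<subseteq> \<Omega>" "\<And>x. x \<notin> K \<Longrightarrow> \<phi> x = 0"
  shows "\<phi> \<in> test_functions \<Omega>"
proof -
  have sub: "closure {x. \<phi> x \<noteq> 0} \<subseteq> K"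
    by (rule closure_minimal) (use assms(4) compact_imp_closed[OF assms(2)] in auto)
  then have "compact (K \<inter> closure {x. \<phi> x \<noteq> 0})"
    using assms(2) by (intro compact_Int_closed) auto
  with sub have "compact (closure {x. \<phi> x \<noteq> 0})" by (simp add: Int_absorb1)
  with sub assms(1,3) show ?thesis by (simp add: test_functions_def)
qed

lemma test_smooth: "\<phi> \<in> test_functions \<Omega> \<Longrightarrow> smooth_on UNIV \<phi>"
  by (simp add: test_functions_def)

lemma test_support:
  assumes "\<phi> \<in> test_functions \<Omega>"
  shows "\<exists>K. compact K \<and> K \<subseteq> \<Omega> \<and> (\<forall>x. x \<notin> K \<longrightarrow> \<phi> x = 0)"
proof (intro exI conjI allI impI)
  let ?K = "closure {x. \<phi> x \<noteq> 0}"
  show "compact ?K" "?K \<subseteq> \<Omega>" using assms by (simp_all add: test_functions_def)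
  show "\<phi> x = 0" if "x \<notin> ?K" for x using that closure_subset[of "{x. \<phi> x \<noteq> 0}"] by (metis (mono_tags, lifting) mem_Collect_eq subsetD)
qed

lemma test_mult_left:
  assumes "smooth_on UNIV f" "\<phi> \<in> test_functions \<Omega>"
  shows "(\<lambda>x. f x * \<phi> x) \<in> test_functions \<Omega>"
proof -
  obtain K where "compact K" "K \<subseteq> \<Omega>" "\<forall>x. x \<notin> K \<longrightarrow> \<phi> x = 0"
    using test_support[OF assms(2)] by blast
  then show ?thesis
    using test_functionsI[OF smooth_mult[OF assms(1) test_smooth[OF assms(2)]], of K \<Omega>] by simp
qed

lemma test_scale: "\<phi> \<in> test_functions \<Omega> \<Longrightarrow> (\<lambda>x. c * \<phi> x) \<in> test_functions \<Omega>"
  using test_mult_left[OF smooth_const, of \<phi> \<Omega> c] by blast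

lemma test_zero: "(\<lambda>x. 0) \<in> test_functions \<Omega>"
  using test_functionsI[OF smooth_const, of "{}" \<Omega> 0] by simp

lemma test_add:
  assumes "\<phi> \<in> test_functions \<Omega>" "\<psi> \<in> test_functions \<Omega>"
  shows "(\<lambda>x. \<phi> x + \<psi> x) \<in> test_functions \<Omega>"
proof -
  obtain K where "compact K" "K \<subseteq> \<Omega>" "\<forall>x. x \<notin> K \<longrightarrow> \<phi> x = 0"
    using test_support[OF assms(1)] by blast
  moreover obtain L where "compact L" "L \<subseteq> \<Omega>" "\<forall>x. x \<notin> L \<longrightarrow> \<psi> x = 0"
    using test_support[OF assms(2)] by blast
  ultimately show ?thesis
    using test_functionsI[OF smooth_add[OF assms[THEN test_smooth]], of "K \<union> L" \<Omega>] compact_Un by auto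
qed

lemma test_sum:
  "(\<And>i. i \<in> I \<Longrightarrow> f i \<in> test_functions \<Omega>) \<Longrightarrow> (\<lambda>x. \<Sum>i\<in>I. f i x) \<in> test_functions \<Omega>"
  by (induction I rule: infinite_finite_induct) (simp_all add: test_zero test_add)

lemma test_partial:
  assumes "\<phi> \<in> test_functions \<Omega>"
  shows "partial_deriv j \<phi> \<in> test_functions \<Omega>"
proof -
  obtain K where K: "compact K" "K \<subseteq> \<Omega>" "\<forall>x. x \<notin> K \<longrightarrow> \<phi> x = 0"
    using test_support[OF assms] by blast
  then have op: "open (- K)" using compact_imp_closed by blast
  have "partial_deriv j \<phi> x = 0" if "x \<notin> K" for x
  proof -
    have "(\<phi> has_derivative (\<lambda>h. 0)) (at x)"
      by (rule has_derivative_transform_within_open[OF has_derivative_const op]) (use that K in auto)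
    from partial_deriv_eq[OF this] show ?thesis .
  qed
  with K show ?thesis using test_functionsI[OF smooth_partial[OF test_smooth[OF assms]], of K \<Omega> j] by simp
qed

lemma test_continuous: "\<phi> \<in> test_functions \<Omega> \<Longrightarrow> continuous_on S \<phi>"
  using smooth_on_continuous[OF test_smooth] continuous_on_subset by blast

lemma test_bounded:
  assumes "\<phi> \<in> test_functions \<Omega>"
  shows "\<exists>M>0. \<forall>x. \<bar>\<phi> x\<bar> \<le> M"
proof -
  obtain K where K: "compact K" "K \<subseteq> \<Omega>" "\<forall>x. x \<notin> K \<longrightarrow> \<phi> x = 0"
    using test_support[OF assms] by blast
  obtain M where M: "M > 0" "\<And>x. x \<in> K \<Longrightarrow> norm (\<phi> x) \<le> M"
    by (rule continuous_on_compact_bounded[OF K(1) test_continuous[OF assms]]) blast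
  have "\<bar>\<phi> x\<bar> \<le> M" for x
    using M K(3) by (cases "x \<in> K") auto
  with M(1) show ?thesis by blast
qed

section \<open>Riesz representation in spaces of functions\<close>

text \<open>
  The discriminant criterion, also when the leading coefficient vanishes, because it is applied to
  forms that are only semidefinite.
\<close>

lemma nonneg_quadratic_imp:
  fixes a b c :: real
  assumes "\<And>t. 0 \<le> a + 2 * t * b + t\<^sup>2 * c"
  shows "b\<^sup>2 \<le> a * c"
proof (cases "c = 0")
  case True
  have "b = 0"
  proof (rule ccontr)
    assume "b \<noteq> 0"
    then show False using assms[of "- (a + 1) / (2 * b)"] True by (simp add: field_simps)
  qed
  with True show ?thesis by simp
next
  case False
  have "c \<ge> 0"
  proof (rule ccontr)
    assume "\<not> c \<ge> 0"
    then have "c < 0" by simp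
    have a: "a \<ge> 0" using assms[of 0] by simp
    define t where "t = sqrt ((a + 1) / - c)"
    have t2: "t\<^sup>2 * c = - (a + 1)" using \<open>c < 0\<close> a by (simp add: t_def divide_nonneg_neg field_simps)
    have "0 \<le> a + 2 * t * b + t\<^sup>2 * c" "0 \<le> a + 2 * (-t) * b + (-t)\<^sup>2 * c" by (rule assms)+
    then show False using t2 by simp
  qed
  with False have "c > 0" by simp
  have "0 \<le> a + 2 * (- b / c) * b + (- b / c)\<^sup>2 * c" by (rule assms)
  also have "\<dots> = a - b\<^sup>2 / c" using \<open>c > 0\<close> by (simp add: power2_eq_square field_simps)
  finally show ?thesis using \<open>c > 0\<close> by (simp add: field_simps)
qed

text \<open>
  The form may vanish at nonzero functions: \<open>L\<^sup>2(\<Omega>)\<close> and \<open>H\<^sup>1(\<Omega>)\<close> are sets of functions here, not of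
  classes modulo null sets. Completeness accordingly says nothing about uniqueness of limits.
\<close>

locale quadratic_space =
  fixes V :: "('a \<Rightarrow> real) set" and Q :: "('a \<Rightarrow> real) \<Rightarrow> ('a \<Rightarrow> real) \<Rightarrow> real"
  assumes zero: "(\<lambda>x. 0) \<in> V"
    and comb: "u \<in> V \<Longrightarrow> v \<in> V \<Longrightarrow> (\<lambda>x. u x + c * v x) \<in> V"
    and sym: "u \<in> V \<Longrightarrow> v \<in> V \<Longrightarrow> Q u v = Q v u"
    and lin: "u \<in> V \<Longrightarrow> v \<in> V \<Longrightarrow> w \<in> V \<Longrightarrow> Q (\<lambda>x. u x + c * v x) w = Q u w + c * Q v w"
    and nonneg: "u \<in> V \<Longrightarrow> 0 \<le> Q u u"
begin

definition nrm :: "('a \<Rightarrow> real) \<Rightarrow> real" where "nrm u = sqrt (Q u u)"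

lemma nrm_ge0: "u \<in> V \<Longrightarrow> 0 \<le> nrm u" by (simp add: nrm_def nonneg)

lemma nrm_sq: "u \<in> V \<Longrightarrow> (nrm u)\<^sup>2 = Q u u" by (simp add: nrm_def nonneg)

lemma diff: "u \<in> V \<Longrightarrow> v \<in> V \<Longrightarrow> (\<lambda>x. u x - v x) \<in> V"
  using comb[of u v "-1"] by simp

lemma add: "u \<in> V \<Longrightarrow> v \<in> V \<Longrightarrow> (\<lambda>x. u x + v x) \<in> V"
  using comb[of u v 1] by simp

lemma scale: "v \<in> V \<Longrightarrow> (\<lambda>x. c * v x) \<in> V"
  using comb[OF zero, of v c] by simp

lemma lin_diff: "u \<in> V \<Longrightarrow> v \<in> V \<Longrightarrow> w \<in> V \<Longrightarrow> Q (\<lambda>x. u x - v x) w = Q u w - Q v w"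
  using lin[of u v w "-1"] by simp

lemma lin_zero: "w \<in> V \<Longrightarrow> Q (\<lambda>x. 0) w = 0"
  using lin[OF zero zero, of w 1] by simp

lemma lin_scale: "v \<in> V \<Longrightarrow> w \<in> V \<Longrightarrow> Q (\<lambda>x. c * v x) w = c * Q v w"
  using lin[OF zero, of v w c] lin_zero[of w] by simp

lemma lin2: "u \<in> V \<Longrightarrow> v \<in> V \<Longrightarrow> w \<in> V \<Longrightarrow> Q w (\<lambda>x. u x + c * v x) = Q w u + c * Q w v"
  using lin[of u v w c] sym[of w "\<lambda>x. u x + c * v x"] sym[of w u] sym[of w v] comb[of u v c] by simp

lemma lin2_diff: "u \<in> V \<Longrightarrow> v \<in> V \<Longrightarrow> w \<in> V \<Longrightarrow> Q w (\<lambda>x. u x - v x) = Q w u - Q w v"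
  using lin2[of u v w "-1"] by simp

lemma expand: "u \<in> V \<Longrightarrow> v \<in> V \<Longrightarrow>
  Q (\<lambda>x. u x + t * v x) (\<lambda>x. u x + t * v x) = Q u u + 2 * t * Q u v + t\<^sup>2 * Q v v"
  using lin[of u v "\<lambda>x. u x + t * v x" t] lin2[of u v u t] lin2[of u v v t] comb[of u v t] sym[of u v]
  by (simp add: power2_eq_square algebra_simps)

lemma cauchy_schwarz: assumes "u \<in> V" "v \<in> V" shows "\<bar>Q u v\<bar> \<le> nrm u * nrm v"
proof -
  have "(Q u v)\<^sup>2 \<le> Q u u * Q v v"
    by (rule nonneg_quadratic_imp) (use expand[OF assms, symmetric] nonneg comb assms in simp)
  then have "sqrt ((Q u v)\<^sup>2) \<le> sqrt (Q u u * Q v v)" by (rule real_sqrt_le_mono)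
  then show ?thesis by (simp add: nrm_def real_sqrt_mult)
qed

lemma triangle: assumes "u \<in> V" "v \<in> V" shows "nrm (\<lambda>x. u x + v x) \<le> nrm u + nrm v"
proof (rule power2_le_imp_le)
  have "(nrm (\<lambda>x. u x + v x))\<^sup>2 = Q u u + 2 * Q u v + Q v v"
    using expand[OF assms, of 1] add[OF assms] by (simp add: nrm_sq)
  also have "\<dots> \<le> (nrm u + nrm v)\<^sup>2"
    using cauchy_schwarz[OF assms] assms by (simp add: power2_sum nrm_sq)
  finally show "(nrm (\<lambda>x. u x + v x))\<^sup>2 \<le> (nrm u + nrm v)\<^sup>2" .
qed (use nrm_ge0 assms in auto)

lemma triangle3:
  assumes "u \<in> V" "v \<in> V" "w \<in> V"
  shows "nrm (\<lambda>x. u x - w x) \<le> nrm (\<lambda>x. u x - v x) + nrm (\<lambda>x. v x - w x)"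
  using triangle[OF diff[OF assms(1,2)] diff[OF assms(2,3)]] by simp

lemma nrm_minus: assumes "u \<in> V" "v \<in> V" shows "nrm (\<lambda>x. u x - v x) = nrm (\<lambda>x. v x - u x)"
  using expand[OF assms, of "-1"] expand[OF assms(2,1), of "-1"] sym[OF assms] by (simp add: nrm_def)

end

locale complete_quadratic_space = quadratic_space +
  assumes complete: "(\<And>n. f n \<in> V) \<Longrightarrow>
      (\<And>e. e > 0 \<Longrightarrow> \<exists>N::nat. \<forall>m\<ge>N. \<forall>n\<ge>N. nrm (\<lambda>x. f m x - f n x) < e) \<Longrightarrow>
      \<exists>u\<in>V. (\<lambda>n. nrm (\<lambda>x. f n x - u x)) \<longlonglongrightarrow> 0"
begin

text \<open>
  The representing element minimises \<open>Q v v - 2 * l v\<close>. Minimising sequences are Cauchy by the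
  parallelogram identity, and at their limit the first variation vanishes in every direction.
\<close>

theorem riesz_representation:
  assumes l: "\<And>u v c. u \<in> V \<Longrightarrow> v \<in> V \<Longrightarrow> l (\<lambda>x. u x + c * v x) = l u + c * l v"
    and bound: "\<And>v. v \<in> V \<Longrightarrow> \<bar>l v\<bar> \<le> C * nrm v"
  shows "\<exists>u\<in>V. \<forall>v\<in>V. Q u v = l v"
proof -
  define J where "J v = Q v v - 2 * l v" for v
  define m where "m = Inf (J ` V)"
  have J_exp: "J (\<lambda>x. u x + t * v x) = J u + 2 * t * (Q u v - l v) + t\<^sup>2 * Q v v" if "u \<in> V" "v \<in> V" for u v t
    using that by (simp add: J_def expand l algebra_simps)
  have "- C\<^sup>2 \<le> J v" if "v \<in> V" for v
  proof -
    have "l v \<le> C * nrm v" using bound[OF that] by linarith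
    moreover have "0 \<le> (nrm v - C)\<^sup>2" by simp
    ultimately show ?thesis using that by (simp add: J_def power2_diff mult.commute[of C] flip: nrm_sq)
  qed
  then have bdd: "bdd_below (J ` V)" by (auto intro!: bdd_belowI2)
  have m_le: "m \<le> J v" if "v \<in> V" for v unfolding m_def using that bdd by (intro cInf_lower) auto
  have "\<exists>v\<in>V. J v < m + inverse (real (Suc n))" for n
  proof -
    have "Inf (J ` V) < m + inverse (real (Suc n))" by (simp add: m_def)
    then show ?thesis using bdd zero by (subst (asm) cInf_less_iff) auto
  qed
  then obtain f where fV: "\<And>n. f n \<in> V" and fm: "\<And>n. J (f n) < m + inverse (real (Suc n))" by metis
  (* The parallelogram identity, read off from J at f i, at f j and at their midpoint. *)
  have par: "(nrm (\<lambda>x. f i x - f j x))\<^sup>2 \<le> 2 * inverse (real (Suc i)) + 2 * inverse (real (Suc j))" for i j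
  proof -
    let ?d = "\<lambda>x. f i x - f j x"
    have d: "?d \<in> V" by (rule diff[OF fV fV])
    have "J (f i) = J (f j) + 2 * (Q (f j) ?d - l ?d) + Q ?d ?d"
      using J_exp[OF fV d, of j 1] by simp
    moreover have "m \<le> J (f j) + (Q (f j) ?d - l ?d) + Q ?d ?d / 4"
      using J_exp[OF fV d, of j "1/2"] m_le[OF comb[OF fV d], of j "1/2"] by (simp add: power2_eq_square)
    moreover have "q \<le> 2 * a + 2 * b - 4 * m'" if "a = b + 2 * y + q" "m' \<le> b + y + q / 4" for a b m' y q :: real
      using that by linarith
    ultimately have "Q ?d ?d \<le> 2 * J (f i) + 2 * J (f j) - 4 * m" by blast
    with fm[of i] fm[of j] show ?thesis using nrm_sq[OF d] by linarith
  qed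
  have "\<exists>u\<in>V. (\<lambda>n. nrm (\<lambda>x. f n x - u x)) \<longlonglongrightarrow> 0"
  proof (rule complete[OF fV])
    fix e :: real assume "e > 0"
    then obtain N where N: "inverse (real (Suc N)) < e\<^sup>2 / 4"
      using reals_Archimedean[of "e\<^sup>2 / 4"] by auto
    show "\<exists>N. \<forall>m\<ge>N. \<forall>n\<ge>N. nrm (\<lambda>x. f m x - f n x) < e"
    proof (intro exI allI impI)
      fix i j assume "i \<ge> N" "j \<ge> N"
      then have "inverse (real (Suc i)) \<le> inverse (real (Suc N))" "inverse (real (Suc j)) \<le> inverse (real (Suc N))"
        by (auto intro!: le_imp_inverse_le)
      with par[of i j] N have "(nrm (\<lambda>x. f i x - f j x))\<^sup>2 < e\<^sup>2" by linarith
      then show "nrm (\<lambda>x. f i x - f j x) < e" using \<open>e > 0\<close> by (meson less_imp_le power2_less_imp_less)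
    qed
  qed
  then obtain u where u: "u \<in> V" and lim: "(\<lambda>n. nrm (\<lambda>x. f n x - u x)) \<longlonglongrightarrow> 0" by blast
  have "Q u v = l v" if v: "v \<in> V" for v
  proof -
    have "(\<lambda>n. Q (f n) v - Q u v) \<longlonglongrightarrow> 0"
    proof (rule Lim_null_comparison)
      show "\<forall>\<^sub>F n in sequentially. norm (Q (f n) v - Q u v) \<le> nrm (\<lambda>x. f n x - u x) * nrm v"
        using cauchy_schwarz[OF diff[OF fV u] v] by (simp add: lin_diff[OF fV u v])
      show "(\<lambda>n. nrm (\<lambda>x. f n x - u x) * nrm v) \<longlonglongrightarrow> 0"
        using lim by (rule tendsto_mult_left_zero)
    qed
    then have Qlim: "(\<lambda>n. Q (f n) v) \<longlonglongrightarrow> Q u v" by (simp add: LIM_zero_iff)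
    (* J (f n) exceeds the infimum by at most 1 / (n + 1), so J increases by no less than
       -1 / (n + 1) in the direction t v. *)
    have "0 \<le> 0 + 2 * t * (Q u v - l v) + t\<^sup>2 * Q v v" for t
    proof (rule tendsto_lowerbound)
      show "(\<lambda>n. inverse (real (Suc n)) + 2 * t * (Q (f n) v - l v) + t\<^sup>2 * Q v v) \<longlonglongrightarrow>
        0 + 2 * t * (Q u v - l v) + t\<^sup>2 * Q v v"
        by (intro tendsto_intros Qlim LIMSEQ_inverse_real_of_nat)
      show "\<forall>\<^sub>F n in sequentially. 0 \<le> inverse (real (Suc n)) + 2 * t * (Q (f n) v - l v) + t\<^sup>2 * Q v v"
      proof (intro always_eventually allI)
        fix n
        show "0 \<le> inverse (real (Suc n)) + 2 * t * (Q (f n) v - l v) + t\<^sup>2 * Q v v"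
          using m_le[OF comb[OF fV[of n] v, of t]] fm[of n] unfolding J_exp[OF fV v] by linarith
      qed
    qed simp
    then have "(Q u v - l v)\<^sup>2 \<le> 0 * Q v v" by (rule nonneg_quadratic_imp)
    then show ?thesis by simp
  qed
  with u show ?thesis by blast
qed

text \<open>
  Orthogonal projection onto the closure \<open>W\<close> of \<open>S\<close>: Riesz' theorem in the complete space \<open>W\<close> represents
  \<open>Q u\<close> by some \<open>p\<close>, and \<open>u - p\<close> is orthogonal to \<open>S\<close>.
\<close>

theorem dense_if_orthogonal_trivial:
  assumes S: "S \<subseteq> V" "(\<lambda>x. 0) \<in> S" "\<And>u v c. u \<in> S \<Longrightarrow> v \<in> S \<Longrightarrow> (\<lambda>x. u x + c * v x) \<in> S"
    and orth: "\<And>u. u \<in> V \<Longrightarrow> (\<And>s. s \<in> S \<Longrightarrow> Q u s = 0) \<Longrightarrow> Q u u = 0"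
    and u: "u \<in> V" and "e > 0"
  shows "\<exists>s\<in>S. nrm (\<lambda>x. u x - s x) < e"
proof -
  define W where "W = {v\<in>V. \<forall>e>0. \<exists>s\<in>S. nrm (\<lambda>x. v x - s x) < e}"
  have WV: "W \<subseteq> V" by (auto simp: W_def)
  have SV: "s \<in> V" if "s \<in> S" for s using S(1) that by auto
  have nrm0: "nrm (\<lambda>x. 0) = 0" using lin_zero[OF zero] by (simp add: nrm_def)
  have SW: "S \<subseteq> W"
  proof
    fix s assume s: "s \<in> S"
    then have "\<exists>s'\<in>S. nrm (\<lambda>x. s x - s' x) < e" if "e > 0" for e
      using that nrm0 by (intro bexI[of _ s]) simp_all
    with SV[OF s] show "s \<in> W" by (simp add: W_def)
  qed
  have comb': "(\<lambda>x. p x + c * q x) \<in> W" if p: "p \<in> W" and q: "q \<in> W" for p q c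
  proof -
    have pq: "p \<in> V" "q \<in> V" using p q WV by auto
    have "\<exists>s\<in>S. nrm (\<lambda>x. p x + c * q x - s x) < e" if "e > 0" for e
    proof -
      have "e / 2 > 0" using \<open>e > 0\<close> by simp
      then obtain s where s: "s \<in> S" "nrm (\<lambda>x. p x - s x) < e/2" using p unfolding W_def by blast
      have "e / (2 * (\<bar>c\<bar> + 1)) > 0" using \<open>e > 0\<close> by simp
      then obtain s' where s': "s' \<in> S" "nrm (\<lambda>x. q x - s' x) < e / (2 * (\<bar>c\<bar> + 1))" using q unfolding W_def by blast
      have d: "(\<lambda>x. q x - s' x) \<in> V" "(\<lambda>x. p x - s x) \<in> V" using pq s s' SV diff by auto
      have "nrm (\<lambda>x. c * (q x - s' x)) = \<bar>c\<bar> * nrm (\<lambda>x. q x - s' x)"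
      proof -
        have "Q (\<lambda>x. c * (q x - s' x)) (\<lambda>x. c * (q x - s' x)) = c\<^sup>2 * Q (\<lambda>x. q x - s' x) (\<lambda>x. q x - s' x)"
          using expand[OF zero d(1), of c] lin_zero[OF d(1)] lin_zero[OF zero] by simp
        then show ?thesis by (simp add: nrm_def real_sqrt_mult)
      qed
      also have "\<dots> \<le> (\<bar>c\<bar> + 1) * nrm (\<lambda>x. q x - s' x)"
        using nrm_ge0[OF d(1)] by (intro mult_right_mono) auto
      also have "\<dots> < e / 2" using s'(2) by (simp add: field_simps)
      finally have "nrm (\<lambda>x. (p x - s x) + c * (q x - s' x)) < e"
        using triangle[OF d(2) scale[OF d(1), of c]] s(2) by linarith
      moreover have "(\<lambda>x. (p x - s x) + c * (q x - s' x)) = (\<lambda>x. p x + c * q x - (s x + c * s' x))"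
        by (auto simp: algebra_simps)
      ultimately show ?thesis using S(3)[OF s(1) s'(1), of c] by (intro bexI[of _ "\<lambda>x. s x + c * s' x"]) simp_all
    qed
    with comb[OF pq] show ?thesis by (simp add: W_def)
  qed
  interpret W: complete_quadratic_space W Q
  proof -
    have q: "quadratic_space W Q"
    proof
      fix u v w :: "'a \<Rightarrow> real" and c :: real
      assume u: "u \<in> W" and v: "v \<in> W"
      then have uv: "u \<in> V" "v \<in> V" using WV by auto
      show "(\<lambda>x. u x + c * v x) \<in> W" by (rule comb'[OF u v])
      show "Q u v = Q v u" "0 \<le> Q u u" using uv by (rule sym) (rule nonneg[OF uv(1)])
      show "Q (\<lambda>x. u x + c * v x) w = Q u w + c * Q v w" if "w \<in> W"
        using lin[OF uv] that WV by auto
    qed (use S(2) SW in auto)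
    show "complete_quadratic_space W Q"
    proof (intro complete_quadratic_space.intro complete_quadratic_space_axioms.intro q)
      fix f :: "nat \<Rightarrow> 'a \<Rightarrow> real" assume f: "\<And>n. f n \<in> W"
        and c: "\<And>e. e > 0 \<Longrightarrow> \<exists>N. \<forall>m\<ge>N. \<forall>n\<ge>N. nrm (\<lambda>x. f m x - f n x) < e"
      have "\<exists>u\<in>V. (\<lambda>n. nrm (\<lambda>x. f n x - u x)) \<longlonglongrightarrow> 0" by (rule complete[OF _ c]) (use f WV in auto)
      then obtain w where w: "w \<in> V" "(\<lambda>n. nrm (\<lambda>x. f n x - w x)) \<longlonglongrightarrow> 0" by blast
      have "w \<in> W"
        unfolding W_def
      proof (intro CollectI conjI allI impI w(1))
        fix e :: real assume "e > 0"
        then have "\<forall>\<^sub>F n in sequentially. nrm (\<lambda>x. f n x - w x) < e/2" using w(2) by (intro order_tendstoD) auto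
        then obtain n where n: "nrm (\<lambda>x. f n x - w x) < e/2" using eventually_happens by force
        obtain s where s: "s \<in> S" "nrm (\<lambda>x. f n x - s x) < e/2" using f[of n] half_gt_zero[OF \<open>e > 0\<close>] unfolding W_def by blast
        have fn: "f n \<in> V" using f WV by auto
        have "nrm (\<lambda>x. w x - s x) < e"
          using triangle3[OF w(1) fn SV[OF s(1)]] nrm_minus[OF w(1) fn] n s(2) by linarith
        then show "\<exists>s\<in>S. nrm (\<lambda>x. w x - s x) < e" using s(1) by blast
      qed
      with w(2) show "\<exists>u\<in>W. (\<lambda>n. nrm (\<lambda>x. f n x - u x)) \<longlonglongrightarrow> 0" by blast
    qed
  qed
  have "\<exists>p\<in>W. \<forall>v\<in>W. Q p v = Q u v"
  proof (rule W.riesz_representation)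
    show "Q u (\<lambda>x. v x + c * w x) = Q u v + c * Q u w" if "v \<in> W" "w \<in> W" for v w c
      using lin2[OF _ _ u, of v w c] that WV by auto
    show "\<bar>Q u v\<bar> \<le> nrm u * nrm v" if "v \<in> W" for v
      using cauchy_schwarz[OF u, of v] that WV by auto
  qed
  then obtain p where p: "p \<in> W" "\<And>v. v \<in> W \<Longrightarrow> Q p v = Q u v" by blast
  have pV: "p \<in> V" using p WV by auto
  have "Q (\<lambda>x. u x - p x) (\<lambda>x. u x - p x) = 0"
  proof (rule orth[OF diff[OF u pV]])
    fix s assume "s \<in> S"
    then show "Q (\<lambda>x. u x - p x) s = 0" using lin_diff[OF u pV, of s] SV[of s] p(2)[of s] SW by auto
  qed
  then have z: "nrm (\<lambda>x. u x - p x) = 0" by (simp add: nrm_def)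
  obtain s where s: "s \<in> S" "nrm (\<lambda>x. p x - s x) < e" using p(1) \<open>e > 0\<close> unfolding W_def by blast
  then have "nrm (\<lambda>x. u x - s x) < e" using triangle3[OF u pV SV[OF s(1)]] z by linarith
  with s(1) show ?thesis by blast
qed

end

section \<open>The Hilbert space of square integrable functions\<close>

locale bounded_open =
  fixes \<Omega> :: "(real^'n::finite) set"
  assumes op: "open \<Omega>" and bd: "bounded \<Omega>"
begin

abbreviation "M \<equiv> lebesgue_on \<Omega>"

lemma lmeas: "\<Omega> \<in> lmeasurable"
  using op bd by (rule lmeasurable_open[rotated])

lemma sets_Omega: "\<Omega> \<in> sets lebesgue"
  using lmeas by (rule fmeasurableD)

lemma compact_closure_Omega: "compact (closure \<Omega>)"
  using bd by (simp add: compact_eq_bounded_closed bounded_closure)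

lemma space_M: "space M = \<Omega>" by simp

lemma finite_M: "finite_measure M"
  using lmeas by (rule finite_measure_lebesgue_on)

lemma measurable_continuous: "continuous_on \<Omega> f \<Longrightarrow> f \<in> borel_measurable M"
  using continuous_imp_measurable_on_sets_lebesgue sets_Omega by blast

lemma integrable_bounded:
  fixes f :: "real^'n \<Rightarrow> real"
  assumes "f \<in> borel_measurable M" "\<And>x. x \<in> \<Omega> \<Longrightarrow> \<bar>f x\<bar> \<le> B"
  shows "integrable M f"
  by (rule finite_measure.integrable_const_bound[OF finite_M, where B=B])
    (use assms in \<open>auto intro!: AE_I2\<close>)

lemma L2_measurable: "u \<in> L2 \<Omega> \<Longrightarrow> u \<in> borel_measurable M" by (simp add: L2_def)

lemma L2_square: "u \<in> L2 \<Omega> \<Longrightarrow> integrable M (\<lambda>x. (u x)\<^sup>2)" by (simp add: L2_def)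

lemma L2_mult_integrable:
  assumes "u \<in> L2 \<Omega>" "v \<in> L2 \<Omega>"
  shows "integrable M (\<lambda>x. u x * v x)"
proof (rule Bochner_Integration.integrable_bound)
  show "integrable M (\<lambda>x. (u x)\<^sup>2 + (v x)\<^sup>2)"
    using assms[THEN L2_square] by (rule Bochner_Integration.integrable_add)
  show "(\<lambda>x. u x * v x) \<in> borel_measurable M"
    using assms[THEN L2_measurable] by (rule borel_measurable_times)
  have "\<bar>a * b\<bar> \<le> a\<^sup>2 + b\<^sup>2" for a b :: real
  proof -
    have "0 \<le> (\<bar>a\<bar> - \<bar>b\<bar>)\<^sup>2" by simp
    then have "2 * (\<bar>a\<bar> * \<bar>b\<bar>) \<le> a\<^sup>2 + b\<^sup>2" by (simp add: power2_diff)
    moreover have "0 \<le> \<bar>a\<bar> * \<bar>b\<bar>" by simp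
    ultimately show ?thesis unfolding abs_mult by linarith
  qed
  then show "AE x in M. norm (u x * v x) \<le> norm ((u x)\<^sup>2 + (v x)\<^sup>2)" by simp
qed

lemma L2_comb: assumes "u \<in> L2 \<Omega>" "v \<in> L2 \<Omega>" shows "(\<lambda>x. u x + c * v x) \<in> L2 \<Omega>"
proof -
  have "integrable M (\<lambda>x. (u x)\<^sup>2 + 2 * c * (u x * v x) + c\<^sup>2 * (v x)\<^sup>2)"
    using assms L2_mult_integrable[OF assms] L2_square by simp
  moreover have "(\<lambda>x. (u x)\<^sup>2 + 2 * c * (u x * v x) + c\<^sup>2 * (v x)\<^sup>2) = (\<lambda>x. (u x + c * v x)\<^sup>2)"
    by (auto simp: power2_eq_square algebra_simps)
  moreover have "(\<lambda>x. u x + c * v x) \<in> borel_measurable M"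
    using assms[THEN L2_measurable] by measurable
  ultimately show ?thesis by (simp add: L2_def)
qed

lemma L2_one: "(\<lambda>x. 1) \<in> L2 \<Omega>"
  by (simp add: L2_def finite_measure.integrable_const[OF finite_M])

lemma L2_zero: "(\<lambda>x. 0) \<in> L2 \<Omega>" by (simp add: L2_def)

lemma L2_cong_on: "f \<in> L2 \<Omega> \<Longrightarrow> (\<And>x. x \<in> \<Omega> \<Longrightarrow> f x = g x) \<Longrightarrow> g \<in> L2 \<Omega>"
proof -
  assume f: "f \<in> L2 \<Omega>" and e: "\<And>x. x \<in> \<Omega> \<Longrightarrow> f x = g x"
  have "g \<in> borel_measurable M" using L2_measurable[OF f] e by (subst measurable_cong[of M g f]) auto
  moreover have "integrable M (\<lambda>x. (g x)\<^sup>2)" using L2_square[OF f] e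
    by (subst Bochner_Integration.integrable_cong[OF refl, of M _ "\<lambda>x. (f x)\<^sup>2"]) auto
  ultimately show "g \<in> L2 \<Omega>" by (simp add: L2_def)
qed

lemma L2_bounded_mult:
  assumes "u \<in> L2 \<Omega>" "f \<in> borel_measurable M" "\<And>x. x \<in> \<Omega> \<Longrightarrow> \<bar>f x\<bar> \<le> B"
  shows "(\<lambda>x. f x * u x) \<in> L2 \<Omega>"
proof -
  have m: "(\<lambda>x. f x * u x) \<in> borel_measurable M"
    using assms(2) L2_measurable[OF assms(1)] by (rule borel_measurable_times)
  have "integrable M (\<lambda>x. (f x * u x)\<^sup>2)"
  proof (rule Bochner_Integration.integrable_bound)
    show "integrable M (\<lambda>x. B\<^sup>2 * (u x)\<^sup>2)" using L2_square[OF assms(1)] by simp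
    show "AE x in M. norm ((f x * u x)\<^sup>2) \<le> norm (B\<^sup>2 * (u x)\<^sup>2)"
    proof (rule AE_I2)
      fix x assume "x \<in> space M"
      then have "(f x)\<^sup>2 \<le> B\<^sup>2" using assms(3)[of x] by (simp add: abs_le_square_iff[symmetric])
      then show "norm ((f x * u x)\<^sup>2) \<le> norm (B\<^sup>2 * (u x)\<^sup>2)"
        by (simp add: power_mult_distrib mult_right_mono)
    qed
  qed (use m in measurable)
  with m show ?thesis by (simp add: L2_def)
qed

lemma L2_bounded:
  assumes "f \<in> borel_measurable M" "\<And>x. x \<in> \<Omega> \<Longrightarrow> \<bar>f x\<bar> \<le> B"
  shows "f \<in> L2 \<Omega>"
  using L2_bounded_mult[OF L2_one assms] by simp

lemma test_L2: assumes "\<phi> \<in> test_functions \<Omega>" shows "\<phi> \<in> L2 \<Omega>"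
proof -
  obtain B where "\<forall>x. \<bar>\<phi> x\<bar> \<le> B" using test_bounded[OF assms] by blast
  then show ?thesis using measurable_continuous[OF test_continuous[OF assms]] by (intro L2_bounded) auto
qed

sublocale L2: quadratic_space "L2 \<Omega>" "L2_inner \<Omega>"
proof
  fix u v w :: "real^'n \<Rightarrow> real" and c :: real
  assume u: "u \<in> L2 \<Omega>"
  show "L2_inner \<Omega> u v = L2_inner \<Omega> v u" by (simp add: L2_inner_def mult.commute)
  show "0 \<le> L2_inner \<Omega> u u" by (simp add: L2_inner_def)
  assume v: "v \<in> L2 \<Omega>"
  show "(\<lambda>x. u x + c * v x) \<in> L2 \<Omega>" using u v by (rule L2_comb)
  assume w: "w \<in> L2 \<Omega>"
  have "L2_inner \<Omega> (\<lambda>x. u x + c * v x) w = (\<integral>x. u x * w x + c * (v x * w x) \<partial>M)"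
    by (simp add: L2_inner_def algebra_simps)
  also have "\<dots> = L2_inner \<Omega> u w + c * L2_inner \<Omega> v w"
    using L2_mult_integrable[OF u w] L2_mult_integrable[OF v w] by (simp add: L2_inner_def)
  finally show "L2_inner \<Omega> (\<lambda>x. u x + c * v x) w = L2_inner \<Omega> u w + c * L2_inner \<Omega> v w" .
qed (rule L2_zero)

lemma L2_inner_cong_AE:
  assumes "u \<in> L2 \<Omega>" "v \<in> L2 \<Omega>" "w \<in> L2 \<Omega>" "ae_eq \<Omega> u v"
  shows "L2_inner \<Omega> u w = L2_inner \<Omega> v w"
  unfolding L2_inner_def
  by (rule integral_cong_AE) (use assms L2_measurable in \<open>auto simp: ae_eq_def\<close>)

lemma L2_nrm_cong_AE:
  assumes "u \<in> L2 \<Omega>" "v \<in> L2 \<Omega>" "ae_eq \<Omega> u v"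
  shows "L2.nrm u = L2.nrm v"
  unfolding L2.nrm_def
  using L2_inner_cong_AE[OF assms(1,2,1,3)] L2_inner_cong_AE[OF assms(1,2,2,3)] L2.sym[OF assms(1,2)] by simp

lemma L2_inner_limit:
  assumes f: "\<And>n. f n \<in> L2 \<Omega>" and u: "u \<in> L2 \<Omega>" and lim: "(\<lambda>n. L2.nrm (\<lambda>x. f n x - u x)) \<longlonglongrightarrow> 0"
    and v: "v \<in> L2 \<Omega>"
  shows "(\<lambda>n. L2_inner \<Omega> (f n) v) \<longlonglongrightarrow> L2_inner \<Omega> u v"
proof -
  have "(\<lambda>n. L2_inner \<Omega> (f n) v - L2_inner \<Omega> u v) \<longlonglongrightarrow> 0"
  proof (rule Lim_null_comparison)
    show "\<forall>\<^sub>F n in sequentially. norm (L2_inner \<Omega> (f n) v - L2_inner \<Omega> u v) \<le> L2.nrm (\<lambda>x. f n x - u x) * L2.nrm v"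
      using L2.cauchy_schwarz[OF L2.diff[OF f u] v] by (simp add: L2.lin_diff[OF f u v])
    show "(\<lambda>n. L2.nrm (\<lambda>x. f n x - u x) * L2.nrm v) \<longlonglongrightarrow> 0"
      using lim by (rule tendsto_mult_left_zero)
  qed
  then show ?thesis by (simp add: LIM_zero_iff)
qed

lemma L2_sum:
  assumes "\<And>k. k \<in> I \<Longrightarrow> f k \<in> L2 \<Omega>"
  shows "(\<lambda>x. \<Sum>k\<in>I. a k * f k x) \<in> L2 \<Omega>"
  using assms
proof (induction I rule: infinite_finite_induct)
  case (insert k I)
  then have "(\<lambda>x. (\<Sum>k\<in>I. a k * f k x) + a k * f k x) \<in> L2 \<Omega>" by (intro L2_comb) auto
  with insert show ?case by (simp add: add.commute)
qed (simp_all add: L2_zero)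

lemma L2_inner_sum:
  assumes "\<And>k. k \<in> I \<Longrightarrow> f k \<in> L2 \<Omega>" "v \<in> L2 \<Omega>"
  shows "L2_inner \<Omega> (\<lambda>x. \<Sum>k\<in>I. a k * f k x) v = (\<Sum>k\<in>I. a k * L2_inner \<Omega> (f k) v)"
proof -
  have "L2_inner \<Omega> (\<lambda>x. \<Sum>k\<in>I. a k * f k x) v = (\<integral>x. (\<Sum>k\<in>I. a k * (f k x * v x)) \<partial>M)"
    by (simp add: L2_inner_def sum_distrib_right mult.assoc)
  also have "\<dots> = (\<Sum>k\<in>I. \<integral>x. a k * (f k x * v x) \<partial>M)"
    by (rule Bochner_Integration.integral_sum) (simp add: L2_mult_integrable assms)
  finally show ?thesis by (simp add: L2_inner_def)
qed

lemma nrm_eq: "L2.nrm u = sqrt (\<integral>x. (u x)\<^sup>2 \<partial>M)"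
  by (simp add: L2.nrm_def L2_inner_def power2_eq_square)

lemma ae_eq_sym: "ae_eq \<Omega> u v \<Longrightarrow> ae_eq \<Omega> v u" by (auto simp: ae_eq_def elim: eventually_mono)

text \<open>
  The measure is finite, so a Cauchy sequence in \<open>L\<^sup>2\<close> is Cauchy in \<open>L\<^sup>1\<close> and has a subsequence that
  converges almost everywhere. Its limit is the limit in \<open>L\<^sup>2\<close> by Fatou's lemma.
\<close>

lemma L2_complete:
  assumes f: "\<And>n. f n \<in> L2 \<Omega>"
    and c: "\<And>e. e > 0 \<Longrightarrow> \<exists>N::nat. \<forall>m\<ge>N. \<forall>n\<ge>N. L2.nrm (\<lambda>x. f m x - f n x) < e"
  shows "\<exists>u\<in>L2 \<Omega>. (\<lambda>n. L2.nrm (\<lambda>x. f n x - u x)) \<longlonglongrightarrow> 0"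
proof -
  note one = L2_one
  have L1: "integrable M u" if "u \<in> L2 \<Omega>" for u using L2_mult_integrable[OF that one] by simp
  have absL2: "(\<lambda>x. \<bar>u x\<bar>) \<in> L2 \<Omega>" if "u \<in> L2 \<Omega>" for u
    using that borel_measurable_abs[OF L2_measurable[OF that]] by (simp add: L2_def)
  have L1le: "(\<integral>x. \<bar>u x\<bar> \<partial>M) \<le> L2.nrm u * L2.nrm (\<lambda>x. 1)" if "u \<in> L2 \<Omega>" for u
    using L2.cauchy_schwarz[OF absL2[OF that] one] by (simp add: L2_inner_def L2.nrm_def)
  have n1: "L2.nrm (\<lambda>x. 1) \<ge> 0" by (rule L2.nrm_ge0[OF one])
  have "\<exists>r. strict_mono r \<and> (AE x in M. Cauchy (\<lambda>i. f (r i) x))"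
  proof (rule cauchy_L1_AE_cauchy_subseq[where M=M and s=f])
    show "integrable M (f n)" for n by (rule L1[OF f])
    fix e :: real assume "e > 0"
    then have "e / (L2.nrm (\<lambda>x. 1) + 1) > 0" using n1 by simp
    from c[OF this] obtain N where N: "\<forall>m\<ge>N. \<forall>n\<ge>N. L2.nrm (\<lambda>x. f m x - f n x) < e / (L2.nrm (\<lambda>x. 1) + 1)" by blast
    show "\<exists>N. \<forall>i\<ge>N. \<forall>j\<ge>N. (\<integral>x. norm (f i x - f j x) \<partial>M) < e"
    proof (intro exI allI impI)
      fix i j assume ij: "i \<ge> N" "j \<ge> N"
      let ?d = "\<lambda>x. f i x - f j x"
      have d: "?d \<in> L2 \<Omega>" by (rule L2.diff[OF f f])
      have "(\<integral>x. norm (f i x - f j x) \<partial>M) \<le> L2.nrm ?d * L2.nrm (\<lambda>x. 1)" using L1le[OF d] by simp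
      also have "\<dots> \<le> L2.nrm ?d * (L2.nrm (\<lambda>x. 1) + 1)" using L2.nrm_ge0[OF d] by (intro mult_left_mono) auto
      also have "\<dots> < e" using N ij n1 by (simp add: field_simps)
      finally show "(\<integral>x. norm (f i x - f j x) \<partial>M) < e" .
    qed
  qed auto
  then obtain r where r: "strict_mono r" and ca: "AE x in M. Cauchy (\<lambda>i. f (r i) x)" by blast
  define u where "u x = lim (\<lambda>i. f (r i) x)" for x
  have lim: "AE x in M. (\<lambda>i. f (r i) x) \<longlonglongrightarrow> u x"
    using ca by eventually_elim (simp add: u_def Cauchy_convergent_iff convergent_LIMSEQ_iff)
  have um[measurable]: "u \<in> borel_measurable M"
    unfolding u_def using f L2_measurable by (intro borel_measurable_lim_metric) auto
  have fm[measurable]: "f n \<in> borel_measurable M" for n by (rule L2_measurable[OF f])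
  have key: "(\<lambda>x. f n x - u x) \<in> L2 \<Omega> \<and> L2.nrm (\<lambda>x. f n x - u x) \<le> e"
    if e: "e > 0" and N: "\<forall>m\<ge>N. \<forall>n\<ge>N. L2.nrm (\<lambda>x. f m x - f n x) < e" and n: "n \<ge> N" for e N n
  proof -
    have sq: "(\<integral>\<^sup>+x. ennreal ((f n x - f (r k) x)\<^sup>2) \<partial>M) \<le> ennreal (e\<^sup>2)" if "k \<ge> N" for k
    proof -
      have d: "(\<lambda>x. f n x - f (r k) x) \<in> L2 \<Omega>" by (rule L2.diff[OF f f])
      have "r k \<ge> N" using that seq_suble[OF r, of k] by linarith
      then have "L2.nrm (\<lambda>x. f n x - f (r k) x) \<le> e" using N n less_imp_le by blast
      then have "(\<integral>x. (f n x - f (r k) x)\<^sup>2 \<partial>M) \<le> e\<^sup>2"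
        unfolding nrm_eq using sqrt_le_D by blast
      then show ?thesis using L2_square[OF d] by (simp add: nn_integral_eq_integral ennreal_leI)
    qed
    have "(\<integral>\<^sup>+x. ennreal ((f n x - u x)\<^sup>2) \<partial>M) = (\<integral>\<^sup>+x. liminf (\<lambda>k. ennreal ((f n x - f (r k) x)\<^sup>2)) \<partial>M)"
    proof (rule nn_integral_cong_AE, use lim in eventually_elim)
      case (elim x)
      then have "(\<lambda>k. ennreal ((f n x - f (r k) x)\<^sup>2)) \<longlonglongrightarrow> ennreal ((f n x - u x)\<^sup>2)"
        by (intro tendsto_ennrealI tendsto_intros)
      then show ?case by (rule lim_imp_Liminf[OF sequentially_bot, symmetric])
    qed
    also have "\<dots> \<le> liminf (\<lambda>k. \<integral>\<^sup>+x. ennreal ((f n x - f (r k) x)\<^sup>2) \<partial>M)"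
      by (rule nn_integral_liminf) measurable
    also have "\<dots> \<le> ennreal (e\<^sup>2)"
    proof -
      have "liminf (\<lambda>k. \<integral>\<^sup>+x. ennreal ((f n x - f (r k) x)\<^sup>2) \<partial>M) \<le> liminf (\<lambda>k. ennreal (e\<^sup>2))"
        by (rule Liminf_mono) (rule eventually_mono[OF eventually_ge_at_top[of N] sq])
      then show ?thesis by (simp add: Liminf_const)
    qed
    finally have le: "(\<integral>\<^sup>+x. ennreal ((f n x - u x)\<^sup>2) \<partial>M) \<le> ennreal (e\<^sup>2)" .
    have i: "integrable M (\<lambda>x. (f n x - u x)\<^sup>2)"
      by (rule integrableI_nonneg) (use le ennreal_less_top in \<open>auto intro: le_less_trans\<close>)
    have "(\<integral>x. (f n x - u x)\<^sup>2 \<partial>M) \<le> e\<^sup>2"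
      using le i by (simp add: nn_integral_eq_integral ennreal_le_iff)
    then have "L2.nrm (\<lambda>x. f n x - u x) \<le> e"
      unfolding nrm_eq using e real_le_lsqrt real_sqrt_le_iff by (metis less_imp_le real_sqrt_abs abs_of_pos)
    moreover have "(\<lambda>x. f n x - u x) \<in> L2 \<Omega>" using i by (simp add: L2_def)
    ultimately show ?thesis by simp
  qed
  obtain N1 where "\<forall>m\<ge>N1. \<forall>n\<ge>N1. L2.nrm (\<lambda>x. f m x - f n x) < 1" using c[of 1] by auto
  from key[OF _ this, of N1] have "(\<lambda>x. f N1 x - u x) \<in> L2 \<Omega>" by simp
  from L2.diff[OF f[of N1] this] have uL: "u \<in> L2 \<Omega>" by simp
  have "(\<lambda>n. L2.nrm (\<lambda>x. f n x - u x)) \<longlonglongrightarrow> 0"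
  proof (rule LIMSEQ_I)
    fix e :: real assume "e > 0"
    then have "e/2 > 0" by simp
    from c[OF this] obtain N where N: "\<forall>m\<ge>N. \<forall>n\<ge>N. L2.nrm (\<lambda>x. f m x - f n x) < e/2" by blast
    have "L2.nrm (\<lambda>x. f n x - u x) < e" if "n \<ge> N" for n
      using key[OF \<open>e/2 > 0\<close> N that] \<open>e > 0\<close> by linarith
    then show "\<exists>N. \<forall>n\<ge>N. norm (L2.nrm (\<lambda>x. f n x - u x) - 0) < e"
      using L2.nrm_ge0[OF L2.diff[OF f uL]] by auto
  qed
  with uL show ?thesis by blast
qed

sublocale L2: complete_quadratic_space "L2 \<Omega>" "L2_inner \<Omega>"
  by unfold_locales (rule L2_complete)

section \<open>Density of the test functions\<close>

text \<open>
  Two limits lead from test functions to the indicator of \<open>K\<close>. For a finite union of balls let \<open>B\<close> be a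
  smooth function that is \<open>1\<close> outside and takes values in \<open>[0, 1)\<close> inside the union; then the test functions \<open>1 - B ^ m\<close>
  tend to the indicator of the union. Covers of \<open>K\<close> by balls of radius tending to \<open>0\<close> then shrink to \<open>K\<close>.
\<close>

lemma orthogonal_test_imp_zero_integral_compact:
  assumes q: "q \<in> L2 \<Omega>" and orth: "\<And>\<phi>. \<phi> \<in> test_functions \<Omega> \<Longrightarrow> L2_inner \<Omega> q \<phi> = 0"
    and K: "compact K" "K \<subseteq> \<Omega>"
  shows "(\<integral>x. q x * indicator K x \<partial>M) = 0"
proof -
  note one = L2_one
  have qi: "integrable M q" using L2_mult_integrable[OF q one] by simp
  have qm[measurable]: "q \<in> borel_measurable M" by (rule L2_measurable[OF q])
  have qni: "integrable M (\<lambda>x. \<bar>q x\<bar>)" using qi by (rule integrable_abs)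
  have meas: "(\<lambda>x. q x * indicator S x) \<in> borel_measurable M" if "S \<in> sets borel" for S
    using that by (intro borel_measurable_times qm measurable_restrict_space1 borel_measurable_indicator) auto
  obtain e where e: "e > 0" "(\<Union>x\<in>K. cball x e) \<subseteq> \<Omega>"
    using compact_subset_open_imp_cball_epsilon_subset[OF K(1) op K(2)] by blast
  have fin: "(\<integral>x. q x * indicator (\<Union>a\<in>I. ball a r) x \<partial>M) = 0" if I: "finite I" "I \<subseteq> K" "r \<le> e" for I r
  proof -
    have "\<exists>\<beta>. smooth_on UNIV \<beta> \<and> (\<forall>x. 0 \<le> \<beta> x) \<and> (\<forall>x. \<beta> x \<le> 1) \<and> (\<forall>x. \<beta> x \<noteq> 0 \<longleftrightarrow> x \<in> ball a r)"
      for a :: "real^'n"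
      by (rule smooth_bump[of a r]) (intro exI conjI allI, assumption+)
    then obtain \<beta> :: "real^'n \<Rightarrow> real^'n \<Rightarrow> real" where "\<And>a. smooth_on UNIV (\<beta> a) \<and> (\<forall>x. 0 \<le> \<beta> a x) \<and> (\<forall>x. \<beta> a x \<le> 1) \<and> (\<forall>x. \<beta> a x \<noteq> 0 \<longleftrightarrow> x \<in> ball a r)"
      by metis
    then have b: "\<And>a. smooth_on UNIV (\<beta> a)" "\<And>a x. 0 \<le> \<beta> a x" "\<And>a x. \<beta> a x \<le> 1"
      "\<And>a x. \<beta> a x \<noteq> 0 \<longleftrightarrow> x \<in> ball a r" by blast+
    (* The factor keeps the sum of the bumps below 1. *)
    define B where "B x = 1 - inverse (real (card I) + 1) * (\<Sum>a\<in>I. \<beta> a x)" for x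
    have sum_le: "(\<Sum>a\<in>I. \<beta> a x) \<le> real (card I)" for x using sum_bounded_above[of I "\<lambda>a. \<beta> a x" 1] b(3) by simp
    have B01: "0 \<le> B x" "B x \<le> 1" for x
      using sum_le[of x] sum_nonneg[of I "\<lambda>a. \<beta> a x"] b(2) by (auto simp: B_def field_simps)
    have Blt: "B x < 1" if x: "x \<in> (\<Union>a\<in>I. ball a r)" for x
    proof -
      obtain a where a: "a \<in> I" "x \<in> ball a r" using x by blast
      then have "\<beta> a x > 0" using b(2)[of a x] b(4)[of a x] by linarith
      then have "(\<Sum>a\<in>I. \<beta> a x) > 0" using sum_pos2[OF I(1) a(1), of "\<lambda>a. \<beta> a x"] b(2) by simp
      then show ?thesis by (simp add: B_def)
    qed
    have B1: "B x = 1" if "x \<notin> (\<Union>a\<in>I. ball a r)" for x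
    proof -
      have "\<beta> a x = 0" if "a \<in> I" for a using b(4)[of a x] that \<open>x \<notin> (\<Union>a\<in>I. ball a r)\<close> by blast
      then show ?thesis by (simp add: B_def)
    qed
    have "(\<lambda>x. 1 + (-1) * (1 + (- inverse (real (card I) + 1)) * (\<Sum>a\<in>I. \<beta> a x)) ^ m) \<in> test_functions \<Omega>" for m
    proof (rule test_functionsI)
      show "smooth_on UNIV (\<lambda>x. 1 + (-1) * (1 + (- inverse (real (card I) + 1)) * (\<Sum>a\<in>I. \<beta> a x)) ^ m)"
        by (intro smooth_add smooth_mult smooth_const smooth_power smooth_sum b(1))
      show "compact (\<Union>a\<in>I. cball a r)" using I(1) by (intro compact_UN) auto
      show "(\<Union>a\<in>I. cball a r) \<subseteq> \<Omega>" using e(2) I by fastforce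
      fix x assume "x \<notin> (\<Union>a\<in>I. cball a r)"
      then have "x \<notin> (\<Union>a\<in>I. ball a r)" by auto
      from B1[OF this] show "1 + (-1) * (1 + (- inverse (real (card I) + 1)) * (\<Sum>a\<in>I. \<beta> a x)) ^ m = 0"
        by (simp add: B_def)
    qed
    then have t: "(\<lambda>x. 1 - B x ^ m) \<in> test_functions \<Omega>" for m by (simp add: B_def)
    have "(\<lambda>m. \<integral>x. q x * (1 - B x ^ m) \<partial>M) \<longlonglongrightarrow> (\<integral>x. q x * indicator (\<Union>a\<in>I. ball a r) x \<partial>M)"
    proof (rule integral_dominated_convergence[where w="\<lambda>x. \<bar>q x\<bar>"])
      show "(\<lambda>x. q x * indicator (\<Union>a\<in>I. ball a r) x) \<in> borel_measurable M" by (rule meas) (intro borel_open open_UN, auto)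
      show "(\<lambda>x. q x * (1 - B x ^ m)) \<in> borel_measurable M" for m
        using L2_measurable[OF test_L2[OF t]] qm by (intro borel_measurable_times)
      show "AE x in M. (\<lambda>m. q x * (1 - B x ^ m)) \<longlonglongrightarrow> q x * indicator (\<Union>a\<in>I. ball a r) x"
      proof (rule AE_I2)
        fix x
        have "(\<lambda>m. 1 - B x ^ m) \<longlonglongrightarrow> indicator (\<Union>a\<in>I. ball a r) x"
        proof (cases "x \<in> (\<Union>a\<in>I. ball a r)")
          case True
          then have "(\<lambda>m. B x ^ m) \<longlonglongrightarrow> 0" using Blt B01 by (intro LIMSEQ_power_zero) auto
          from tendsto_diff[OF tendsto_const this, of 1] True show ?thesis by simp
        next
          case False
          with B1 show ?thesis by simp
        qed
        then show "(\<lambda>m. q x * (1 - B x ^ m)) \<longlonglongrightarrow> q x * indicator (\<Union>a\<in>I. ball a r) x"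
          by (intro tendsto_intros)
      qed
      show "AE x in M. norm (q x * (1 - B x ^ m)) \<le> \<bar>q x\<bar>" for m
      proof (rule AE_I2)
        fix x
        have "\<bar>1 - B x ^ m\<bar> \<le> 1" using B01 power_le_one[of "B x" m] zero_le_power[of "B x" m] by auto
        then show "norm (q x * (1 - B x ^ m)) \<le> \<bar>q x\<bar>" by (simp add: abs_mult mult_left_le)
      qed
    qed (rule qni)
    moreover have "(\<integral>x. q x * (1 - B x ^ m) \<partial>M) = 0" for m using orth[OF t] by (simp add: L2_inner_def)
    ultimately show ?thesis by (simp add: LIMSEQ_const_iff)
  qed
  have "\<exists>I. finite I \<and> I \<subseteq> K \<and> K \<subseteq> (\<Union>a\<in>I. ball a (e / real (Suc n)))" for n
  proof -
    have pos: "e / real (Suc n) > 0" using e(1) by simp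
    have "K \<subseteq> (\<Union>a\<in>K. ball a (e / real (Suc n)))" using pos by (intro subsetI UN_I) auto
    then show ?thesis
    proof (rule compactE_image[OF K(1), rotated])
      fix I assume "I \<subseteq> K" "finite I" "K \<subseteq> (\<Union>a\<in>I. ball a (e / real (Suc n)))"
      then show ?thesis by blast
    qed simp
  qed
  then obtain I where I: "\<And>n. finite (I n)" "\<And>n. I n \<subseteq> K" "\<And>n. K \<subseteq> (\<Union>a\<in>I n. ball a (e / real (Suc n)))" by metis
  define U where "U n = (\<Union>a\<in>I n. ball a (e / real (Suc n)))" for n
  have "(\<lambda>n. \<integral>x. q x * indicator (U n) x \<partial>M) \<longlonglongrightarrow> (\<integral>x. q x * indicator K x \<partial>M)"
  proof (rule integral_dominated_convergence[where w="\<lambda>x. \<bar>q x\<bar>"])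
    show "(\<lambda>x. q x * indicator K x) \<in> borel_measurable M" by (rule meas) (use K compact_imp_closed borel_closed in blast)
    show "(\<lambda>x. q x * indicator (U n) x) \<in> borel_measurable M" for n unfolding U_def by (rule meas) (intro borel_open open_UN, auto)
    show "AE x in M. norm (q x * indicator (U n) x) \<le> \<bar>q x\<bar>" for n by (auto intro!: AE_I2 simp: indicator_def)
    show "AE x in M. (\<lambda>n. q x * indicator (U n) x) \<longlonglongrightarrow> q x * indicator K x"
    proof (rule AE_I2)
      fix x
      have "\<forall>\<^sub>F n in sequentially. indicator (U n) x = (indicator K x :: real)"
      proof (cases "x \<in> K")
        case True
        then have "x \<in> U n" for n using I(3)[of n] unfolding U_def by blast
        with True show ?thesis by simp
      next
        case False
        have "open (- K)" "x \<in> - K" using K(1) compact_imp_closed open_Compl False by auto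
        then obtain d where d: "d > 0" "ball x d \<subseteq> - K" using openE by blast
        have "(\<lambda>n. e / real (Suc n)) \<longlonglongrightarrow> 0" by real_asymp
        then have "\<forall>\<^sub>F n in sequentially. e / real (Suc n) < d" using d(1) by (intro order_tendstoD) auto
        then show ?thesis
        proof eventually_elim
          case (elim n)
          have "x \<notin> U n"
          proof
            assume "x \<in> U n"
            then obtain a where "a \<in> I n" "dist a x < e / real (Suc n)" by (auto simp: U_def)
            with elim have "a \<in> ball x d" by (simp add: dist_commute)
            with d(2) \<open>a \<in> I n\<close> I(2) show False by blast
          qed
          with False show ?case by simp
        qed
      qed
      then show "(\<lambda>n. q x * indicator (U n) x) \<longlonglongrightarrow> q x * indicator K x"
        by (intro tendsto_intros tendsto_eventually)
    qed
  qed (rule qni)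
  moreover have "(\<integral>x. q x * indicator (U n) x \<partial>M) = 0" for n
    unfolding U_def using e(1) by (intro fin I) (simp add: field_simps)
  ultimately show ?thesis by (simp add: LIMSEQ_const_iff)
qed

text \<open>
  If \<open>{q > 0}\<close> had positive measure, it would contain a compact set of positive measure, over which
  the integral of \<open>q\<close> would be both positive and, by the preceding lemma, \<open>0\<close>.
\<close>

lemma orthogonal_test_imp_nonpos:
  assumes q: "q \<in> L2 \<Omega>" and orth: "\<And>\<phi>. \<phi> \<in> test_functions \<Omega> \<Longrightarrow> L2_inner \<Omega> q \<phi> = 0"
  shows "AE x in M. q x \<le> 0"
proof -
  have qm: "q \<in> borel_measurable M" by (rule L2_measurable[OF q])
  define A where "A = {x\<in>\<Omega>. q x > 0}"
  have "{x\<in>space M. q x > 0} \<in> sets M" using qm by measurable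
  then have A: "A \<in> sets lebesgue" unfolding A_def space_M using sets_Omega by (simp add: sets_restrict_space_iff)
  have "emeasure lebesgue A = 0"
  proof (rule ccontr)
    assume "emeasure lebesgue A \<noteq> 0"
    have "A \<in> lmeasurable" using fmeasurableI2[OF lmeas _ A] by (auto simp: A_def)
    then have fin: "emeasure lebesgue A = ennreal (measure lebesgue A)" by (rule emeasure_eq_measure2)
    with \<open>emeasure lebesgue A \<noteq> 0\<close> have "measure lebesgue A \<noteq> 0" by auto
    then have pos: "measure lebesgue A > 0" using measure_nonneg[of lebesgue A] by linarith
    obtain T where T: "closed T" "T \<subseteq> A" "A - T \<in> lmeasurable" "emeasure lebesgue (A - T) < ennreal (measure lebesgue A)"
      by (rule sets_lebesgue_inner_closed[OF A pos])
    have Ts: "T \<in> sets lebesgue" using borel_closed[OF T(1)] by auto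
    have Tne: "emeasure lebesgue T \<noteq> 0"
    proof
      assume "emeasure lebesgue T = 0"
      then have "emeasure lebesgue (A - T) = emeasure lebesgue A"
        using A Ts by (intro emeasure_Diff_null_set) (auto simp: null_sets_def)
      with T(4) fin show False by simp
    qed
    have TO: "T \<subseteq> \<Omega>" using T(2) by (auto simp: A_def)
    then have "bounded T" using bd bounded_subset by blast
    with T(1) have "compact T" using compact_eq_bounded_closed by blast
    from orthogonal_test_imp_zero_integral_compact[OF q orth this TO]
    have z: "(\<integral>x. q x * indicator T x \<partial>M) = 0" by simp
    have "T \<in> sets M" using Ts TO sets_Omega by (simp add: sets_restrict_space_iff)
    have "(\<lambda>x. indicator T x) \<in> L2 \<Omega>"
      by (rule L2_bounded[where B=1]) (use \<open>T \<in> sets M\<close> in \<open>auto simp: indicator_def\<close>)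
    then have int: "integrable M (\<lambda>x. q x * indicator T x)" by (rule L2_mult_integrable[OF q])
    have "AE x in M. q x * indicator T x = 0"
      using z int by (subst (asm) integral_nonneg_eq_0_iff_AE) (use T(2) in \<open>auto simp: A_def indicator_def intro!: AE_I2\<close>)
    then have "AE x in M. x \<notin> T"
      by eventually_elim (use T(2) in \<open>auto simp: A_def indicator_def split: if_splits\<close>)
    then have "AE x in lebesgue. x \<in> \<Omega> \<longrightarrow> x \<notin> T" using sets_Omega by (simp add: AE_restrict_space_iff)
    then have "AE x in lebesgue. x \<notin> T" by eventually_elim (use TO in auto)
    then have "T \<in> null_sets lebesgue" using Ts by (simp add: AE_iff_null_sets)
    with Tne show False by auto
  qed
  with A have "A \<in> null_sets lebesgue" by auto
  then have "AE x in lebesgue. x \<notin> A" by (rule AE_not_in)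
  then have "AE x in lebesgue. x \<in> \<Omega> \<longrightarrow> q x \<le> 0" by eventually_elim (auto simp: A_def)
  then show ?thesis using sets_Omega by (simp add: AE_restrict_space_iff)
qed

lemma orthogonal_test_imp_zero:
  assumes q: "q \<in> L2 \<Omega>" and orth: "\<And>\<phi>. \<phi> \<in> test_functions \<Omega> \<Longrightarrow> L2_inner \<Omega> q \<phi> = 0"
  shows "AE x in M. q x = 0"
proof -
  have m: "(\<lambda>x. (-1) * q x) \<in> L2 \<Omega>" by (rule L2.scale[OF q])
  have "AE x in M. (-1) * q x \<le> 0"
    using L2.lin_scale[OF q test_L2, of _ "-1"] orth by (intro orthogonal_test_imp_nonpos[OF m]) simp
  moreover have "AE x in M. q x \<le> 0" using q orth by (rule orthogonal_test_imp_nonpos)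
  ultimately show ?thesis by eventually_elim simp
qed

lemma test_dense:
  assumes "u \<in> L2 \<Omega>" "e > 0"
  shows "\<exists>\<phi>\<in>test_functions \<Omega>. L2.nrm (\<lambda>x. u x - \<phi> x) < e"
proof (rule L2.dense_if_orthogonal_trivial)
  show "(\<lambda>x. \<phi> x + c * \<psi> x) \<in> test_functions \<Omega>" if "\<phi> \<in> test_functions \<Omega>" "\<psi> \<in> test_functions \<Omega>" for \<phi> \<psi> c
    using that by (intro test_add test_scale)
  show "L2_inner \<Omega> q q = 0" if q: "q \<in> L2 \<Omega>" and "\<And>\<phi>. \<phi> \<in> test_functions \<Omega> \<Longrightarrow> L2_inner \<Omega> q \<phi> = 0" for q
  proof -
    have "ae_eq \<Omega> q (\<lambda>x. 0)" using orthogonal_test_imp_zero[OF that] by (simp add: ae_eq_def)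
    from L2_inner_cong_AE[OF q L2_zero q this] show ?thesis by (simp add: L2_inner_def)
  qed
qed (use assms test_L2 test_zero in auto)

lemma ae_eq_if_test_eq:
  assumes "u \<in> L2 \<Omega>" "v \<in> L2 \<Omega>"
    and "\<And>\<phi>. \<phi> \<in> test_functions \<Omega> \<Longrightarrow> L2_inner \<Omega> u \<phi> = L2_inner \<Omega> v \<phi>"
  shows "ae_eq \<Omega> u v"
proof -
  have "AE x in M. u x - v x = 0"
    by (rule orthogonal_test_imp_zero[OF L2.diff[OF assms(1,2)]]) (use assms L2.lin_diff test_L2 in auto)
  then show ?thesis by (simp add: ae_eq_def)
qed

end

section \<open>Integration by parts\<close>

text \<open>
  The difference quotients of \<open>g\<close> have integral \<open>0\<close> because Lebesgue measure is translation
  invariant, and they converge to \<open>g'\<close> under a common integrable bound.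
\<close>

lemma lborel_integral_directional_derivative_zero:
  fixes g g' :: "real^'n::finite \<Rightarrow> real" and e :: "real^'n"
  assumes d: "\<And>x s. ((\<lambda>s. g (x + s *\<^sub>R e)) has_real_derivative g' (x + s *\<^sub>R e)) (at s)"
    and cont: "continuous_on UNIV g"
    and K: "bounded K" "\<And>x. x \<notin> K \<Longrightarrow> g x = 0"
    and B: "\<And>x. \<bar>g' x\<bar> \<le> B"
  shows "g' \<in> borel_measurable borel" and "integral\<^sup>L lborel g' = 0"
proof -
  have gm[measurable]: "g \<in> borel_measurable borel" using cont by (rule borel_measurable_continuous_onI)
  obtain R where R: "R > 0" "\<And>x. x \<in> K \<Longrightarrow> norm x \<le> R" using K(1) bounded_pos by metis
  define S where "S = cball (0::real^'n) (R + norm e)"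
  have Sm: "emeasure lborel S < \<infinity>" unfolding S_def by (rule emeasure_lborel_cball_finite)
  have Sb[measurable]: "S \<in> sets borel" by (simp add: S_def)
  define q where "q m x = (g (x + inverse (real (Suc m)) *\<^sub>R e) - g x) * real (Suc m)" for m x
  have lip: "\<bar>g (x + s *\<^sub>R e) - g x\<bar> \<le> B * s" if s: "s > 0" for x s
  proof -
    obtain z where z: "z > 0" "z < s" "g (x + s *\<^sub>R e) - g (x + 0 *\<^sub>R e) = (s - 0) * g' (x + z *\<^sub>R e)"
      using MVT2[OF s, of "\<lambda>s. g (x + s *\<^sub>R e)" "\<lambda>s. g' (x + s *\<^sub>R e)"] d by auto
    then show ?thesis using B[of "x + z *\<^sub>R e"] s by (simp add: abs_mult mult.commute mult_left_mono)
  qed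
  have qb: "\<bar>q m x\<bar> \<le> B * indicator S x" for m x
  proof -
    have i: "inverse (real (Suc m)) > 0" by simp
    show ?thesis
    proof (cases "x \<in> S")
      case True
      have "\<bar>q m x\<bar> = \<bar>g (x + inverse (real (Suc m)) *\<^sub>R e) - g x\<bar> * real (Suc m)"
        by (simp add: q_def abs_mult)
      also have "\<dots> \<le> B * inverse (real (Suc m)) * real (Suc m)" by (rule mult_right_mono[OF lip[OF i]]) simp
      also have "\<dots> = B" by (simp add: field_simps)
      finally show ?thesis using True by simp
    next
      case False
      then have n: "norm x > R + norm e" by (simp add: S_def)
      then have "x \<notin> K" using R(2)[of x] by (smt (verit) norm_ge_zero)
      moreover have "x + inverse (real (Suc m)) *\<^sub>R e \<notin> K"
      proof
        assume "x + inverse (real (Suc m)) *\<^sub>R e \<in> K"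
        then have "norm (x + inverse (real (Suc m)) *\<^sub>R e) \<le> R" by (rule R(2))
        moreover have "norm (inverse (real (Suc m)) *\<^sub>R e) \<le> norm e" by (simp add: field_simps)
        moreover have "norm x \<le> norm (x + inverse (real (Suc m)) *\<^sub>R e) + norm (inverse (real (Suc m)) *\<^sub>R e)"
          using norm_triangle_ineq4[of "x + inverse (real (Suc m)) *\<^sub>R e" "inverse (real (Suc m)) *\<^sub>R e"] by simp
        ultimately show False using n by linarith
      qed
      ultimately show ?thesis using K(2) False by (simp add: q_def)
    qed
  qed
  have qlim: "(\<lambda>m. q m x) \<longlonglongrightarrow> g' x" for x
  proof -
    have "((\<lambda>s. (g (x + s *\<^sub>R e) - g x) / s) \<longlongrightarrow> g' x) (at 0)"
      using d[of x 0] by (simp add: has_field_derivative_iff)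
    moreover have "filterlim (\<lambda>m. inverse (real (Suc m))) (at 0) sequentially"
      unfolding filterlim_at using LIMSEQ_inverse_real_of_nat by simp
    ultimately have "(\<lambda>m. (g (x + inverse (real (Suc m)) *\<^sub>R e) - g x) / inverse (real (Suc m))) \<longlonglongrightarrow> g' x"
      by (rule filterlim_compose)
    then show ?thesis by (simp add: q_def divide_inverse)
  qed
  have qm: "q m \<in> borel_measurable borel" for m unfolding q_def by measurable
  show g'm: "g' \<in> borel_measurable borel" by (rule borel_measurable_LIMSEQ_real[OF qlim qm])
  have gi: "integrable lborel g"
  proof -
    have "compact (cball (0::real^'n) R)" by simp
    then have "integrable lborel (\<lambda>x. indicator (cball 0 R) x *\<^sub>R g x)"
      by (rule borel_integrable_compact) (rule continuous_on_subset[OF cont], simp)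
    moreover have "(\<lambda>x. indicator (cball 0 R) x *\<^sub>R g x) = g"
    proof
      fix x show "indicator (cball 0 R) x *\<^sub>R g x = g x"
        using K(2)[of x] R(2)[of x] by (cases "x \<in> K") auto
    qed
    ultimately show ?thesis by (simp only:)
  qed
  have trans: "integrable lborel (\<lambda>x. g (x + c)) \<and> integral\<^sup>L lborel (\<lambda>x. g (x + c)) = integral\<^sup>L lborel g" for c
  proof -
    have e: "(\<lambda>x. g (x + c)) = (\<lambda>x. g (c + x))" by (simp add: add.commute)
    have "integrable (distr lborel borel ((+) c)) g" using gi by (simp add: lborel_distr_plus)
    then have "integrable lborel (\<lambda>x. g (c + x))" by (subst (asm) integrable_distr_eq) auto
    moreover have "integral\<^sup>L (distr lborel borel ((+) c)) g = integral\<^sup>L lborel (\<lambda>x. g (c + x))"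
      by (rule integral_distr) auto
    ultimately show ?thesis by (simp add: lborel_distr_plus e)
  qed
  have q0: "integral\<^sup>L lborel (q m) = 0" for m
    using trans[of "inverse (real (Suc m)) *\<^sub>R e"] gi by (simp add: q_def[abs_def])
  have "(\<lambda>m. integral\<^sup>L lborel (q m)) \<longlonglongrightarrow> integral\<^sup>L lborel g'"
  proof (rule integral_dominated_convergence[where w="\<lambda>x. B * indicator S x"])
    show "integrable lborel (\<lambda>x. B * indicator S x)" using Sm by simp
  qed (use qb qlim qm g'm in auto)
  then show "integral\<^sup>L lborel g' = 0" by (simp add: q0 LIMSEQ_const_iff)
qed

context bounded_open
begin

text \<open>
  This is applied to products of test functions and to fields cut off near the boundary. Extended by \<open>0\<close>,
  both are differentiable in the whole space, which turns the integral over \<open>\<Omega>\<close> into one over the whole space.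
\<close>

lemma integral_partial_zero:
  fixes g :: "real^'n \<Rightarrow> real"
  assumes d: "\<And>x. (g has_derivative (\<lambda>h. D x \<bullet> h)) (at x)"
    and z: "\<And>x. x \<notin> \<Omega> \<Longrightarrow> g x = 0" "\<And>x. x \<notin> \<Omega> \<Longrightarrow> D x = 0"
    and B: "\<And>x. \<bar>D x $ j\<bar> \<le> B"
  shows "(\<integral>x. D x $ j \<partial>M) = 0"
proof -
  have dd: "((\<lambda>s. g (x + s *\<^sub>R axis j 1)) has_real_derivative D (x + s *\<^sub>R axis j 1) $ j) (at s)" for x s
  proof -
    have "((\<lambda>s. x + s *\<^sub>R axis j 1) has_derivative (\<lambda>h. h *\<^sub>R axis j 1)) (at s)"
      by (auto intro!: derivative_eq_intros)
    from diff_chain_at[OF this d] show ?thesis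
      by (simp add: o_def has_field_derivative_def inner_axis mult.commute[of _ "D _ $ j"])
  qed
  have cont: "continuous_on UNIV g" using has_derivative_continuous[OF d] by (intro continuous_at_imp_continuous_on) simp
  note l = lborel_integral_directional_derivative_zero[OF dd cont bd z(1) B]
  have "(\<integral>x. D x $ j \<partial>M) = (\<integral>x. indicator \<Omega> x *\<^sub>R (D x $ j) \<partial>lebesgue)"
    using sets_Omega by (subst integral_restrict_space) auto
  also have "(\<lambda>x. indicator \<Omega> x *\<^sub>R (D x $ j)) = (\<lambda>x. D x $ j)"
  proof
    fix x show "indicator \<Omega> x *\<^sub>R (D x $ j) = D x $ j" using z(2)[of x] by (cases "x \<in> \<Omega>") simp_all
  qed
  also have "(\<integral>x. D x $ j \<partial>lebesgue) = 0" using l by (simp add: integral_completion)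
  finally show ?thesis .
qed

lemma integral_test_partial_zero:
  assumes "\<phi> \<in> test_functions \<Omega>"
  shows "(\<integral>x. partial_deriv j \<phi> x \<partial>M) = 0"
proof -
  obtain B where B: "\<forall>x. \<bar>partial_deriv j \<phi> x\<bar> \<le> B" using test_bounded[OF test_partial[OF assms]] by blast
  obtain K where K: "K \<subseteq> \<Omega>" "\<forall>x. x \<notin> K \<longrightarrow> \<phi> x = 0" using test_support[OF assms] by blast
  have g0: "gradient \<phi> x = 0" if "x \<notin> \<Omega>" for x
  proof -
    have "partial_deriv i \<phi> x = 0" for i using test_support[OF test_partial[OF assms, of i]] that by blast
    then show ?thesis by (simp add: gradient_def vec_eq_iff)
  qed
  have "(\<integral>x. gradient \<phi> x $ j \<partial>M) = 0"
    by (rule integral_partial_zero[OF gradient_has_derivative[OF smooth_on_differentiable[OF test_smooth[OF assms]]]])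
      (use B K g0 in \<open>auto simp: gradient_def\<close>)
  then show ?thesis by (simp add: gradient_def)
qed

lemma test_integration_by_parts:
  assumes "\<phi> \<in> test_functions \<Omega>" "\<psi> \<in> test_functions \<Omega>"
  shows "L2_inner \<Omega> \<phi> (partial_deriv j \<psi>) = - L2_inner \<Omega> (partial_deriv j \<phi>) \<psi>"
proof -
  note d = smooth_on_differentiable[OF test_smooth]
  have "(\<integral>x. partial_deriv j (\<lambda>x. \<phi> x * \<psi> x) x \<partial>M) = 0"
    by (rule integral_test_partial_zero[OF test_mult_left[OF test_smooth]]) fact+
  then have "(\<integral>x. \<phi> x * partial_deriv j \<psi> x + partial_deriv j \<phi> x * \<psi> x \<partial>M) = 0"
    by (simp add: partial_deriv_mult[OF d[OF assms(1)] d[OF assms(2)]])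
  moreover have "integrable M (\<lambda>x. \<phi> x * partial_deriv j \<psi> x)" "integrable M (\<lambda>x. partial_deriv j \<phi> x * \<psi> x)"
    using assms by (auto intro!: L2_mult_integrable test_L2 test_partial)
  ultimately show ?thesis by (simp add: L2_inner_def)
qed

section \<open>The Sobolev space of first order\<close>

lemma is_weak_gradient_iff:
  "is_weak_gradient \<Omega> u g \<longleftrightarrow> (\<forall>j. (\<lambda>x. g x $ j) \<in> L2 \<Omega>) \<and>
     (\<forall>\<phi> \<in> test_functions \<Omega>. \<forall>j. L2_inner \<Omega> u (partial_deriv j \<phi>) = - L2_inner \<Omega> (\<lambda>x. g x $ j) \<phi>)"
  by (simp add: is_weak_gradient_def L2_inner_def)

definition wd :: "(real^'n \<Rightarrow> real) \<Rightarrow> 'n \<Rightarrow> real^'n \<Rightarrow> real" where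
  "wd u j = (\<lambda>x. weak_gradient \<Omega> u x $ j)"

lemma H1_L2: "u \<in> H1 \<Omega> \<Longrightarrow> u \<in> L2 \<Omega>" by (simp add: H1_def)

lemma H1_weak_gradient: "u \<in> H1 \<Omega> \<Longrightarrow> is_weak_gradient \<Omega> u (weak_gradient \<Omega> u)"
  unfolding weak_gradient_def H1_def using someI_ex[of "is_weak_gradient \<Omega> u"] by simp

lemma H1I: "u \<in> L2 \<Omega> \<Longrightarrow> is_weak_gradient \<Omega> u g \<Longrightarrow> u \<in> H1 \<Omega>" by (auto simp: H1_def)

lemma wd_L2: "u \<in> H1 \<Omega> \<Longrightarrow> wd u j \<in> L2 \<Omega>"
  using H1_weak_gradient[of u] by (simp add: is_weak_gradient_iff wd_def)

lemma wd_parts: "u \<in> H1 \<Omega> \<Longrightarrow> \<phi> \<in> test_functions \<Omega> \<Longrightarrow> L2_inner \<Omega> u (partial_deriv j \<phi>) = - L2_inner \<Omega> (wd u j) \<phi>"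
  using H1_weak_gradient[of u] by (simp add: is_weak_gradient_iff wd_def)

lemma wd_unique:
  assumes "u \<in> L2 \<Omega>" "is_weak_gradient \<Omega> u g"
  shows "ae_eq \<Omega> (wd u j) (\<lambda>x. g x $ j)"
proof -
  have u: "u \<in> H1 \<Omega>" by (rule H1I) fact+
  show ?thesis
    by (rule ae_eq_if_test_eq[OF wd_L2[OF u]]) (use assms wd_parts[OF u, of _ j] in \<open>auto simp: is_weak_gradient_iff\<close>)
qed

lemma is_weak_gradient_comb:
  assumes "u \<in> L2 \<Omega>" "v \<in> L2 \<Omega>" "is_weak_gradient \<Omega> u g" "is_weak_gradient \<Omega> v h"
  shows "is_weak_gradient \<Omega> (\<lambda>x. u x + c * v x) (\<lambda>x. g x + c *\<^sub>R h x)"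
  unfolding is_weak_gradient_iff
proof (intro conjI ballI allI)
  note gh = assms(3,4)[unfolded is_weak_gradient_iff]
  show "(\<lambda>x. (g x + c *\<^sub>R h x) $ j) \<in> L2 \<Omega>" for j using gh L2_comb by simp
  fix \<phi> j assume p: "\<phi> \<in> test_functions \<Omega>"
  then have "L2_inner \<Omega> (\<lambda>x. u x + c * v x) (partial_deriv j \<phi>) = - (L2_inner \<Omega> (\<lambda>x. g x $ j) \<phi> + c * L2_inner \<Omega> (\<lambda>x. h x $ j) \<phi>)"
    using gh L2.lin[OF assms(1,2) test_L2[OF test_partial[OF p]]] by simp
  also have "\<dots> = - L2_inner \<Omega> (\<lambda>x. (g x + c *\<^sub>R h x) $ j) \<phi>"
    using gh L2.lin[OF _ _ test_L2[OF p], of "\<lambda>x. g x $ j" "\<lambda>x. h x $ j" c] by simp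
  finally show "L2_inner \<Omega> (\<lambda>x. u x + c * v x) (partial_deriv j \<phi>) = - L2_inner \<Omega> (\<lambda>x. (g x + c *\<^sub>R h x) $ j) \<phi>" .
qed

lemma H1_comb: "u \<in> H1 \<Omega> \<Longrightarrow> v \<in> H1 \<Omega> \<Longrightarrow> (\<lambda>x. u x + c * v x) \<in> H1 \<Omega>"
  by (rule H1I[OF L2_comb is_weak_gradient_comb[OF _ _ H1_weak_gradient H1_weak_gradient]]) (auto intro: H1_L2)

lemma wd_comb:
  assumes "u \<in> H1 \<Omega>" "v \<in> H1 \<Omega>"
  shows "ae_eq \<Omega> (wd (\<lambda>x. u x + c * v x) j) (\<lambda>x. wd u j x + c * wd v j x)"
  using wd_unique[OF L2_comb is_weak_gradient_comb[OF _ _ H1_weak_gradient H1_weak_gradient], of u v c j] assms H1_L2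
  by (simp add: wd_def)

lemma test_weak_gradient:
  assumes "\<phi> \<in> test_functions \<Omega>"
  shows "is_weak_gradient \<Omega> \<phi> (gradient \<phi>)"
  unfolding is_weak_gradient_iff gradient_def
  using test_integration_by_parts[OF assms] test_L2[OF test_partial[OF assms]] by simp

lemma test_H1: "\<phi> \<in> test_functions \<Omega> \<Longrightarrow> \<phi> \<in> H1 \<Omega>"
  using H1I[OF test_L2 test_weak_gradient] by blast

lemma test_wd: "\<phi> \<in> test_functions \<Omega> \<Longrightarrow> ae_eq \<Omega> (wd \<phi> j) (partial_deriv j \<phi>)"
  using wd_unique[OF test_L2 test_weak_gradient, of \<phi> j] by (simp add: gradient_def)

lemma weak_gradient_cong:
  assumes "u \<in> L2 \<Omega>" "v \<in> L2 \<Omega>" "ae_eq \<Omega> u v"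
  shows "is_weak_gradient \<Omega> u = is_weak_gradient \<Omega> v"
  unfolding is_weak_gradient_iff
  using L2_inner_cong_AE[OF assms(1,2) test_L2[OF test_partial] assms(3)] by auto

text \<open>
  Functions that agree almost everywhere have the same set of weak gradients, from which the choice
  operator takes the same element; hence an equation instead of equality almost everywhere.
\<close>

lemma wd_cong:
  assumes "u \<in> L2 \<Omega>" "v \<in> L2 \<Omega>" "ae_eq \<Omega> u v"
  shows "wd u = wd v"
  unfolding wd_def weak_gradient_def weak_gradient_cong[OF assms] ..

lemma H1_cong:
  assumes "u \<in> H1 \<Omega>" "v \<in> L2 \<Omega>" "ae_eq \<Omega> u v"
  shows "v \<in> H1 \<Omega>"
  using assms weak_gradient_cong[OF H1_L2[OF assms(1)] assms(2,3)] by (simp add: H1_def)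

text \<open>
  The form of \<open>1 - \<Delta>\<close>, i.e. the inner product of \<open>H\<^sup>1(\<Omega>)\<close>.
\<close>

definition h1 :: "(real^'n \<Rightarrow> real) \<Rightarrow> (real^'n \<Rightarrow> real) \<Rightarrow> real" where
  "h1 u v = L2_inner \<Omega> u v + (\<Sum>j\<in>UNIV. L2_inner \<Omega> (wd u j) (wd v j))"

sublocale H1: quadratic_space "H1 \<Omega>" h1
proof
  show "(\<lambda>x. 0) \<in> H1 \<Omega>" using test_H1[OF test_zero] .
  fix u v w :: "real^'n \<Rightarrow> real" and c :: real
  assume u: "u \<in> H1 \<Omega>"
  show "0 \<le> h1 u u" unfolding h1_def
    using u by (intro add_nonneg_nonneg sum_nonneg L2.nonneg H1_L2 wd_L2)
  assume v: "v \<in> H1 \<Omega>"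
  show "(\<lambda>x. u x + c * v x) \<in> H1 \<Omega>" using u v by (rule H1_comb)
  show "h1 u v = h1 v u" unfolding h1_def using u v by (simp add: L2.sym[OF H1_L2 H1_L2] L2.sym[OF wd_L2 wd_L2])
  assume w: "w \<in> H1 \<Omega>"
  have "L2_inner \<Omega> (wd (\<lambda>x. u x + c * v x) j) (wd w j) = L2_inner \<Omega> (wd u j) (wd w j) + c * L2_inner \<Omega> (wd v j) (wd w j)" for j
  proof -
    have "L2_inner \<Omega> (wd (\<lambda>x. u x + c * v x) j) (wd w j) = L2_inner \<Omega> (\<lambda>x. wd u j x + c * wd v j x) (wd w j)"
      by (rule L2_inner_cong_AE) (use u v w in \<open>auto intro!: wd_L2 H1_comb L2_comb wd_comb\<close>)
    then show ?thesis using u v w by (simp add: L2.lin wd_L2)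
  qed
  then show "h1 (\<lambda>x. u x + c * v x) w = h1 u w + c * h1 v w"
    using u v w by (simp add: h1_def L2.lin H1_L2 sum.distrib sum_distrib_left algebra_simps)
qed

lemma L2_nrm_le_H1: "u \<in> H1 \<Omega> \<Longrightarrow> L2.nrm u \<le> H1.nrm u"
  unfolding L2.nrm_def H1.nrm_def h1_def
  by (simp add: sum_nonneg L2.nonneg wd_L2)

lemma wd_nrm_le_H1: "u \<in> H1 \<Omega> \<Longrightarrow> L2.nrm (wd u j) \<le> H1.nrm u"
  unfolding L2.nrm_def H1.nrm_def h1_def
  using sum_nonneg_leq_bound[of UNIV "\<lambda>j. L2_inner \<Omega> (wd u j) (wd u j)" _ j] L2.nonneg[OF H1_L2]
  by (simp add: L2.nonneg wd_L2 add_increasing)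

lemma wd_diff:
  assumes "u \<in> H1 \<Omega>" "v \<in> H1 \<Omega>"
  shows "ae_eq \<Omega> (wd (\<lambda>x. u x - v x) j) (\<lambda>x. wd u j x - wd v j x)"
  using wd_comb[OF assms, of "-1" j] by simp

lemma H1_complete:
  assumes f: "\<And>n. f n \<in> H1 \<Omega>"
    and c: "\<And>e. e > 0 \<Longrightarrow> \<exists>N::nat. \<forall>m\<ge>N. \<forall>n\<ge>N. H1.nrm (\<lambda>x. f m x - f n x) < e"
  shows "\<exists>u\<in>H1 \<Omega>. (\<lambda>n. H1.nrm (\<lambda>x. f n x - u x)) \<longlonglongrightarrow> 0"
proof -
  have "\<exists>u\<in>L2 \<Omega>. (\<lambda>n. L2.nrm (\<lambda>x. f n x - u x)) \<longlonglongrightarrow> 0"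
  proof (rule L2_complete)
    show "f n \<in> L2 \<Omega>" for n by (rule H1_L2[OF f])
    show "\<exists>N. \<forall>m\<ge>N. \<forall>n\<ge>N. L2.nrm (\<lambda>x. f m x - f n x) < e" if e: "e > 0" for e
    proof -
      obtain N where N: "\<forall>m\<ge>N. \<forall>n\<ge>N. H1.nrm (\<lambda>x. f m x - f n x) < e" using c[OF e] by blast
      have "L2.nrm (\<lambda>x. f m x - f n x) < e" if "m \<ge> N" "n \<ge> N" for m n
        using L2_nrm_le_H1[OF H1.diff[OF f[of m] f[of n]]] N[rule_format, OF that] by linarith
      then show ?thesis by (intro exI[of _ N]) simp
    qed
  qed
  then obtain u where u: "u \<in> L2 \<Omega>" "(\<lambda>n. L2.nrm (\<lambda>x. f n x - u x)) \<longlonglongrightarrow> 0" by blast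
  have wn: "L2.nrm (wd (\<lambda>x. f m x - f n x) j) = L2.nrm (\<lambda>x. wd (f m) j x - wd (f n) j x)" for m n j
    using f by (intro L2_nrm_cong_AE wd_diff wd_L2 H1.diff L2.diff)
  have "\<exists>g\<in>L2 \<Omega>. (\<lambda>n. L2.nrm (\<lambda>x. wd (f n) j x - g x)) \<longlonglongrightarrow> 0" for j
  proof (rule L2_complete)
    show "wd (f n) j \<in> L2 \<Omega>" for n by (rule wd_L2[OF f])
    show "\<exists>N. \<forall>m\<ge>N. \<forall>n\<ge>N. L2.nrm (\<lambda>x. wd (f m) j x - wd (f n) j x) < e" if e: "e > 0" for e
    proof -
      obtain N where N: "\<forall>m\<ge>N. \<forall>n\<ge>N. H1.nrm (\<lambda>x. f m x - f n x) < e" using c[OF e] by blast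
      have "L2.nrm (\<lambda>x. wd (f m) j x - wd (f n) j x) < e" if "m \<ge> N" "n \<ge> N" for m n
        using wd_nrm_le_H1[OF H1.diff[OF f[of m] f[of n]], of j] N[rule_format, OF that] unfolding wn by linarith
      then show ?thesis by (intro exI[of _ N]) simp
    qed
  qed
  then have "\<forall>j. \<exists>g. g \<in> L2 \<Omega> \<and> (\<lambda>n. L2.nrm (\<lambda>x. wd (f n) j x - g x)) \<longlonglongrightarrow> 0" by (simp add: Bex_def)
  then have "\<exists>g. \<forall>j. g j \<in> L2 \<Omega> \<and> (\<lambda>n. L2.nrm (\<lambda>x. wd (f n) j x - g j x)) \<longlonglongrightarrow> 0" by (rule choice)
  then obtain g where "\<forall>j. g j \<in> L2 \<Omega> \<and> (\<lambda>n. L2.nrm (\<lambda>x. wd (f n) j x - g j x)) \<longlonglongrightarrow> 0" ..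
  then have g: "\<And>j. g j \<in> L2 \<Omega>" "\<And>j. (\<lambda>n. L2.nrm (\<lambda>x. wd (f n) j x - g j x)) \<longlonglongrightarrow> 0" by simp_all
  have wg: "is_weak_gradient \<Omega> u (\<lambda>x. \<chi> j. g j x)"
    unfolding is_weak_gradient_iff
  proof (intro conjI ballI allI)
    show "(\<lambda>x. (\<chi> j. g j x) $ j) \<in> L2 \<Omega>" for j using g by simp
    fix \<phi> j assume p: "\<phi> \<in> test_functions \<Omega>"
    have "(\<lambda>n. L2_inner \<Omega> (f n) (partial_deriv j \<phi>)) \<longlonglongrightarrow> L2_inner \<Omega> u (partial_deriv j \<phi>)"
      by (rule L2_inner_limit[OF H1_L2[OF f] u test_L2[OF test_partial[OF p]]])
    moreover have "(\<lambda>n. - L2_inner \<Omega> (wd (f n) j) \<phi>) \<longlonglongrightarrow> - L2_inner \<Omega> (g j) \<phi>"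
      by (intro tendsto_minus L2_inner_limit[OF wd_L2[OF f] g test_L2[OF p]])
    ultimately show "L2_inner \<Omega> u (partial_deriv j \<phi>) = - L2_inner \<Omega> (\<lambda>x. (\<chi> j. g j x) $ j) \<phi>"
      unfolding wd_parts[OF f p] using LIMSEQ_unique by simp
  qed
  have uH: "u \<in> H1 \<Omega>" by (rule H1I[OF u(1) wg])
  have wu: "ae_eq \<Omega> (wd u j) (g j)" for j using wd_unique[OF u(1) wg, of j] by simp
  have e: "L2.nrm (wd (\<lambda>x. f n x - u x) j) = L2.nrm (\<lambda>x. wd (f n) j x - g j x)" for n j
  proof (rule L2_nrm_cong_AE)
    show "ae_eq \<Omega> (wd (\<lambda>x. f n x - u x) j) (\<lambda>x. wd (f n) j x - g j x)"
      using wd_diff[OF f[of n] uH, of j] wu[of j] unfolding ae_eq_def by eventually_elim simp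
  qed (use f uH g in \<open>auto intro!: wd_L2 H1.diff L2.diff\<close>)
  have sq: "(H1.nrm (\<lambda>x. f n x - u x))\<^sup>2 = (L2.nrm (\<lambda>x. f n x - u x))\<^sup>2 + (\<Sum>j\<in>UNIV. (L2.nrm (\<lambda>x. wd (f n) j x - g j x))\<^sup>2)" for n
    unfolding e[symmetric] using H1.diff[OF f uH] by (simp add: H1.nrm_sq L2.nrm_sq H1_L2 wd_L2 h1_def)
  have "(\<lambda>n. (H1.nrm (\<lambda>x. f n x - u x))\<^sup>2) \<longlonglongrightarrow> 0\<^sup>2 + (\<Sum>j\<in>(UNIV::'n set). 0\<^sup>2)"
    unfolding sq by (intro tendsto_intros u g)
  then have "(\<lambda>n. sqrt ((H1.nrm (\<lambda>x. f n x - u x))\<^sup>2)) \<longlonglongrightarrow> sqrt 0" by (intro tendsto_real_sqrt) simp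
  then have "(\<lambda>n. H1.nrm (\<lambda>x. f n x - u x)) \<longlonglongrightarrow> 0" using H1.nrm_ge0[OF H1.diff[OF f uH]] by simp
  with uH show ?thesis by blast
qed

sublocale H1: complete_quadratic_space "H1 \<Omega>" h1
  by unfold_locales (rule H1_complete)

section \<open>The Neumann Laplacian and its resolvent\<close>

text \<open>
  The weak form of \<open>u = (1 - \<Delta>)\<^sup>-\<^sup>1 f\<close>. Since all of \<open>H\<^sup>1(\<Omega>)\<close> is admitted for \<open>v\<close>, it includes the Neumann
  boundary condition.
\<close>

lemma resolvent_exists:
  assumes f: "f \<in> L2 \<Omega>"
  shows "\<exists>u\<in>H1 \<Omega>. \<forall>v\<in>H1 \<Omega>. h1 u v = L2_inner \<Omega> f v"
proof (rule H1.riesz_representation)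
  show "L2_inner \<Omega> f (\<lambda>x. u x + c * v x) = L2_inner \<Omega> f u + c * L2_inner \<Omega> f v" if "u \<in> H1 \<Omega>" "v \<in> H1 \<Omega>" for u v c
    using L2.lin2[OF _ _ f] that H1_L2 by blast
  show "\<bar>L2_inner \<Omega> f v\<bar> \<le> L2.nrm f * H1.nrm v" if v: "v \<in> H1 \<Omega>" for v
    using L2.cauchy_schwarz[OF f H1_L2[OF v]] mult_left_mono[OF L2_nrm_le_H1[OF v] L2.nrm_ge0[OF f]] by linarith
qed

lemma integral_weak_gradient_inner:
  assumes "u \<in> H1 \<Omega>" "v \<in> H1 \<Omega>"
  shows "(\<integral>x. weak_gradient \<Omega> u x \<bullet> weak_gradient \<Omega> v x \<partial>M) = (\<Sum>j\<in>UNIV. L2_inner \<Omega> (wd u j) (wd v j))"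
  unfolding inner_vec_def L2_inner_def wd_def
  using L2_mult_integrable[OF wd_L2[OF assms(1)] wd_L2[OF assms(2)]] by (simp add: wd_def)

lemma is_weak_laplacian_unique:
  assumes "is_weak_laplacian \<Omega> u w"
  shows "is_weak_laplacian \<Omega> u (weak_laplacian \<Omega> u)" "ae_eq \<Omega> (weak_laplacian \<Omega> u) w"
proof -
  show *: "is_weak_laplacian \<Omega> u (weak_laplacian \<Omega> u)"
    unfolding weak_laplacian_def using someI[of "is_weak_laplacian \<Omega> u", OF assms] by simp
  show "ae_eq \<Omega> (weak_laplacian \<Omega> u) w"
    by (rule ae_eq_if_test_eq) (use assms * in \<open>auto simp: is_weak_laplacian_def L2_inner_def\<close>)
qed

text \<open>
  Green's formula against test functions identifies \<open>w\<close> as the weak Laplacian; against the other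
  elements of \<open>H\<^sup>1(\<Omega>)\<close> it is the boundary condition.
\<close>

lemma neumann_domI:
  assumes u: "u \<in> H1 \<Omega>" and w: "w \<in> L2 \<Omega>"
    and green: "\<And>v. v \<in> H1 \<Omega> \<Longrightarrow> L2_inner \<Omega> w v = - (\<Sum>j\<in>UNIV. L2_inner \<Omega> (wd u j) (wd v j))"
  shows "u \<in> neumann_dom \<Omega>" "ae_eq \<Omega> (weak_laplacian \<Omega> u) w"
proof -
  have l: "is_weak_laplacian \<Omega> u w"
    unfolding is_weak_laplacian_def
  proof (intro conjI ballI w)
    fix \<phi> assume p: "\<phi> \<in> test_functions \<Omega>"
    have "(\<integral>x. u x * laplacian \<phi> x \<partial>M) = (\<Sum>j\<in>UNIV. L2_inner \<Omega> u (partial_deriv j (partial_deriv j \<phi>)))"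
      unfolding laplacian_def L2_inner_def sum_distrib_left
      by (rule Bochner_Integration.integral_sum) (rule L2_mult_integrable[OF H1_L2[OF u] test_L2[OF test_partial[OF test_partial[OF p]]]])
    also have "\<dots> = - (\<Sum>j\<in>UNIV. L2_inner \<Omega> (wd u j) (partial_deriv j \<phi>))"
      by (simp add: wd_parts[OF u test_partial[OF p]] sum_negf)
    also have "\<dots> = - (\<Sum>j\<in>UNIV. L2_inner \<Omega> (wd u j) (wd \<phi> j))"
    proof -
      have "L2_inner \<Omega> (wd \<phi> j) (wd u j) = L2_inner \<Omega> (partial_deriv j \<phi>) (wd u j)" for j
        by (rule L2_inner_cong_AE[OF wd_L2[OF test_H1[OF p]] test_L2[OF test_partial[OF p]] wd_L2[OF u] test_wd[OF p]])
      then show ?thesis by (simp add: L2_inner_def mult.commute)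
    qed
    also have "\<dots> = (\<integral>x. w x * \<phi> x \<partial>M)" using green[OF test_H1[OF p]] by (simp add: L2_inner_def)
    finally show "(\<integral>x. u x * laplacian \<phi> x \<partial>M) = (\<integral>x. w x * \<phi> x \<partial>M)" .
  qed
  show ae: "ae_eq \<Omega> (weak_laplacian \<Omega> u) w" by (rule is_weak_laplacian_unique(2)[OF l])
  have lL: "weak_laplacian \<Omega> u \<in> L2 \<Omega>" using is_weak_laplacian_unique(1)[OF l] by (simp add: is_weak_laplacian_def)
  have "(\<integral>x. v x * weak_laplacian \<Omega> u x \<partial>M) = - (\<integral>x. weak_gradient \<Omega> v x \<bullet> weak_gradient \<Omega> u x \<partial>M)" if v: "v \<in> H1 \<Omega>" for v
    using L2_inner_cong_AE[OF lL w H1_L2[OF v] ae] green[OF v] integral_weak_gradient_inner[OF v u]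
    by (simp add: L2_inner_def mult.commute)
  then show "u \<in> neumann_dom \<Omega>" using u l by (auto simp: neumann_dom_def)
qed

lemma neumann_domD:
  assumes "u \<in> neumann_dom \<Omega>"
  shows "u \<in> H1 \<Omega>" "weak_laplacian \<Omega> u \<in> L2 \<Omega>"
    "\<And>v. v \<in> H1 \<Omega> \<Longrightarrow> L2_inner \<Omega> (weak_laplacian \<Omega> u) v = - (\<Sum>j\<in>UNIV. L2_inner \<Omega> (wd u j) (wd v j))"
proof -
  show u: "u \<in> H1 \<Omega>" using assms by (simp add: neumann_dom_def)
  obtain w where "is_weak_laplacian \<Omega> u w" using assms by (auto simp: neumann_dom_def)
  from is_weak_laplacian_unique(1)[OF this] show "weak_laplacian \<Omega> u \<in> L2 \<Omega>" by (simp add: is_weak_laplacian_def)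
  show "L2_inner \<Omega> (weak_laplacian \<Omega> u) v = - (\<Sum>j\<in>UNIV. L2_inner \<Omega> (wd u j) (wd v j))" if v: "v \<in> H1 \<Omega>" for v
    using assms v integral_weak_gradient_inner[OF v u] by (simp add: neumann_dom_def L2_inner_def mult.commute)
qed

lemma neumann_resolvent:
  assumes u: "u \<in> H1 \<Omega>" and f: "f \<in> L2 \<Omega>" and r: "\<And>v. v \<in> H1 \<Omega> \<Longrightarrow> h1 u v = L2_inner \<Omega> f v"
  shows "u \<in> neumann_dom \<Omega>" "ae_eq \<Omega> (weak_laplacian \<Omega> u) (\<lambda>x. u x - f x)"
proof -
  note uL = H1_L2[OF u]
  have g: "L2_inner \<Omega> (\<lambda>x. u x - f x) v = - (\<Sum>j\<in>UNIV. L2_inner \<Omega> (wd u j) (wd v j))" if v: "v \<in> H1 \<Omega>" for v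
    using r[OF v] L2.lin_diff[OF uL f H1_L2[OF v]] by (simp add: h1_def)
  show "u \<in> neumann_dom \<Omega>" "ae_eq \<Omega> (weak_laplacian \<Omega> u) (\<lambda>x. u x - f x)"
    using neumann_domI[OF u L2.diff[OF uL f] g] by simp_all
qed

lemma neumann_dom_h1:
  assumes "u \<in> neumann_dom \<Omega>" "v \<in> H1 \<Omega>"
  shows "h1 u v = L2_inner \<Omega> (\<lambda>x. u x - weak_laplacian \<Omega> u x) v"
  using neumann_domD[OF assms(1)] L2.lin_diff[OF H1_L2 _ H1_L2, of u "weak_laplacian \<Omega> u" v] assms(2)
  by (simp add: h1_def)

text \<open>
  The weak Laplacian is a chosen representative, so it is linear only up to null sets.
\<close>

lemma neumann_comb:
  assumes u: "u \<in> neumann_dom \<Omega>" and v: "v \<in> neumann_dom \<Omega>"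
  shows "(\<lambda>x. u x + c * v x) \<in> neumann_dom \<Omega>"
    and "ae_eq \<Omega> (weak_laplacian \<Omega> (\<lambda>x. u x + c * v x)) (\<lambda>x. weak_laplacian \<Omega> u x + c * weak_laplacian \<Omega> v x)"
proof -
  note uH = neumann_domD(1)[OF u] and vH = neumann_domD(1)[OF v]
  have uf: "(\<lambda>x. u x - weak_laplacian \<Omega> u x) \<in> L2 \<Omega>" by (rule L2.diff[OF H1_L2[OF uH] neumann_domD(2)[OF u]])
  have vf: "(\<lambda>x. v x - weak_laplacian \<Omega> v x) \<in> L2 \<Omega>" by (rule L2.diff[OF H1_L2[OF vH] neumann_domD(2)[OF v]])
  let ?f = "\<lambda>x. (u x - weak_laplacian \<Omega> u x) + c * (v x - weak_laplacian \<Omega> v x)"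
  have f: "?f \<in> L2 \<Omega>" by (rule L2_comb[OF uf vf])
  have "h1 (\<lambda>x. u x + c * v x) z = L2_inner \<Omega> ?f z" if z: "z \<in> H1 \<Omega>" for z
    unfolding H1.lin[OF uH vH z] L2.lin[OF uf vf H1_L2[OF z]] neumann_dom_h1[OF u z] neumann_dom_h1[OF v z] ..
  note n = neumann_resolvent[OF H1_comb[OF uH vH] f this]
  show "(\<lambda>x. u x + c * v x) \<in> neumann_dom \<Omega>" by (rule n(1))
  have "(\<lambda>x. u x + c * v x - ?f x) = (\<lambda>x. weak_laplacian \<Omega> u x + c * weak_laplacian \<Omega> v x)"
    by (auto simp: algebra_simps)
  with n(2) show "ae_eq \<Omega> (weak_laplacian \<Omega> (\<lambda>x. u x + c * v x)) (\<lambda>x. weak_laplacian \<Omega> u x + c * weak_laplacian \<Omega> v x)"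
    by simp
qed

lemma neumann_cong:
  assumes u: "u \<in> neumann_dom \<Omega>" and v: "v \<in> L2 \<Omega>" and e: "ae_eq \<Omega> u v"
  shows "v \<in> neumann_dom \<Omega>" "ae_eq \<Omega> (weak_laplacian \<Omega> u) (weak_laplacian \<Omega> v)"
proof -
  note uH = neumann_domD(1)[OF u]
  note uL = H1_L2[OF uH]
  have f: "(\<lambda>x. u x - weak_laplacian \<Omega> u x) \<in> L2 \<Omega>" by (rule L2.diff[OF uL neumann_domD(2)[OF u]])
  have "h1 v z = L2_inner \<Omega> (\<lambda>x. u x - weak_laplacian \<Omega> u x) z" if z: "z \<in> H1 \<Omega>" for z
    using neumann_dom_h1[OF u z] L2_inner_cong_AE[OF uL v H1_L2[OF z] e] wd_cong[OF uL v e] by (simp add: h1_def)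
  note n = neumann_resolvent[OF H1_cong[OF uH v e] f this]
  show "v \<in> neumann_dom \<Omega>" by (rule n(1))
  have "ae_eq \<Omega> (weak_laplacian \<Omega> v) (\<lambda>x. v x - (u x - weak_laplacian \<Omega> u x))" by (rule n(2))
  then show "ae_eq \<Omega> (weak_laplacian \<Omega> u) (weak_laplacian \<Omega> v)"
    using e unfolding ae_eq_def by eventually_elim simp
qed

end

section \<open>Fields tangential to the boundary\<close>

text \<open>
  Tangency is a condition on the values at the boundary. It suffices to ask for one defining
  function at each point, because all of them have the same tangent space there.
\<close>

definition tangential :: "(real^'n::finite) set \<Rightarrow> (real^'n \<Rightarrow> real^'n) \<Rightarrow> bool" where
  "tangential \<Omega> F \<longleftrightarrow>
     (\<forall>z\<in>frontier \<Omega>. \<exists>U \<rho>. z \<in> U \<and> defining_function \<Omega> U \<rho> \<and> F z \<bullet> gradient \<rho> z = 0)"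

text \<open>
  Otherwise some direction \<open>h\<close> would decrease \<open>\<rho>\<close> and increase \<open>\<rho>'\<close> to first order, whereas close to
  the boundary point both are negative exactly in \<open>\<Omega>\<close>.
\<close>

lemma defining_functions_same_tangent_space:
  assumes r: "defining_function \<Omega> U \<rho>" and r': "defining_function \<Omega> U' \<rho>'"
    and z: "z \<in> frontier \<Omega>" "z \<in> U" "z \<in> U'" and v: "v \<bullet> gradient \<rho>' z = 0"
  shows "v \<bullet> gradient \<rho> z = 0"
proof (rule ccontr)
  assume ne: "v \<bullet> gradient \<rho> z \<noteq> 0"
  have o: "open U" "open U'" and s: "smooth_on U \<rho>" "smooth_on U' \<rho>'"
    and zero: "\<rho> z = 0" "\<rho>' z = 0" and gne: "gradient \<rho>' z \<noteq> 0"
    using r r' z by (auto simp: defining_function_def)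
  (* The multiple - p of v decreases rho; the small multiple e of the gradient of rho' makes rho' increase
     without spoiling this. *)
  define p where "p = v \<bullet> gradient \<rho> z"
  define k where "k = gradient \<rho>' z \<bullet> gradient \<rho> z"
  define e where "e = p\<^sup>2 / (2 * (\<bar>k\<bar> + 1))"
  define h where "h = (- p) *\<^sub>R v + e *\<^sub>R gradient \<rho>' z"
  have p2: "p\<^sup>2 > 0" using ne by (simp add: p_def)
  then have e: "e > 0" by (simp add: e_def)
  have "h \<bullet> gradient \<rho> z = - p\<^sup>2 + e * k"
    by (simp add: h_def p_def k_def inner_add_left inner_diff_left power2_eq_square)
  then have "gradient \<rho> z \<bullet> h = - p\<^sup>2 + e * k" by (simp add: inner_commute)
  also have "e * k \<le> p\<^sup>2 / 2"
  proof -
    have "e * k \<le> e * (\<bar>k\<bar> + 1)" using e by (intro mult_left_mono) auto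
    also have "\<dots> = p\<^sup>2 / 2" by (simp add: e_def field_simps)
    finally show ?thesis .
  qed
  finally have neg: "gradient \<rho> z \<bullet> h < 0" using p2 by linarith
  have "h \<bullet> gradient \<rho>' z = e * (norm (gradient \<rho>' z))\<^sup>2"
    using v by (simp add: h_def inner_add_left inner_diff_left power2_norm_eq_inner)
  then have "gradient \<rho>' z \<bullet> h = e * (norm (gradient \<rho>' z))\<^sup>2" by (simp add: inner_commute)
  then have pos: "gradient \<rho>' z \<bullet> h > 0" using e gne by simp
  have d1: "((\<lambda>s. \<rho> (z + s *\<^sub>R h)) has_real_derivative gradient \<rho> z \<bullet> h) (at 0)"
    using line_has_derivative[of \<rho> z 0 h] smooth_on_differentiable_at[OF s(1) o(1) z(2)] by simp
  have d2: "((\<lambda>s. \<rho>' (z + s *\<^sub>R h)) has_real_derivative gradient \<rho>' z \<bullet> h) (at 0)"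
    using line_has_derivative[of \<rho>' z 0 h] smooth_on_differentiable_at[OF s(2) o(2) z(3)] by simp
  obtain a where a: "a > 0" "\<And>t. t > 0 \<Longrightarrow> t < a \<Longrightarrow> \<rho> (z + t *\<^sub>R h) < 0"
    using DERIV_neg_dec_right[OF d1 neg] zero by auto
  obtain b where b: "b > 0" "\<And>t. t > 0 \<Longrightarrow> t < b \<Longrightarrow> \<rho>' (z + t *\<^sub>R h) > 0"
    using DERIV_pos_inc_right[OF d2 pos] zero by auto
  have "open (U \<inter> U')" "z \<in> U \<inter> U'" using o z by auto
  then obtain c where c: "c > 0" "ball z c \<subseteq> U \<inter> U'" using openE by blast
  define t where "t = min (min a b) (c / (norm h + 1)) / 2"
  have m: "min (min a b) (c / (norm h + 1)) > 0" using a(1) b(1) c(1) by (simp add: add_nonneg_pos)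
  have "q / 2 > 0 \<and> q / 2 < q" if "q > 0" for q :: real using that by simp
  from this[OF m] have "t > 0" "t < min (min a b) (c / (norm h + 1))" unfolding t_def by blast+
  then have t: "t > 0" "t < a" "t < b" "t < c / (norm h + 1)" by simp_all
  have "t * norm h \<le> t * (norm h + 1)" using t(1) by (intro mult_left_mono) auto
  also have "\<dots> < c" using t(4) by (simp add: pos_less_divide_eq add_nonneg_pos)
  finally have "z + t *\<^sub>R h \<in> ball z c" using t(1) by (simp add: dist_norm)
  then have "z + t *\<^sub>R h \<in> U" "z + t *\<^sub>R h \<in> U'" using c(2) by auto
  then have "z + t *\<^sub>R h \<in> \<Omega>" using a(2)[OF t(1,2)] r by (auto simp: defining_function_def)
  then have "\<rho>' (z + t *\<^sub>R h) < 0" using \<open>z + t *\<^sub>R h \<in> U'\<close> r' by (auto simp: defining_function_def)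
  with b(2)[OF t(1,3)] show False by simp
qed

lemma tangentialD:
  assumes "tangential \<Omega> F" "defining_function \<Omega> U \<rho>" "z \<in> frontier \<Omega>" "z \<in> U"
  shows "F z \<bullet> gradient \<rho> z = 0"
  using assms defining_functions_same_tangent_space unfolding tangential_def by metis

lemma tangentialI_normal:
  assumes n: "outer_unit_normal \<Omega> \<nu>" and F: "\<And>z. z \<in> frontier \<Omega> \<Longrightarrow> F z \<bullet> \<nu> z = 0"
  shows "tangential \<Omega> F"
  unfolding tangential_def
proof
  fix z assume z: "z \<in> frontier \<Omega>"
  then obtain U \<rho> where u: "z \<in> U" "defining_function \<Omega> U \<rho>" "\<nu> z = gradient \<rho> z /\<^sub>R norm (gradient \<rho> z)"
    using n unfolding outer_unit_normal_def by blast
  have "gradient \<rho> z \<noteq> 0" using u z by (auto simp: defining_function_def)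
  then have "F z \<bullet> gradient \<rho> z = 0" using F[OF z] by (simp add: u(3))
  with u show "\<exists>U \<rho>. z \<in> U \<and> defining_function \<Omega> U \<rho> \<and> F z \<bullet> gradient \<rho> z = 0" by blast
qed

section \<open>A divergence theorem for tangential fields\<close>

text \<open>
  A square is the simplest building block of a continuously differentiable step function, which is
  all that the cutoffs below have to be.
\<close>

definition ramp2 :: "real \<Rightarrow> real" where "ramp2 t = (max 0 t)\<^sup>2"

lemma ramp2_DERIV: "(ramp2 has_real_derivative 2 * max 0 t) (at t)"
proof -
  consider "t < 0" | "t > 0" | "t = 0" by linarith
  then show ?thesis
  proof cases
    case 1
    then show ?thesis using has_field_derivative_transform_within_open[of "\<lambda>_. 0" 0 t "{..<0}" ramp2]
      by (auto simp: ramp2_def)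
  next
    case 2
    have "((\<lambda>t::real. t\<^sup>2) has_real_derivative 2 * t) (at t)" by (auto intro!: derivative_eq_intros)
    then show ?thesis using 2 has_field_derivative_transform_within_open[of "\<lambda>t. t\<^sup>2" "2 * t" t "{0<..}" ramp2]
      by (auto simp: ramp2_def)
  next
    case 3
    have "((\<lambda>h. ramp2 h / h) \<longlongrightarrow> 0) (at 0)"
    proof (rule Lim_null_comparison)
      show "\<forall>\<^sub>F h in at 0. norm (ramp2 h / h) \<le> \<bar>h\<bar>"
        by (auto simp: ramp2_def max_def power2_eq_square intro!: always_eventually)
      show "((\<lambda>h::real. \<bar>h\<bar>) \<longlongrightarrow> 0) (at 0)" by (rule tendsto_rabs_zero) simp
    qed
    then show ?thesis using 3 by (simp add: has_field_derivative_iff ramp2_def)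
  qed
qed

text \<open>
  The second primitive of a function with the values \<open>4\<close>, \<open>-4\<close> on the two halves of the unit
  interval.
\<close>

definition step :: "real \<Rightarrow> real" where "step t = 2 * (ramp2 t - 2 * ramp2 (t - 1/2) + ramp2 (t - 1))"
definition step' :: "real \<Rightarrow> real" where "step' t = 4 * (max 0 t - 2 * max 0 (t - 1/2) + max 0 (t - 1))"

lemma step_DERIV: "(step has_real_derivative step' t) (at t)"
proof -
  have "((\<lambda>t. ramp2 (t - a)) has_real_derivative 2 * max 0 (t - a)) (at t)" for a
  proof -
    have "((\<lambda>t. t - a) has_real_derivative 1) (at t)" by (auto intro!: derivative_eq_intros)
    from DERIV_chain2[OF ramp2_DERIV this] show ?thesis by simp
  qed
  from this[of "1/2"] this[of 1] show ?thesis
    unfolding step_def[abs_def] step'_def by (auto intro!: derivative_eq_intros ramp2_DERIV)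
qed

lemma step_0: "t \<le> 0 \<Longrightarrow> step t = 0" "t \<le> 0 \<Longrightarrow> step' t = 0"
  by (auto simp: step_def step'_def ramp2_def)

lemma step_1: "t \<ge> 1 \<Longrightarrow> step t = 1" "t \<ge> 1 \<Longrightarrow> step' t = 0"
  by (auto simp: step_def step'_def ramp2_def max_def power2_eq_square algebra_simps)

lemma step'_bounds: "0 \<le> step' t" "step' t \<le> 2"
  by (auto simp: step'_def max_def)

lemma step_mono: "s \<le> t \<Longrightarrow> step s \<le> step t"
  using DERIV_nonneg_imp_nondecreasing[of s t step] step_DERIV step'_bounds by blast

lemma step_bounds: "0 \<le> step t" "step t \<le> 1"
proof -
  show "0 \<le> step t" using step_mono[of "min t 0" t] step_0(1)[of "min t 0"] by simp
  show "step t \<le> 1" using step_mono[of t "max t 1"] step_1(1)[of "max t 1"] by simp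
qed

lemma step'_continuous: "continuous_on S step'"
  unfolding step'_def[abs_def] by (intro continuous_intros)

lemma step_continuous: "continuous_on S step"
  using DERIV_continuous_on[of S step step'] step_DERIV has_field_derivative_at_within by blast

locale tangential_field = bounded_open \<Omega> for \<Omega> :: "(real^'n::finite) set" +
  fixes F :: "real^'n \<Rightarrow> real^'n" and DF :: "real^'n \<Rightarrow> real^'n^'n" and L :: real
  assumes sb: "smooth_boundary \<Omega>"
    and Fcont: "continuous_on (closure \<Omega>) F"
    and Fder: "x \<in> \<Omega> \<Longrightarrow> (F has_derivative (\<lambda>h. DF x *v h)) (at x)"
    and DFcont: "continuous_on \<Omega> DF"
    and DFbound: "x \<in> \<Omega> \<Longrightarrow> norm (DF x *v h) \<le> L * norm h"
    and tang: "tangential \<Omega> F"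
begin

lemma F_bounded: obtains B where "B > 0" "\<And>x. x \<in> closure \<Omega> \<Longrightarrow> norm (F x) \<le> B"
  by (rule continuous_on_compact_bounded[OF compact_closure_Omega Fcont]) (rule that)

text \<open>
  A tangential field crosses the level sets of \<open>\<rho>\<close> near the boundary at a rate at most proportional to \<open>- \<rho>\<close>.
  Starting at \<open>y\<close>, move in the fixed direction \<open>n\<close>, the gradient of \<open>\<rho>\<close> at \<open>x0\<close>. In this direction \<open>\<rho>\<close> grows at a rate of at
  least \<open>c\<close>, so the boundary is hit after time \<open>s1 \<le> - \<rho> y / c\<close>; at that point the product of \<open>F\<close> and \<open>\<nabla>\<rho>\<close> is \<open>0\<close>,
  and along the way its derivative is bounded. The estimate serves twice: for the
  cutoffs of the divergence theorem and for the invariance of \<open>\<Omega>\<close> under the flow.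
\<close>

lemma boundary_estimate:
  assumes df: "defining_function \<Omega> U \<rho>" and x0: "x0 \<in> frontier \<Omega>" "x0 \<in> U"
  shows "\<exists>r>0. \<exists>C\<ge>0. \<exists>G. ball x0 r \<subseteq> U \<and> (\<forall>y\<in>ball x0 r. norm (gradient \<rho> y) \<le> G) \<and>
    (\<forall>y\<in>\<Omega> \<inter> ball x0 r. \<bar>F y \<bullet> gradient \<rho> y\<bar> \<le> C * (- \<rho> y))"
proof -
  have oU: "open U" and sm: "smooth_on U \<rho>" and inner: "\<Omega> \<inter> U = {y \<in> U. \<rho> y < 0}"
    and front: "frontier \<Omega> \<inter> U = {y \<in> U. \<rho> y = 0}" and n0: "gradient \<rho> x0 \<noteq> 0" and \<rho>0: "\<rho> x0 = 0"
    using df x0 by (auto simp: defining_function_def)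
  note d\<rho> = smooth_on_differentiable_at[OF sm oU]
  note gc = smooth_on_gradient_continuous[OF sm]
  define n where "n = gradient \<rho> x0"
  define c where "c = (norm n)\<^sup>2 / 2"
  have N: "norm n > 0" using n0 by (simp add: n_def)
  then have c: "c > 0" by (simp add: c_def)
  have "continuous_on U (\<lambda>y. gradient \<rho> y \<bullet> n)" using gc by (intro continuous_intros)
  then have "isCont (\<lambda>y. gradient \<rho> y \<bullet> n) x0" using oU x0(2) by (simp add: continuous_on_eq_continuous_at)
  moreover have "gradient \<rho> x0 \<bullet> n > c" using N by (simp add: c_def power2_norm_eq_inner flip: n_def)
  ultimately have "\<forall>\<^sub>F y in nhds x0. gradient \<rho> y \<bullet> n > c"
    using tendsto_at_iff_tendsto_nhds[of "\<lambda>y. gradient \<rho> y \<bullet> n" x0] order_tendstoD(1) unfolding isCont_def by blast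
  moreover have "\<forall>\<^sub>F y in nhds x0. y \<in> U" using oU x0(2) by (rule eventually_nhds_in_open)
  ultimately have "\<forall>\<^sub>F y in nhds x0. gradient \<rho> y \<bullet> n > c \<and> y \<in> U" by (rule eventually_conj)
  then obtain R0 where R0: "R0 > 0" "\<And>y. dist y x0 < R0 \<Longrightarrow> gradient \<rho> y \<bullet> n > c \<and> y \<in> U"
    by (auto simp: eventually_nhds_metric)
  define R where "R = R0 / 2"
  have R: "R > 0" "\<And>y. y \<in> cball x0 R \<Longrightarrow> gradient \<rho> y \<bullet> n > c" "cball x0 R \<subseteq> U"
    using R0 by (auto simp: R_def dist_commute)
  obtain G where G: "G > 0" "\<And>x. x \<in> cball x0 R \<Longrightarrow> norm (gradient \<rho> x) \<le> G"
    by (rule continuous_on_compact_bounded[OF compact_cball continuous_on_subset[OF gc R(3)]]) blast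
  define H where "H x = (\<chi> i. gradient (partial_deriv i \<rho>) x)" for x
  have "continuous_on U H"
    unfolding H_def[abs_def] by (intro continuous_on_vec_lambda smooth_on_gradient_continuous smooth_partial sm)
  then obtain K where K: "K > 0" "\<And>x. x \<in> cball x0 R \<Longrightarrow> norm (H x) \<le> K"
    using continuous_on_compact_bounded[OF compact_cball continuous_on_subset[OF _ R(3)]] by blast
  have Hd: "(gradient \<rho> has_derivative (\<lambda>h. H x *v h)) (at x)" if "x \<in> U" for x
  proof (rule has_derivative_matrix)
    show "((\<lambda>x. gradient \<rho> x $ i) has_derivative (\<lambda>h. H x $ i \<bullet> h)) (at x)" for i
      using gradient_has_derivative[OF smooth_on_differentiable_at[OF smooth_partial[OF sm] oU that]]
      by (simp add: H_def gradient_def[of \<rho>])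
  qed
  obtain BF where BF: "BF > 0" "\<And>x. x \<in> closure \<Omega> \<Longrightarrow> norm (F x) \<le> BF" by (rule F_bounded) blast
  have "isCont \<rho> x0" using d\<rho>[OF x0(2)] differentiable_imp_continuous_within by blast
  then have "(\<rho> \<longlongrightarrow> \<rho> x0) (nhds x0)" unfolding isCont_def tendsto_at_iff_tendsto_nhds[of \<rho> x0] .
  then have "\<forall>\<^sub>F y in nhds x0. dist (\<rho> y) (\<rho> x0) < c * R / (2 * norm n)"
    using c R(1) N by (intro tendstoD) auto
  then obtain r0 where r0: "r0 > 0" "\<And>y. dist y x0 < r0 \<Longrightarrow> \<bar>\<rho> y\<bar> < c * R / (2 * norm n)"
    by (auto simp: eventually_nhds_metric \<rho>0)
  define r where "r = min r0 (R / 2)"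
  have r: "r > 0" "r \<le> R / 2" "r \<le> r0" using r0(1) R(1) by (auto simp: r_def)
  have rR: "ball x0 r \<subseteq> cball x0 R" using r R(1) by auto
  define L' where "L' = max L 0"
  define KH where "KH = real CARD('n) * K"
  define C where "C = (BF * (KH * norm n) + L' * norm n * G) / c"
  have C0: "C \<ge> 0" unfolding C_def using c G(1) BF(1) K(1) by (simp add: L'_def KH_def)
  have est: "\<bar>F y \<bullet> gradient \<rho> y\<bar> \<le> C * (- \<rho> y)" if y: "y \<in> \<Omega>" "y \<in> ball x0 r" for y
  proof -
    have yU: "y \<in> U" using y(2) rR R(3) by blast
    have neg: "\<rho> y < 0" using y(1) yU inner by auto
    (* After time sm the value of rho is nonnegative. *)
    define sm where "sm = - \<rho> y / c"
    have sm: "sm > 0" using neg c by (simp add: sm_def divide_neg_pos)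
    have sb: "sm * norm n < R / 2"
    proof -
      have "- \<rho> y < c * R / (2 * norm n)" using r0(2)[of y] y(2) r(3) by (simp add: dist_commute)
      then have "sm < R / (2 * norm n)" using c N by (simp add: sm_def field_simps)
      then show ?thesis using N by (simp add: field_simps)
    qed
    have inb: "y + s *\<^sub>R n \<in> cball x0 R" if s: "0 \<le> s" "s \<le> sm" for s
    proof -
      have "norm (s *\<^sub>R n) \<le> sm * norm n" using s by (simp add: mult_right_mono)
      then have "dist x0 (y + s *\<^sub>R n) \<le> dist x0 y + sm * norm n"
        using norm_triangle_ineq4[of "x0 - y" "s *\<^sub>R n"] by (simp add: dist_norm algebra_simps)
      also have "\<dots> \<le> R" using y(2) r(2) sb by simp
      finally show ?thesis by simp
    qed
    define p where "p s = \<rho> (y + s *\<^sub>R n)" for s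
    have pd: "(p has_real_derivative gradient \<rho> (y + s *\<^sub>R n) \<bullet> n) (at s)" if "0 \<le> s" "s \<le> sm" for s
      unfolding p_def by (rule line_has_derivative[OF d\<rho>]) (use inb[OF that] R(3) in blast)
    have inc: "p s + c * (t - s) \<le> p t" if st: "0 \<le> s" "s < t" "t \<le> sm" for s t
    proof -
      obtain z where z: "z > s" "z < t" "p t - p s = (t - s) * (gradient \<rho> (y + z *\<^sub>R n) \<bullet> n)"
        using MVT2[OF st(2), of p "\<lambda>s. gradient \<rho> (y + s *\<^sub>R n) \<bullet> n"] pd st by auto
      have "gradient \<rho> (y + z *\<^sub>R n) \<bullet> n > c" using R(2)[OF inb[of z]] z st by simp
      then have "(t - s) * c \<le> (t - s) * (gradient \<rho> (y + z *\<^sub>R n) \<bullet> n)" using st by (intro mult_left_mono) auto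
      with z(3) show ?thesis by (simp add: mult.commute)
    qed
    have p0: "p 0 = \<rho> y" by (simp add: p_def)
    have "0 \<le> p sm" using inc[of 0 sm] sm c by (simp add: p0 sm_def)
    moreover have "continuous_on {0..sm} p" using DERIV_isCont[OF pd] by (intro continuous_at_imp_continuous_on) simp
    ultimately obtain s1 where s1: "0 \<le> s1" "s1 \<le> sm" "p s1 = 0"
      using IVT'[of p 0 0 sm] sm neg p0 by auto
    have s1pos: "s1 > 0" using s1 p0 neg by (cases "s1 = 0") auto
    have inO: "y + s *\<^sub>R n \<in> \<Omega>" if s: "0 \<le> s" "s < s1" for s
    proof -
      have "c * (s1 - s) > 0" using c s by simp
      then have "p s < 0" using inc[of s s1] s s1 by simp
      moreover have "y + s *\<^sub>R n \<in> U" using inb[of s] s s1 R(3) by auto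
      ultimately show ?thesis using inner by (auto simp: p_def)
    qed
    define z where "z = y + s1 *\<^sub>R n"
    have zc: "z \<in> cball x0 R" using inb[of s1] s1 by (simp add: z_def)
    then have zU: "z \<in> U" using R(3) by blast
    have zF: "z \<in> frontier \<Omega>" using s1(3) zU front by (auto simp: p_def z_def)
    then have zcl: "z \<in> closure \<Omega>" by (simp add: frontier_def)
    have tz: "F z \<bullet> gradient \<rho> z = 0" by (rule tangentialD[OF tang df zF zU])
    have cl: "y + s *\<^sub>R n \<in> closure \<Omega>" if "s \<in> {0..s1}" for s
    proof (cases "s = s1")
      case True then show ?thesis using zcl by (simp add: z_def)
    next
      case False then show ?thesis using inO[of s] that closure_subset[of \<Omega>] by auto
    qed
    have inR: "y + s *\<^sub>R n \<in> cball x0 R" if "s \<in> {0..s1}" for s using inb[of s] that s1 by simp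
    (* At the end point F need not be differentiable, so the mean value theorem is used with
       continuity there. *)
    define f where "f s = F (y + s *\<^sub>R n) \<bullet> gradient \<rho> (y + s *\<^sub>R n)" for s
    define f' where "f' s = F (y + s *\<^sub>R n) \<bullet> (H (y + s *\<^sub>R n) *v n) + (DF (y + s *\<^sub>R n) *v n) \<bullet> gradient \<rho> (y + s *\<^sub>R n)" for s
    have ct: "continuous_on {0..s1} f"
      unfolding f_def[abs_def] using inR R(3)
      by (intro continuous_on_inner continuous_on_compose2[OF Fcont] continuous_on_compose2[OF gc])
        (auto intro!: continuous_intros cl)
    have fd: "(f has_derivative (\<lambda>t. t * f' s)) (at s)" if s: "0 < s" "s < s1" for s
    proof -
      have l: "((\<lambda>s. y + s *\<^sub>R n) has_derivative (\<lambda>t. t *\<^sub>R n)) (at s)" by (auto intro!: derivative_eq_intros)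
      have "y + s *\<^sub>R n \<in> U" using inR[of s] R(3) s by auto
      from has_derivative_inner[OF diff_chain_at[OF l Fder[OF inO]] diff_chain_at[OF l Hd[OF this]]] s
      show ?thesis by (simp add: f_def[abs_def] f'_def o_def matrix_vector_mult_scaleR algebra_simps)
    qed
    obtain s where s: "0 < s" "s < s1" "f s1 - f 0 = (s1 - 0) * f' s" using mvt[OF s1pos ct fd] by blast
    have f's: "\<bar>f' s\<bar> \<le> BF * (KH * norm n) + L' * norm n * G"
    proof -
      let ?w = "y + s *\<^sub>R n"
      have w: "?w \<in> cball x0 R" "?w \<in> closure \<Omega>" "?w \<in> \<Omega>" using inR[of s] cl[of s] inO[of s] s by simp_all
      have "\<bar>F ?w \<bullet> (H ?w *v n)\<bar> \<le> norm (F ?w) * norm (H ?w *v n)" by (rule Cauchy_Schwarz_ineq2)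
      also have "\<dots> \<le> BF * (KH * norm n)"
      proof (rule mult_mono)
        have "norm (H ?w *v n) \<le> real CARD('n) * norm (H ?w) * norm n" by (rule norm_matrix_vector_le)
        also have "\<dots> \<le> KH * norm n" unfolding KH_def using K(2)[OF w(1)] by (intro mult_right_mono mult_left_mono) auto
        finally show "norm (H ?w *v n) \<le> KH * norm n" .
      qed (use BF w(2) in auto)
      finally have 1: "\<bar>F ?w \<bullet> (H ?w *v n)\<bar> \<le> BF * (KH * norm n)" .
      have "\<bar>(DF ?w *v n) \<bullet> gradient \<rho> ?w\<bar> \<le> norm (DF ?w *v n) * norm (gradient \<rho> ?w)" by (rule Cauchy_Schwarz_ineq2)
      also have "\<dots> \<le> (L' * norm n) * G"
      proof (rule mult_mono)
        show "norm (DF ?w *v n) \<le> L' * norm n"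
          using DFbound[OF w(3), of n] mult_right_mono[of L L' "norm n"] by (simp add: L'_def)
      qed (use G(2)[OF w(1)] in \<open>auto simp: L'_def\<close>)
      finally show ?thesis using 1 by (simp add: f'_def)
    qed
    have "F y \<bullet> gradient \<rho> y = - (s1 * f' s)" using s(3) tz by (simp add: f_def z_def)
    then have "\<bar>F y \<bullet> gradient \<rho> y\<bar> = s1 * \<bar>f' s\<bar>" using s1pos by (simp add: abs_mult)
    also have "\<dots> \<le> sm * (BF * (KH * norm n) + L' * norm n * G)" using f's s1 sm by (intro mult_mono) auto
    also have "\<dots> = C * (- \<rho> y)" by (simp add: C_def sm_def)
    finally show ?thesis .
  qed
  have "ball x0 r \<subseteq> U" using rR R(3) by blast
  moreover have "\<forall>y\<in>ball x0 r. norm (gradient \<rho> y) \<le> G" using G(2) rR by blast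
  ultimately show ?thesis using r(1) C0 est by (intro exI[of _ r] conjI exI[of _ C] exI[of _ G]) auto
qed

text \<open>
  Functions \<open>\<eta> m\<close> on \<open>\<Omega>\<close> that vanish near the part \<open>W\<close> of the boundary and tend to \<open>1\<close>. Their gradients \<open>\<eta>' m\<close> must
  blow up with \<open>m\<close>; the decisive requirement is that the derivatives along \<open>F\<close> stay bounded uniformly in \<open>m\<close> and
  tend to \<open>0\<close>.
\<close>

definition cutoffs :: "(real^'n) set \<Rightarrow> (nat \<Rightarrow> real^'n \<Rightarrow> real) \<Rightarrow> (nat \<Rightarrow> real^'n \<Rightarrow> real^'n) \<Rightarrow> bool" where
  "cutoffs W \<eta> \<eta>' \<longleftrightarrow>
     (\<forall>m. \<forall>x\<in>\<Omega>. (\<eta> m has_derivative (\<lambda>h. \<eta>' m x \<bullet> h)) (at x)) \<and>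
     (\<forall>m. continuous_on \<Omega> (\<eta>' m)) \<and>
     (\<forall>m. \<exists>B. \<forall>x\<in>\<Omega>. norm (\<eta>' m x) \<le> B) \<and>
     (\<forall>m. \<forall>x\<in>\<Omega>. 0 \<le> \<eta> m x \<and> \<eta> m x \<le> 1) \<and>
     (\<forall>x\<in>\<Omega>. (\<lambda>m. \<eta> m x) \<longlonglongrightarrow> 1) \<and>
     (\<exists>C. \<forall>m. \<forall>x\<in>\<Omega>. \<bar>F x \<bullet> \<eta>' m x\<bar> \<le> C) \<and>
     (\<forall>x\<in>\<Omega>. (\<lambda>m. F x \<bullet> \<eta>' m x) \<longlonglongrightarrow> 0) \<and>
     (\<forall>m. \<forall>z\<in>W. \<exists>V. open V \<and> z \<in> V \<and> (\<forall>x\<in>V \<inter> \<Omega>. \<eta> m x = 0))"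

lemma cutoffsD:
  assumes "cutoffs W \<eta> \<eta>'"
  shows "x \<in> \<Omega> \<Longrightarrow> (\<eta> m has_derivative (\<lambda>h. \<eta>' m x \<bullet> h)) (at x)"
    and "continuous_on \<Omega> (\<eta>' m)"
    and "\<exists>B. \<forall>x\<in>\<Omega>. norm (\<eta>' m x) \<le> B"
    and "x \<in> \<Omega> \<Longrightarrow> 0 \<le> \<eta> m x" and "x \<in> \<Omega> \<Longrightarrow> \<eta> m x \<le> 1"
    and "x \<in> \<Omega> \<Longrightarrow> (\<lambda>m. \<eta> m x) \<longlonglongrightarrow> 1"
    and "\<exists>C. \<forall>m. \<forall>x\<in>\<Omega>. \<bar>F x \<bullet> \<eta>' m x\<bar> \<le> C"
    and "x \<in> \<Omega> \<Longrightarrow> (\<lambda>m. F x \<bullet> \<eta>' m x) \<longlonglongrightarrow> 0"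
    and "z \<in> W \<Longrightarrow> \<exists>V. open V \<and> z \<in> V \<and> (\<forall>x\<in>V \<inter> \<Omega>. \<eta> m x = 0)"
  using assms by (simp_all add: cutoffs_def)

lemma cutoffs_empty: "cutoffs {} (\<lambda>m x. 1) (\<lambda>m x. 0)"
  by (auto simp: cutoffs_def)

lemma cutoffs_Un:
  assumes 1: "cutoffs W1 \<eta>1 d1" and 2: "cutoffs W2 \<eta>2 d2"
  shows "cutoffs (W1 \<union> W2) (\<lambda>m x. \<eta>1 m x * \<eta>2 m x) (\<lambda>m x. \<eta>1 m x *\<^sub>R d2 m x + \<eta>2 m x *\<^sub>R d1 m x)"
proof -
  have d: "(\<eta>1 m has_derivative (\<lambda>h. d1 m x \<bullet> h)) (at x)" "(\<eta>2 m has_derivative (\<lambda>h. d2 m x \<bullet> h)) (at x)"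
    if "x \<in> \<Omega>" for m x using cutoffsD(1)[OF 1 that] cutoffsD(1)[OF 2 that] by simp_all
  have b: "0 \<le> \<eta>1 m x" "\<eta>1 m x \<le> 1" "0 \<le> \<eta>2 m x" "\<eta>2 m x \<le> 1" if "x \<in> \<Omega>" for m x using cutoffsD(4,5)[OF 1 that] cutoffsD(4,5)[OF 2 that] by simp_all
  have cont: "continuous_on \<Omega> (\<eta>1 m)" "continuous_on \<Omega> (\<eta>2 m)" for m
    using has_derivative_continuous[OF d(1)] has_derivative_continuous[OF d(2)]
    by (auto intro!: continuous_at_imp_continuous_on)
  obtain C1 C2 where "\<forall>m. \<forall>x\<in>\<Omega>. \<bar>F x \<bullet> d1 m x\<bar> \<le> C1" "\<forall>m. \<forall>x\<in>\<Omega>. \<bar>F x \<bullet> d2 m x\<bar> \<le> C2"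
    using cutoffsD(7)[OF 1] cutoffsD(7)[OF 2] by blast
  then have C: "\<And>m x. x \<in> \<Omega> \<Longrightarrow> \<bar>F x \<bullet> d1 m x\<bar> \<le> C1" "\<And>m x. x \<in> \<Omega> \<Longrightarrow> \<bar>F x \<bullet> d2 m x\<bar> \<le> C2" by simp_all
  show ?thesis unfolding cutoffs_def
  proof (intro conjI allI ballI)
    fix m x assume x: "x \<in> \<Omega>"
    show "((\<lambda>x. \<eta>1 m x * \<eta>2 m x) has_derivative (\<lambda>h. (\<eta>1 m x *\<^sub>R d2 m x + \<eta>2 m x *\<^sub>R d1 m x) \<bullet> h)) (at x)"
      using has_derivative_mult[OF d[OF x]] by (simp add: inner_add_left algebra_simps)
    show "0 \<le> \<eta>1 m x * \<eta>2 m x" "\<eta>1 m x * \<eta>2 m x \<le> 1" using b[OF x, of m] by (auto intro: mult_le_one)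
  next
    fix m
    have "continuous_on \<Omega> (d1 m)" "continuous_on \<Omega> (d2 m)" using cutoffsD(2)[OF 1] cutoffsD(2)[OF 2] by simp_all
    then show "continuous_on \<Omega> (\<lambda>x. \<eta>1 m x *\<^sub>R d2 m x + \<eta>2 m x *\<^sub>R d1 m x)" using cont by (intro continuous_intros)
    obtain B1 B2 where "\<forall>x\<in>\<Omega>. norm (d1 m x) \<le> B1" "\<forall>x\<in>\<Omega>. norm (d2 m x) \<le> B2"
      using cutoffsD(3)[OF 1] cutoffsD(3)[OF 2] by blast
    then have B: "\<And>x. x \<in> \<Omega> \<Longrightarrow> norm (d1 m x) \<le> B1" "\<And>x. x \<in> \<Omega> \<Longrightarrow> norm (d2 m x) \<le> B2" by simp_all
    have "norm (\<eta>1 m x *\<^sub>R d2 m x + \<eta>2 m x *\<^sub>R d1 m x) \<le> B2 + B1" if x: "x \<in> \<Omega>" for x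
    proof (rule norm_triangle_le, rule add_mono)
      show "norm (\<eta>1 m x *\<^sub>R d2 m x) \<le> B2" "norm (\<eta>2 m x *\<^sub>R d1 m x) \<le> B1"
        using b[OF x, of m] B(1)[OF x] B(2)[OF x] mult_mono[of "\<eta>1 m x" 1 "norm (d2 m x)" B2] mult_mono[of "\<eta>2 m x" 1 "norm (d1 m x)" B1] by auto
    qed
    then show "\<exists>B. \<forall>x\<in>\<Omega>. norm (\<eta>1 m x *\<^sub>R d2 m x + \<eta>2 m x *\<^sub>R d1 m x) \<le> B" by blast
  next
    fix x assume x: "x \<in> \<Omega>"
    have l: "(\<lambda>m. \<eta>1 m x) \<longlonglongrightarrow> 1" "(\<lambda>m. \<eta>2 m x) \<longlonglongrightarrow> 1" "(\<lambda>m. F x \<bullet> d1 m x) \<longlonglongrightarrow> 0" "(\<lambda>m. F x \<bullet> d2 m x) \<longlonglongrightarrow> 0"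
      using cutoffsD(6,8)[OF 1 x] cutoffsD(6,8)[OF 2 x] by simp_all
    show "(\<lambda>m. \<eta>1 m x * \<eta>2 m x) \<longlonglongrightarrow> 1" using tendsto_mult[OF l(1,2)] by simp
    show "(\<lambda>m. F x \<bullet> (\<eta>1 m x *\<^sub>R d2 m x + \<eta>2 m x *\<^sub>R d1 m x)) \<longlonglongrightarrow> 0"
      using tendsto_add[OF tendsto_mult[OF l(1,4)] tendsto_mult[OF l(2,3)]] by (simp add: inner_add_right)
  next
    have "\<bar>F x \<bullet> (\<eta>1 m x *\<^sub>R d2 m x + \<eta>2 m x *\<^sub>R d1 m x)\<bar> \<le> C2 + C1" if x: "x \<in> \<Omega>" for m x
    proof -
      have "\<bar>\<eta>1 m x * (F x \<bullet> d2 m x)\<bar> \<le> C2" "\<bar>\<eta>2 m x * (F x \<bullet> d1 m x)\<bar> \<le> C1"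
        using b[OF x, of m] C(1)[OF x, of m] C(2)[OF x, of m] mult_mono[of "\<eta>1 m x" 1 "\<bar>F x \<bullet> d2 m x\<bar>" C2] mult_mono[of "\<eta>2 m x" 1 "\<bar>F x \<bullet> d1 m x\<bar>" C1]
        by (auto simp: abs_mult)
      then show ?thesis by (simp add: inner_add_right)
    qed
    then show "\<exists>C. \<forall>m. \<forall>x\<in>\<Omega>. \<bar>F x \<bullet> (\<eta>1 m x *\<^sub>R d2 m x + \<eta>2 m x *\<^sub>R d1 m x)\<bar> \<le> C" by blast
  next
    fix m z assume "z \<in> W1 \<union> W2"
    then show "\<exists>V. open V \<and> z \<in> V \<and> (\<forall>x\<in>V \<inter> \<Omega>. \<eta>1 m x * \<eta>2 m x = 0)"
    proof
      assume "z \<in> W1"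
      from cutoffsD(9)[OF 1 this] obtain V where "open V" "z \<in> V" "\<forall>x\<in>V \<inter> \<Omega>. \<eta>1 m x = 0" by blast
      then show ?thesis by (intro exI[of _ V]) simp
    next
      assume "z \<in> W2"
      from cutoffsD(9)[OF 2 this] obtain V where "open V" "z \<in> V" "\<forall>x\<in>V \<inter> \<Omega>. \<eta>2 m x = 0" by blast
      then show ?thesis by (intro exI[of _ V]) simp
    qed
  qed
qed

text \<open>
  Near \<open>x0\<close> the cutoff is \<open>step (- m * \<rho> - 1)\<close>. Apart from a bounded term due to \<open>\<beta>\<close>, its derivative along \<open>F\<close> is \<open>m\<close> times a bounded multiple of the
  product of \<open>F\<close> and \<open>\<nabla>\<rho>\<close>, which is at most \<open>C * - \<rho>\<close>, and it vanishes unless \<open>- \<rho> \<le> 2 / m\<close>. The function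
  \<open>\<beta>\<close> localises the construction: away from \<open>x0\<close> all cutoffs are \<open>1\<close>.
\<close>

lemma local_cutoffs:
  assumes x0: "x0 \<in> frontier \<Omega>"
  shows "\<exists>r>0. \<exists>\<eta> \<eta>'. cutoffs (frontier \<Omega> \<inter> ball x0 r) \<eta> \<eta>'"
proof -
  obtain U \<rho> where U: "x0 \<in> U" and df: "defining_function \<Omega> U \<rho>" using sb x0 unfolding smooth_boundary_def by blast
  have oU: "open U" and sm: "smooth_on U \<rho>" and inner: "\<Omega> \<inter> U = {y \<in> U. \<rho> y < 0}"
    and front: "frontier \<Omega> \<inter> U = {y \<in> U. \<rho> y = 0}"
    using df by (auto simp: defining_function_def)
  obtain R C G where R: "R > 0" and C: "C \<ge> 0" and RU: "ball x0 R \<subseteq> U"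
    and G: "\<And>y. y \<in> ball x0 R \<Longrightarrow> norm (gradient \<rho> y) \<le> G"
    and est: "\<And>y. y \<in> \<Omega> \<Longrightarrow> y \<in> ball x0 R \<Longrightarrow> \<bar>F y \<bullet> gradient \<rho> y\<bar> \<le> C * (- \<rho> y)"
    using boundary_estimate[OF df x0 U] by blast
  define r where "r = R / 2"
  have r: "r > 0" using R by (simp add: r_def)
  (* beta is 1 in the ball of radius r and 0 outside the one of radius sqrt 2 * r < R. *)
  define q where "q x = 2 - (x - x0) \<bullet> (x - x0) / r\<^sup>2" for x
  define \<beta> where "\<beta> x = step (q x)" for x
  define \<beta>' where "\<beta>' x = (step' (q x) * (- 2 / r\<^sup>2)) *\<^sub>R (x - x0)" for x
  define K where "K = {x. (x - x0) \<bullet> (x - x0) \<le> 2 * r\<^sup>2}"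
  have Kcl: "closed K" unfolding K_def by (intro closed_Collect_le continuous_intros)
  have KR: "K \<subseteq> ball x0 R"
  proof
    fix x assume "x \<in> K"
    then have "(norm (x - x0))\<^sup>2 \<le> 2 * r\<^sup>2" by (simp add: K_def power2_norm_eq_inner)
    also have "\<dots> < R\<^sup>2" using R by (simp add: r_def power2_eq_square)
    finally have "norm (x - x0) < R" using R by (simp add: power2_less_imp_less)
    then show "x \<in> ball x0 R" by (simp add: dist_norm norm_minus_commute)
  qed
  have out: "\<beta> x = 0" "\<beta>' x = 0" if "x \<notin> K" for x
  proof -
    have "q x \<le> 0" using that r by (simp add: K_def q_def field_simps)
    then show "\<beta> x = 0" "\<beta>' x = 0" by (simp_all add: \<beta>_def \<beta>'_def step_0)
  qed
  have q_der: "(q has_derivative (\<lambda>h. (- 2 / r\<^sup>2) * ((x - x0) \<bullet> h))) (at x)" for x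
    unfolding q_def[abs_def] using r by (auto intro!: derivative_eq_intros simp: inner_commute field_simps)
  have \<beta>_der: "(\<beta> has_derivative (\<lambda>h. \<beta>' x \<bullet> h)) (at x)" for x
    using diff_chain_at[OF q_der step_DERIV[unfolded has_field_derivative_def]]
    by (simp add: o_def \<beta>_def[abs_def] \<beta>'_def mult.assoc)
  have \<beta>01: "0 \<le> \<beta> x" "\<beta> x \<le> 1" for x by (simp_all add: \<beta>_def step_bounds)
  have q_cont: "continuous_on S q" for S unfolding q_def[abs_def] using r by (intro continuous_intros) simp
  have \<beta>_cont: "continuous_on S \<beta>" for S
    using has_derivative_continuous[OF \<beta>_der] by (auto intro: continuous_at_imp_continuous_on)
  have \<beta>'_cont: "continuous_on S \<beta>'" for S
    unfolding \<beta>'_def[abs_def]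
    by (intro continuous_intros continuous_on_compose2[OF step'_continuous[of UNIV] q_cont]) auto
  define B\<beta> where "B\<beta> = 4 / r\<^sup>2 * R"
  have \<beta>'_b: "norm (\<beta>' x) \<le> B\<beta>" for x
  proof (cases "x \<in> K")
    case True
    then have "norm (x - x0) \<le> R" using KR by (force simp: dist_norm norm_minus_commute)
    then have "\<bar>step' (q x)\<bar> * (2 / r\<^sup>2) * norm (x - x0) \<le> 2 * (2 / r\<^sup>2) * R"
      using step'_bounds[of "q x"] by (intro mult_mono) auto
    then show ?thesis by (simp add: \<beta>'_def B\<beta>_def abs_mult)
  next
    case False
    then show ?thesis using out R by (simp add: B\<beta>_def)
  qed
  (* step (s m x) is 0 where - rho <= 1 / m and 1 where - rho >= 2 / m. *)
  define s where "s m x = - real m * \<rho> x - 1" for m x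
  define \<eta> where "\<eta> m x = (if x \<in> K then 1 - \<beta> x * (1 - step (s m x)) else 1)" for m x
  define \<eta>' where "\<eta>' m x = (if x \<in> K then - (1 - step (s m x)) *\<^sub>R \<beta>' x - (\<beta> x * step' (s m x) * real m) *\<^sub>R gradient \<rho> x else 0)" for m x
  have \<eta>U: "\<eta> m x = 1 - \<beta> x * (1 - step (s m x))" for m x by (simp add: \<eta>_def out)
  have \<eta>'U: "\<eta>' m x = - (1 - step (s m x)) *\<^sub>R \<beta>' x - (\<beta> x * step' (s m x) * real m) *\<^sub>R gradient \<rho> x" for m x
    by (simp add: \<eta>'_def out)
  have \<rho>_der: "(\<rho> has_derivative (\<lambda>h. gradient \<rho> x \<bullet> h)) (at x)" if "x \<in> U" for x
    using gradient_has_derivative[OF smooth_on_differentiable_at[OF sm oU that]] .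
  have s_der: "((\<lambda>x. step (s m x)) has_derivative (\<lambda>h. step' (s m x) * (- real m * (gradient \<rho> x \<bullet> h)))) (at x)" if "x \<in> U" for m x
  proof -
    have "(s m has_derivative (\<lambda>h. - real m * (gradient \<rho> x \<bullet> h))) (at x)"
      unfolding s_def[abs_def] using \<rho>_der[OF that] by (auto intro!: derivative_eq_intros)
    from diff_chain_at[OF this step_DERIV[unfolded has_field_derivative_def]] show ?thesis by (simp add: o_def)
  qed
  have derU: "(\<eta> m has_derivative (\<lambda>h. \<eta>' m x \<bullet> h)) (at x)" if x: "x \<in> U" for m x
  proof -
    have "((\<lambda>x. 1 - \<beta> x * (1 - step (s m x))) has_derivative
       (\<lambda>h. 0 - (\<beta> x * (0 - step' (s m x) * (- real m * (gradient \<rho> x \<bullet> h))) + (\<beta>' x \<bullet> h) * (1 - step (s m x))))) (at x)"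
      by (intro has_derivative_diff has_derivative_mult has_derivative_const \<beta>_der s_der[OF x])
    moreover have "(\<lambda>h. 0 - (\<beta> x * (0 - step' (s m x) * (- real m * (gradient \<rho> x \<bullet> h))) + (\<beta>' x \<bullet> h) * (1 - step (s m x)))) = (\<lambda>h. \<eta>' m x \<bullet> h)"
      unfolding \<eta>'U by (auto simp: inner_diff_left algebra_simps)
    moreover have "\<eta> m = (\<lambda>x. 1 - \<beta> x * (1 - step (s m x)))" using \<eta>U by auto
    ultimately show ?thesis by simp
  qed
  have \<eta>'K: "\<eta>' m x = 0" if "x \<notin> K" for m x using that by (simp add: \<eta>'_def)
  have der: "(\<eta> m has_derivative (\<lambda>h. \<eta>' m x \<bullet> h)) (at x)" for m x
  proof (cases "x \<in> U")
    case False
    then have xK: "x \<notin> K" using KR RU by blast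
    have "(\<eta> m has_derivative (\<lambda>h. 0)) (at x)"
      by (rule has_derivative_transform_within_open[OF has_derivative_const, of "- K" _ 1])
        (use Kcl xK in \<open>auto simp: \<eta>_def\<close>)
    then show ?thesis using \<eta>'K[OF xK] by simp
  qed (rule derU)
  have s_cont: "continuous_on U (s m)" for m
    unfolding s_def[abs_def] by (intro continuous_intros smooth_on_continuous[OF sm])
  have cont': "continuous_on (\<Omega> \<inter> U \<union> \<Omega> \<inter> - K) (\<eta>' m)" for m
  proof (rule continuous_on_open_Un)
    show "open (\<Omega> \<inter> U)" "open (\<Omega> \<inter> - K)" using op oU Kcl by auto
    have "continuous_on U (\<eta>' m)"
      unfolding \<eta>'U[abs_def]
      by (intro continuous_intros \<beta>'_cont \<beta>_cont smooth_on_gradient_continuous[OF sm]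
         continuous_on_compose2[OF step_continuous[of UNIV] s_cont] continuous_on_compose2[OF step'_continuous[of UNIV] s_cont]) auto
    then show "continuous_on (\<Omega> \<inter> U) (\<eta>' m)" by (rule continuous_on_subset) auto
    show "continuous_on (\<Omega> \<inter> - K) (\<eta>' m)"
      by (rule continuous_on_eq[OF continuous_on_const[of _ 0]]) (use \<eta>'K in auto)
  qed
  have un: "\<Omega> \<inter> U \<union> \<Omega> \<inter> - K = \<Omega>" using KR RU by blast
  obtain BF where BF: "BF > 0" "\<And>x. x \<in> closure \<Omega> \<Longrightarrow> norm (F x) \<le> BF" by (rule F_bounded) blast
  have ev1: "\<forall>\<^sub>F m in sequentially. s m x \<ge> 1" if x: "x \<in> \<Omega>" "x \<in> U" for x
  proof -
    have n: "\<rho> x < 0" using inner x by auto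
    obtain N :: nat where N: "real N > 2 / - \<rho> x" using reals_Archimedean2 by blast
    have "s m x \<ge> 1" if "m \<ge> N" for m
    proof -
      have "real m > 2 / - \<rho> x" using N that by simp
      then have "real m * - \<rho> x > 2" using n by (subst (asm) pos_divide_less_eq) auto
      then show ?thesis by (simp add: s_def)
    qed
    then show ?thesis by (auto simp: eventually_sequentially)
  qed
  have ev: "\<forall>\<^sub>F m in sequentially. \<eta> m x = 1 \<and> \<eta>' m x = 0" if x: "x \<in> \<Omega>" for x
  proof (cases "x \<in> K")
    case True
    then have "x \<in> U" using KR RU by blast
    from ev1[OF x this] show ?thesis by eventually_elim (simp add: \<eta>U \<eta>'U step_1)
  next
    case False then show ?thesis using \<eta>'K by (simp add: \<eta>_def)
  qed
  have "cutoffs (frontier \<Omega> \<inter> ball x0 r) \<eta> \<eta>'"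
    unfolding cutoffs_def
  proof (intro conjI allI ballI)
    show "(\<eta> m has_derivative (\<lambda>h. \<eta>' m x \<bullet> h)) (at x)" for m x by (rule der)
    show "continuous_on \<Omega> (\<eta>' m)" for m using cont' un by simp
    show "0 \<le> \<eta> m x" "\<eta> m x \<le> 1" for m x
      using \<beta>01[of x] step_bounds[of "s m x"] mult_le_one[of "\<beta> x" "1 - step (s m x)"] by (auto simp: \<eta>U)
    show "(\<lambda>m. \<eta> m x) \<longlonglongrightarrow> 1" if "x \<in> \<Omega>" for x
      by (rule tendsto_eventually) (use ev[OF that] in \<open>auto elim: eventually_mono\<close>)
    show "(\<lambda>m. F x \<bullet> \<eta>' m x) \<longlonglongrightarrow> 0" if "x \<in> \<Omega>" for x
      by (rule tendsto_eventually) (use ev[OF that] in \<open>auto elim: eventually_mono\<close>)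
    have nb: "norm (\<eta>' m x) \<le> B\<beta> + 2 * real m * \<bar>G\<bar>" for m x
    proof (cases "x \<in> K")
      case True
      have "norm (\<eta>' m x) \<le> norm ((1 - step (s m x)) *\<^sub>R \<beta>' x) + norm ((\<beta> x * step' (s m x) * real m) *\<^sub>R gradient \<rho> x)"
        unfolding \<eta>'U
        using norm_triangle_ineq4[of "- (1 - step (s m x)) *\<^sub>R \<beta>' x" "(\<beta> x * step' (s m x) * real m) *\<^sub>R gradient \<rho> x"]
        by (simp only: scaleR_minus_left norm_minus_cancel)
      also have "norm ((1 - step (s m x)) *\<^sub>R \<beta>' x) \<le> 1 * B\<beta>"
        unfolding norm_scaleR using step_bounds[of "s m x"] \<beta>'_b[of x] by (intro mult_mono) auto
      also have "norm ((\<beta> x * step' (s m x) * real m) *\<^sub>R gradient \<rho> x) \<le> (1 * 2 * real m) * \<bar>G\<bar>"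
        unfolding norm_scaleR
      proof (rule mult_mono)
        show "\<bar>\<beta> x * step' (s m x) * real m\<bar> \<le> 1 * 2 * real m"
          unfolding abs_mult using \<beta>01[of x] step'_bounds[of "s m x"] by (intro mult_mono) auto
        show "norm (gradient \<rho> x) \<le> \<bar>G\<bar>" using G[of x] KR True by (meson abs_ge_self order_trans subsetD)
      qed auto
      finally show ?thesis by simp
    next
      case False then show ?thesis using \<eta>'K[OF False] R by (simp add: B\<beta>_def)
    qed
    show "\<exists>B. \<forall>x\<in>\<Omega>. norm (\<eta>' m x) \<le> B" for m using nb by blast
    have "\<bar>F x \<bullet> \<eta>' m x\<bar> \<le> BF * B\<beta> + 4 * C" if x: "x \<in> \<Omega>" for m x
    proof (cases "x \<in> K")
      case True
      then have xR: "x \<in> ball x0 R" and xU: "x \<in> U" using KR RU by auto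
      have neg: "\<rho> x < 0" using inner x xU by auto
      have "F x \<bullet> \<eta>' m x = - ((1 - step (s m x)) * (F x \<bullet> \<beta>' x)) - \<beta> x * (step' (s m x) * real m * (F x \<bullet> gradient \<rho> x))"
        unfolding \<eta>'U by (simp add: inner_diff_right algebra_simps)
      then have "\<bar>F x \<bullet> \<eta>' m x\<bar> \<le> \<bar>(1 - step (s m x)) * (F x \<bullet> \<beta>' x)\<bar> + \<bar>\<beta> x * (step' (s m x) * real m * (F x \<bullet> gradient \<rho> x))\<bar>" by linarith
      also have "\<bar>(1 - step (s m x)) * (F x \<bullet> \<beta>' x)\<bar> \<le> 1 * (BF * B\<beta>)"
        unfolding abs_mult
      proof (rule mult_mono)
        have "\<bar>F x \<bullet> \<beta>' x\<bar> \<le> norm (F x) * norm (\<beta>' x)" by (rule Cauchy_Schwarz_ineq2)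
        also have "\<dots> \<le> BF * B\<beta>" using BF(2)[of x] BF(1) x closure_subset[of \<Omega>] \<beta>'_b[of x] by (intro mult_mono) auto
        finally show "\<bar>F x \<bullet> \<beta>' x\<bar> \<le> BF * B\<beta>" .
      qed (use step_bounds[of "s m x"] in auto)
      also have "\<bar>\<beta> x * (step' (s m x) * real m * (F x \<bullet> gradient \<rho> x))\<bar> \<le> 1 * (4 * C)"
        unfolding abs_mult[of "\<beta> x"]
      proof (rule mult_mono)
        show "\<bar>step' (s m x) * real m * (F x \<bullet> gradient \<rho> x)\<bar> \<le> 4 * C"
        proof (cases "s m x \<ge> 1")
          case True then show ?thesis using C by (simp add: step_1)
        next
          case False
          then have m2: "real m * - \<rho> x \<le> 2" by (simp add: s_def)
          (* The factor m is absorbed by - rho <= 2 / m. *)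
          have "\<bar>step' (s m x) * real m * (F x \<bullet> gradient \<rho> x)\<bar> = step' (s m x) * (real m * \<bar>F x \<bullet> gradient \<rho> x\<bar>)"
            using step'_bounds[of "s m x"] by (simp add: abs_mult)
          also have "\<dots> \<le> 2 * (real m * (C * - \<rho> x))"
            using step'_bounds[of "s m x"] est[OF x xR] neg C by (intro mult_mono) auto
          also have "\<dots> = 2 * C * (real m * - \<rho> x)" by simp
          also have "\<dots> \<le> 2 * C * 2" using C m2 by (intro mult_left_mono) auto
          finally show ?thesis by simp
        qed
      qed (use \<beta>01[of x] in auto)
      finally show ?thesis by simp
    next
      case False then show ?thesis using \<eta>'K[OF False] BF(1) R C by (simp add: B\<beta>_def)
    qed
    then show "\<exists>C. \<forall>m. \<forall>x\<in>\<Omega>. \<bar>F x \<bullet> \<eta>' m x\<bar> \<le> C" by blast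
    fix m z assume z: "z \<in> frontier \<Omega> \<inter> ball x0 r"
    then have zb: "z \<in> ball x0 R" using r by (auto simp: r_def)
    then have zU: "z \<in> U" using RU by blast
    have \<rho>z: "\<rho> z = 0" using front z zU by blast
    show "\<exists>V. open V \<and> z \<in> V \<and> (\<forall>x\<in>V \<inter> \<Omega>. \<eta> m x = 0)"
    proof (intro exI[of _ "U \<inter> s m -` {..<0} \<inter> ball x0 r"] conjI ballI)
      have "open (U \<inter> s m -` {..<0})" using s_cont[of m] oU by (intro continuous_open_preimage) auto
      then show "open (U \<inter> s m -` {..<0} \<inter> ball x0 r)" by auto
      show "z \<in> U \<inter> s m -` {..<0} \<inter> ball x0 r" using zU z \<rho>z by (simp add: s_def)
      fix x assume x: "x \<in> (U \<inter> s m -` {..<0} \<inter> ball x0 r) \<inter> \<Omega>"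
      then have "norm (x - x0) < r" by (simp add: dist_norm norm_minus_commute)
      then have "(norm (x - x0))\<^sup>2 \<le> r\<^sup>2" using r by (intro power_mono) auto
      then have "q x \<ge> 1" using r by (simp add: q_def power2_norm_eq_inner field_simps)
      then have "\<beta> x = 1" by (simp add: \<beta>_def step_1)
      moreover have "step (s m x) = 0" using x by (intro step_0) auto
      ultimately show "\<eta> m x = 0" by (simp add: \<eta>U)
    qed
  qed
  with r show ?thesis by blast
qed

lemma global_cutoffs: "\<exists>\<eta> \<eta>'. cutoffs (frontier \<Omega>) \<eta> \<eta>'"
proof -
  obtain r where r: "\<And>z. z \<in> frontier \<Omega> \<Longrightarrow> r z > 0" "\<And>z. z \<in> frontier \<Omega> \<Longrightarrow> \<exists>\<eta> \<eta>'. cutoffs (frontier \<Omega> \<inter> ball z (r z)) \<eta> \<eta>'"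
    using local_cutoffs by metis
  have "compact (frontier \<Omega>)" using bd by (rule compact_frontier_bounded)
  moreover have "frontier \<Omega> \<subseteq> (\<Union>z\<in>frontier \<Omega>. ball z (r z))" using r(1) by force
  ultimately obtain I where I: "I \<subseteq> frontier \<Omega>" "finite I" "frontier \<Omega> \<subseteq> (\<Union>z\<in>I. ball z (r z))"
    using compactE_image[of "frontier \<Omega>" "frontier \<Omega>" "\<lambda>z. ball z (r z)"] by (metis open_ball)
  have "\<exists>\<eta> \<eta>'. cutoffs (\<Union>z\<in>J. frontier \<Omega> \<inter> ball z (r z)) \<eta> \<eta>'" if "finite J" "J \<subseteq> frontier \<Omega>" for J
    using that
  proof (induction J)
    case empty
    show ?case using cutoffs_empty by auto
  next
    case (insert z J)
    obtain \<eta>1 d1 where 1: "cutoffs (\<Union>z\<in>J. frontier \<Omega> \<inter> ball z (r z)) \<eta>1 d1" using insert by auto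
    obtain \<eta>2 d2 where 2: "cutoffs (frontier \<Omega> \<inter> ball z (r z)) \<eta>2 d2" using r(2)[of z] insert by auto
    from cutoffs_Un[OF 2 1] show ?case by auto
  qed
  from this[OF I(2,1)] have "\<exists>\<eta> \<eta>'. cutoffs (\<Union>z\<in>I. frontier \<Omega> \<inter> ball z (r z)) \<eta> \<eta>'" .
  moreover have "(\<Union>z\<in>I. frontier \<Omega> \<inter> ball z (r z)) = frontier \<Omega>" using I(3) by blast
  ultimately show ?thesis by simp
qed

text \<open>
  The boundary term of the divergence theorem is absent, so surface measure can be avoided. The
  fields \<open>\<eta> m * F\<close>, extended by \<open>0\<close>, are differentiable in the whole space and have divergence integral \<open>0\<close>; in the limit the
  term with \<open>\<eta>'\<close> disappears by dominated convergence.
\<close>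

theorem divergence_theorem_tangential: "(\<integral>x. (\<Sum>j\<in>UNIV. DF x $ j $ j) \<partial>M) = 0"
proof -
  obtain \<eta> \<eta>' where c: "cutoffs (frontier \<Omega>) \<eta> \<eta>'" using global_cutoffs by blast
  note c' = cutoffsD[OF c]
  have \<eta>d: "(\<eta> m has_derivative (\<lambda>h. \<eta>' m x \<bullet> h)) (at x)" if "x \<in> \<Omega>" for m x using c'(1)[OF that] .
  have \<eta>01: "0 \<le> \<eta> m x" "\<eta> m x \<le> 1" if "x \<in> \<Omega>" for m x using c'(4,5)[OF that] by simp_all
  have \<eta>cont: "continuous_on \<Omega> (\<eta> m)" for m
    using has_derivative_continuous[OF \<eta>d] by (auto intro!: continuous_at_imp_continuous_on)
  have \<eta>'cont: "continuous_on \<Omega> (\<eta>' m)" for m by (rule c'(2))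
  have \<eta>lim: "(\<lambda>m. \<eta> m x) \<longlonglongrightarrow> 1" "(\<lambda>m. F x \<bullet> \<eta>' m x) \<longlonglongrightarrow> 0" if "x \<in> \<Omega>" for x using c'(6,8)[OF that] by simp_all
  obtain C where "\<forall>m. \<forall>x\<in>\<Omega>. \<bar>F x \<bullet> \<eta>' m x\<bar> \<le> C" using c'(7) by blast
  then have C: "\<And>m x. x \<in> \<Omega> \<Longrightarrow> \<bar>F x \<bullet> \<eta>' m x\<bar> \<le> C" by simp
  obtain BF where BF: "BF > 0" "\<And>x. x \<in> closure \<Omega> \<Longrightarrow> norm (F x) \<le> BF" by (rule F_bounded) blast
  have DFj: "\<bar>DF x $ i $ j\<bar> \<le> L" if "x \<in> \<Omega>" for x i j
  proof -
    have "\<bar>(DF x *v axis j 1) $ i\<bar> \<le> norm (DF x *v axis j 1)" by (rule component_le_norm_cart)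
    also have "\<dots> \<le> L" using DFbound[OF that, of "axis j 1"] by simp
    finally show ?thesis by (simp add: matrix_vector_mult_basis column_def)
  qed
  (* The gradient of the i-th component of the field cut off. *)
  define D where "D m i x = (if x \<in> \<Omega> then \<eta> m x *\<^sub>R (DF x $ i) + F x $ i *\<^sub>R \<eta>' m x else 0)" for m i x
  have Db: "\<bar>D m j x $ j\<bar> \<le> \<bar>L\<bar> + BF * \<bar>B\<bar>"
    if B: "\<And>x. x \<in> \<Omega> \<Longrightarrow> norm (\<eta>' m x) \<le> B" and x: "x \<in> \<Omega>" for m B j x
  proof -
    have "\<bar>\<eta> m x * DF x $ j $ j\<bar> \<le> 1 * \<bar>L\<bar>"
      unfolding abs_mult using \<eta>01[OF x, of m] DFj[OF x, of j j] by (intro mult_mono) auto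
    moreover have "\<bar>F x $ j * \<eta>' m x $ j\<bar> \<le> BF * \<bar>B\<bar>"
      unfolding abs_mult
    proof (rule mult_mono)
      show "\<bar>F x $ j\<bar> \<le> BF" using component_le_norm_cart[of "F x" j] BF(2)[of x] x closure_subset[of \<Omega>] by force
      show "\<bar>\<eta>' m x $ j\<bar> \<le> \<bar>B\<bar>" using component_le_norm_cart[of "\<eta>' m x" j] B[OF x] by linarith
    qed (use BF in auto)
    ultimately show ?thesis using x by (simp add: D_def)
  qed
  have key: "(\<integral>x. D m j x $ j \<partial>M) = 0" for m j
  proof -
    define g where "g x = (if x \<in> \<Omega> then \<eta> m x * F x $ j else 0)" for x
    obtain B where B: "\<And>x. x \<in> \<Omega> \<Longrightarrow> norm (\<eta>' m x) \<le> B" using c'(3)[of m] by blast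
    show ?thesis
    proof (rule integral_partial_zero[of g])
      fix x
      show "(g has_derivative (\<lambda>h. D m j x \<bullet> h)) (at x)"
      proof (cases "x \<in> \<Omega>")
        case True
        have "((\<lambda>x. F x $ j) has_derivative (\<lambda>h. (DF x *v h) $ j)) (at x)"
          using has_derivative_compose[OF Fder[OF True] bounded_linear_imp_has_derivative[OF bounded_linear_vec_nth]] .
        from has_derivative_mult[OF \<eta>d[OF True, of m] this]
        have "((\<lambda>x. \<eta> m x * F x $ j) has_derivative (\<lambda>h. D m j x \<bullet> h)) (at x)"
          using True by (simp add: D_def inner_add_left matrix_vector_mult_def inner_vec_def sum_distrib_left sum.distrib distrib_left mult.commute mult.left_commute)
        then show ?thesis
          by (rule has_derivative_transform_within_open[OF _ op True]) (simp add: g_def)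
      next
        case False
        have "\<exists>V. open V \<and> x \<in> V \<and> (\<forall>y\<in>V. g y = 0)"
        proof (cases "x \<in> closure \<Omega>")
          case True
          then have "x \<in> frontier \<Omega>" using False op by (simp add: frontier_def interior_open)
          then obtain V where "open V" "x \<in> V" "\<forall>x\<in>V \<inter> \<Omega>. \<eta> m x = 0" using c'(9) by blast
          then show ?thesis by (intro exI[of _ V]) (auto simp: g_def)
        next
          case False
          then show ?thesis using closure_subset[of \<Omega>] by (intro exI[of _ "- closure \<Omega>"]) (auto simp: g_def)
        qed
        then obtain V where V: "open V" "x \<in> V" "\<And>y. y \<in> V \<Longrightarrow> 0 = g y" by auto
        have "(g has_derivative (\<lambda>h. 0)) (at x)"
          by (rule has_derivative_transform_within_open[OF has_derivative_const V])
        then show ?thesis using False by (simp add: D_def)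
      qed
      show "\<bar>D m j x $ j\<bar> \<le> \<bar>L\<bar> + BF * \<bar>B\<bar>" using Db[OF B] BF by (cases "x \<in> \<Omega>") (simp_all add: D_def)
    qed (auto simp: g_def D_def)
  qed
  have Fm: "continuous_on \<Omega> F" by (rule continuous_on_subset[OF Fcont closure_subset])
  have trc: "continuous_on \<Omega> (\<lambda>x. \<Sum>j\<in>UNIV. DF x $ j $ j)" using DFcont by (intro continuous_intros)
  have trb: "\<bar>\<Sum>j\<in>UNIV. DF x $ j $ j\<bar> \<le> (\<Sum>j\<in>(UNIV::'n set). L)" if "x \<in> \<Omega>" for x
    by (rule order_trans[OF sum_abs sum_mono[OF DFj[OF that]]])
  have int1: "integrable M (\<lambda>x. \<eta> m x * (\<Sum>j\<in>UNIV. DF x $ j $ j))" for m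
  proof (rule integrable_bounded)
    show "(\<lambda>x. \<eta> m x * (\<Sum>j\<in>UNIV. DF x $ j $ j)) \<in> borel_measurable M"
      by (rule measurable_continuous[OF continuous_on_mult[OF \<eta>cont trc]])
    show "\<bar>\<eta> m x * (\<Sum>j\<in>UNIV. DF x $ j $ j)\<bar> \<le> 1 * (\<Sum>j\<in>(UNIV::'n set). L)" if "x \<in> \<Omega>" for x
      unfolding abs_mult using \<eta>01[OF that, of m] trb[OF that] by (intro mult_mono) auto
  qed
  have int2: "integrable M (\<lambda>x. F x \<bullet> \<eta>' m x)" for m
    by (rule integrable_bounded[OF _ C]) (use Fm \<eta>'cont in \<open>auto intro!: measurable_continuous continuous_intros\<close>)
  have ijm: "integrable M (\<lambda>x. D m j x $ j)" for m j
  proof -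
    have "continuous_on \<Omega> (\<lambda>x. \<eta> m x * DF x $ j $ j + F x $ j * \<eta>' m x $ j)"
      using \<eta>cont DFcont Fm \<eta>'cont by (intro continuous_intros)
    then have "continuous_on \<Omega> (\<lambda>x. D m j x $ j)" by (rule continuous_on_eq) (simp add: D_def)
    moreover obtain B where B: "\<And>x. x \<in> \<Omega> \<Longrightarrow> norm (\<eta>' m x) \<le> B" using c'(3)[of m] by blast
    ultimately show ?thesis by (intro integrable_bounded[OF measurable_continuous Db[OF B]])
  qed
  have split: "(\<integral>x. \<eta> m x * (\<Sum>j\<in>UNIV. DF x $ j $ j) \<partial>M) + (\<integral>x. F x \<bullet> \<eta>' m x \<partial>M) = 0" for m
  proof -
    have "(\<integral>x. \<eta> m x * (\<Sum>j\<in>UNIV. DF x $ j $ j) \<partial>M) + (\<integral>x. F x \<bullet> \<eta>' m x \<partial>M)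
       = (\<integral>x. \<eta> m x * (\<Sum>j\<in>UNIV. DF x $ j $ j) + F x \<bullet> \<eta>' m x \<partial>M)"
      using int1 int2 by simp
    also have "\<dots> = (\<integral>x. (\<Sum>j\<in>UNIV. D m j x $ j) \<partial>M)"
      by (rule Bochner_Integration.integral_cong) (simp_all add: D_def inner_vec_def sum.distrib sum_distrib_left)
    also have "\<dots> = (\<Sum>j\<in>UNIV. \<integral>x. D m j x $ j \<partial>M)" using ijm by (intro Bochner_Integration.integral_sum)
    finally show ?thesis by (simp add: key)
  qed
  have l1: "(\<lambda>m. \<integral>x. \<eta> m x * (\<Sum>j\<in>UNIV. DF x $ j $ j) \<partial>M) \<longlonglongrightarrow> (\<integral>x. (\<Sum>j\<in>UNIV. DF x $ j $ j) \<partial>M)"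
  proof (rule integral_dominated_convergence[where w="\<lambda>_. \<Sum>j\<in>(UNIV::'n set). L"])
    show "(\<lambda>x. \<Sum>j\<in>UNIV. DF x $ j $ j) \<in> borel_measurable M" using trc by (rule measurable_continuous)
    show "(\<lambda>x. \<eta> m x * (\<Sum>j\<in>UNIV. DF x $ j $ j)) \<in> borel_measurable M" for m using int1 by (rule borel_measurable_integrable)
    show "integrable M (\<lambda>_. \<Sum>j\<in>(UNIV::'n set). L)" by (rule finite_measure.integrable_const[OF finite_M])
    show "AE x in M. (\<lambda>m. \<eta> m x * (\<Sum>j\<in>UNIV. DF x $ j $ j)) \<longlonglongrightarrow> (\<Sum>j\<in>UNIV. DF x $ j $ j)"
    proof (rule AE_I2)
      fix x assume "x \<in> space M"
      then have "(\<lambda>m. \<eta> m x) \<longlonglongrightarrow> 1" using \<eta>lim(1)[of x] by simp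
      from tendsto_mult_right[OF this, of "\<Sum>j\<in>UNIV. DF x $ j $ j"]
      show "(\<lambda>m. \<eta> m x * (\<Sum>j\<in>UNIV. DF x $ j $ j)) \<longlonglongrightarrow> (\<Sum>j\<in>UNIV. DF x $ j $ j)" by simp
    qed
    show "AE x in M. norm (\<eta> m x * (\<Sum>j\<in>UNIV. DF x $ j $ j)) \<le> (\<Sum>j\<in>(UNIV::'n set). L)" for m
    proof (rule AE_I2)
      fix x assume "x \<in> space M"
      then have x: "x \<in> \<Omega>" by simp
      have "\<bar>\<eta> m x * (\<Sum>j\<in>UNIV. DF x $ j $ j)\<bar> \<le> 1 * (\<Sum>j\<in>(UNIV::'n set). L)"
        unfolding abs_mult using \<eta>01[OF x, of m] trb[OF x] by (intro mult_mono) auto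
      then show "norm (\<eta> m x * (\<Sum>j\<in>UNIV. DF x $ j $ j)) \<le> (\<Sum>j\<in>(UNIV::'n set). L)" by simp
    qed
  qed
  have l2: "(\<lambda>m. \<integral>x. F x \<bullet> \<eta>' m x \<partial>M) \<longlonglongrightarrow> (\<integral>x. 0 \<partial>M)"
  proof (rule integral_dominated_convergence[where w="\<lambda>_. C"])
    show "(\<lambda>x. F x \<bullet> \<eta>' m x) \<in> borel_measurable M" for m using int2 by (rule borel_measurable_integrable)
    show "integrable M (\<lambda>_. C)" by (rule finite_measure.integrable_const[OF finite_M])
    show "AE x in M. (\<lambda>m. F x \<bullet> \<eta>' m x) \<longlonglongrightarrow> 0" using \<eta>lim(2) by (intro AE_I2) simp
    show "AE x in M. norm (F x \<bullet> \<eta>' m x) \<le> C" for m using C by (intro AE_I2) simp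
  qed simp
  from tendsto_add[OF l1 l2] show ?thesis by (simp add: split LIMSEQ_const_iff)
qed

end

section \<open>Symmetry of the second derivatives\<close>

text \<open>
  The second difference is symmetric in \<open>i\<close> and \<open>j\<close>, so exchanging them compares the two mixed derivatives at
  nearby points.
\<close>

lemma second_difference_mean_value:
  fixes f :: "real^'n::finite \<Rightarrow> real"
  assumes d: "\<And>y. dist y x < r \<Longrightarrow> f differentiable (at y)"
    and d2: "\<And>y. dist y x < r \<Longrightarrow> partial_deriv i f differentiable (at y)"
    and h: "0 < h" "2 * h < r"
  shows "\<exists>p. dist p x \<le> 2 * h \<and>
    f (x + h *\<^sub>R axis i 1 + h *\<^sub>R axis j 1) - f (x + h *\<^sub>R axis i 1) - f (x + h *\<^sub>R axis j 1) + f x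
      = h\<^sup>2 * partial_deriv j (partial_deriv i f) p"
proof -
  let ?e = "axis i 1 :: real^'n" and ?e' = "axis j 1 :: real^'n"
  have near: "dist (x + s *\<^sub>R ?e + t *\<^sub>R ?e') x \<le> 2 * h" if "0 \<le> s" "s \<le> h" "0 \<le> t" "t \<le> h" for s t
    using that norm_triangle_ineq[of "s *\<^sub>R ?e" "t *\<^sub>R ?e'"] by (simp add: dist_norm add.assoc)
  define g where "g s = f ((x + h *\<^sub>R ?e') + s *\<^sub>R ?e) - f (x + s *\<^sub>R ?e)" for s
  have "\<exists>z>0. z < h \<and> g h - g 0 = (h - 0) * (partial_deriv i f ((x + h *\<^sub>R ?e') + z *\<^sub>R ?e) - partial_deriv i f (x + z *\<^sub>R ?e))"
  proof (rule MVT2[OF h(1)])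
    fix s assume s: "0 \<le> s" "s \<le> h"
    have "dist ((x + h *\<^sub>R ?e') + s *\<^sub>R ?e) x < r" "dist (x + s *\<^sub>R ?e) x < r"
      using near[OF s, of h] near[OF s, of 0] h by (simp_all add: add_ac)
    then show "(g has_real_derivative partial_deriv i f ((x + h *\<^sub>R ?e') + s *\<^sub>R ?e) - partial_deriv i f (x + s *\<^sub>R ?e)) (at s)"
      unfolding g_def[abs_def] by (intro DERIV_diff partial_line d)
  qed
  then obtain z where z: "0 < z" "z < h"
    "g h - g 0 = h * (partial_deriv i f ((x + z *\<^sub>R ?e) + h *\<^sub>R ?e') - partial_deriv i f ((x + z *\<^sub>R ?e) + 0 *\<^sub>R ?e'))"
    by (auto simp: add_ac)
  have "\<exists>w>0. w < h \<and> partial_deriv i f ((x + z *\<^sub>R ?e) + h *\<^sub>R ?e') - partial_deriv i f ((x + z *\<^sub>R ?e) + 0 *\<^sub>R ?e')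
     = (h - 0) * partial_deriv j (partial_deriv i f) ((x + z *\<^sub>R ?e) + w *\<^sub>R ?e')"
  proof (rule MVT2[OF h(1)])
    fix s assume s: "0 \<le> s" "s \<le> h"
    have "dist ((x + z *\<^sub>R ?e) + s *\<^sub>R ?e') x < r" using near[of z s] s z h by simp
    then show "((\<lambda>s. partial_deriv i f ((x + z *\<^sub>R ?e) + s *\<^sub>R ?e')) has_real_derivative
        partial_deriv j (partial_deriv i f) ((x + z *\<^sub>R ?e) + s *\<^sub>R ?e')) (at s)"
      by (intro partial_line d2)
  qed
  then obtain w where w: "0 < w" "w < h" "partial_deriv i f ((x + z *\<^sub>R ?e) + h *\<^sub>R ?e') - partial_deriv i f ((x + z *\<^sub>R ?e) + 0 *\<^sub>R ?e')
     = h * partial_deriv j (partial_deriv i f) ((x + z *\<^sub>R ?e) + w *\<^sub>R ?e')" by auto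
  have "g h - g 0 = h\<^sup>2 * partial_deriv j (partial_deriv i f) ((x + z *\<^sub>R ?e) + w *\<^sub>R ?e')"
    using z(3) w(3) by (simp add: power2_eq_square)
  moreover have "g h - g 0 = f (x + h *\<^sub>R ?e + h *\<^sub>R ?e') - f (x + h *\<^sub>R ?e) - f (x + h *\<^sub>R ?e') + f x"
    by (simp add: g_def add_ac)
  ultimately show ?thesis using near[of z w] z w by auto
qed

theorem mixed_partials_symmetric:
  fixes f :: "real^'n::finite \<Rightarrow> real"
  assumes U: "open U" "x \<in> U"
    and d: "\<And>y. y \<in> U \<Longrightarrow> f differentiable (at y)"
    and d2: "\<And>y k. y \<in> U \<Longrightarrow> partial_deriv k f differentiable (at y)"
    and c: "\<And>k l. continuous_on U (partial_deriv k (partial_deriv l f))"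
  shows "partial_deriv i (partial_deriv j f) x = partial_deriv j (partial_deriv i f) x"
proof -
  obtain r where r: "r > 0" "\<And>y. dist y x < r \<Longrightarrow> y \<in> U"
    using U by (auto simp: open_dist)
  define h where "h n = r / (real n + 3)" for n :: nat
  have h: "0 < h n" "2 * h n < r" for n using r(1) by (simp_all add: h_def field_simps add_pos_nonneg)
  have h0: "h \<longlonglongrightarrow> 0" unfolding h_def[abs_def] by real_asymp
  have "\<exists>p. dist p x \<le> 2 * h n \<and>
    f (x + h n *\<^sub>R axis k 1 + h n *\<^sub>R axis l 1) - f (x + h n *\<^sub>R axis k 1) - f (x + h n *\<^sub>R axis l 1) + f x
      = (h n)\<^sup>2 * partial_deriv l (partial_deriv k f) p" for n k l
    by (rule second_difference_mean_value[where r=r]) (use d d2 r h in auto)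
  then obtain p where p: "\<And>n k l. dist (p n k l) x \<le> 2 * h n"
    "\<And>n k l. f (x + h n *\<^sub>R axis k 1 + h n *\<^sub>R axis l 1) - f (x + h n *\<^sub>R axis k 1) - f (x + h n *\<^sub>R axis l 1) + f x
      = (h n)\<^sup>2 * partial_deriv l (partial_deriv k f) (p n k l)" by metis
  have eq: "partial_deriv i (partial_deriv j f) (p n j i) = partial_deriv j (partial_deriv i f) (p n i j)" for n
  proof -
    have "(h n)\<^sup>2 * partial_deriv i (partial_deriv j f) (p n j i) = (h n)\<^sup>2 * partial_deriv j (partial_deriv i f) (p n i j)"
      unfolding p(2)[symmetric] by (simp add: add_ac)
    then show ?thesis using h(1)[of n] by simp
  qed
  have lim: "(\<lambda>n. partial_deriv l (partial_deriv k f) (p n k l)) \<longlonglongrightarrow> partial_deriv l (partial_deriv k f) x" for k l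
  proof -
    have "(\<lambda>n. p n k l) \<longlonglongrightarrow> x"
    proof (rule metric_tendsto_imp_tendsto)
      show "(\<lambda>n. 2 * h n) \<longlonglongrightarrow> 0" using tendsto_mult_right_zero[OF h0, of 2] .
      show "\<forall>\<^sub>F n in sequentially. dist (p n k l) x \<le> dist (2 * h n) 0"
        using p(1) h(1) by (auto intro!: always_eventually simp: less_imp_le)
    qed
    moreover have "isCont (partial_deriv l (partial_deriv k f)) x" using c U by (simp add: continuous_on_eq_continuous_at)
    ultimately show ?thesis by (rule isCont_tendsto_compose[rotated])
  qed
  show ?thesis using LIMSEQ_unique[OF lim[of i j]] lim[of j i] by (simp add: eq)
qed

section \<open>Fields with skew Jacobian\<close>

text \<open>
  Put \<open>c v = b (a + v) - b a\<close>. Polarising the hypothesis gives \<open>c v \<bullet> w = - (c w \<bullet> v)\<close>. With \<open>w\<close> running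
  through the multiples \<open>t e\<^sub>j\<close> of the basis vectors, the right-hand side shows that each component of \<open>c\<close> is linear in \<open>v\<close>.
\<close>

lemma killing_imp_affine_local:
  fixes b :: "real^'n::finite \<Rightarrow> real^'n"
  assumes r: "r > 0"
    and b: "\<And>x y. x \<in> ball a r \<Longrightarrow> y \<in> ball a r \<Longrightarrow> (b x - b y) \<bullet> (x - y) = 0"
  shows "\<exists>A::real^'n^'n. (\<forall>v. (A *v v) \<bullet> v = 0) \<and> (\<forall>x\<in>ball a r. b x = b a + A *v (x - a))"
proof -
  define c where "c v = b (a + v) - b a" for v
  have inb: "a + v \<in> ball a r \<longleftrightarrow> norm v < r" for v by (simp add: dist_norm)
  have c1: "c v \<bullet> v = 0" if "norm v < r" for v
    using b[of "a + v" a] that r inb[of v] by (simp add: c_def)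
  have c2: "c v \<bullet> w = - (c w \<bullet> v)" if "norm v < r" "norm w < r" for v w
  proof -
    have "(c v - c w) \<bullet> (v - w) = 0"
      using b[of "a + v" "a + w"] that inb by (simp add: c_def)
    then show ?thesis using c1[OF that(1)] c1[OF that(2)] by (simp add: inner_diff_left inner_diff_right)
  qed
  define t where "t = r / 2"
  have t: "t > 0" "t < r" using r by (simp_all add: t_def)
  (* The points t e_j lie in the ball, which the basis vectors need not. *)
  define A :: "real^'n^'n" where "A = (\<chi> j. (- 1 / t) *\<^sub>R c (t *\<^sub>R axis j 1))"
  have A: "c v = A *v v" if "norm v < r" for v
  proof -
    have "c v $ j = (A *v v) $ j" for j
    proof -
      have "t * c v $ j = c v \<bullet> (t *\<^sub>R axis j 1)" by (simp add: inner_axis)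
      also have "\<dots> = - (c (t *\<^sub>R axis j 1) \<bullet> v)" using that t by (intro c2) simp_all
      finally have "c v $ j = - (c (t *\<^sub>R axis j 1) \<bullet> v) / t" using t by (simp add: field_simps)
      then show ?thesis by (simp add: A_def matrix_vector_mul_component)
    qed
    then show ?thesis by (simp add: vec_eq_iff)
  qed
  have "(A *v v) \<bullet> v = 0" for v
  proof -
    define s where "s = t / (norm v + 1)"
    have s: "s > 0" using t by (simp add: s_def add_nonneg_pos)
    have "s * norm v \<le> s * (norm v + 1)" using s by (intro mult_left_mono) auto
    also have "\<dots> = t"
    proof -
      have "norm v + 1 \<noteq> 0" using norm_ge_zero[of v] by linarith
      then show ?thesis by (simp add: s_def)
    qed
    finally have "norm (s *\<^sub>R v) < r" using s t by simp
    then have "(A *v (s *\<^sub>R v)) \<bullet> (s *\<^sub>R v) = 0" using c1[of "s *\<^sub>R v"] A[of "s *\<^sub>R v"] by simp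
    then show ?thesis using s by (simp add: matrix_vector_mult_scaleR)
  qed
  moreover have "b x = b a + A *v (x - a)" if "x \<in> ball a r" for x
  proof -
    have "b x - b a = A *v (x - a)" using A[of "x - a"] that by (simp add: c_def dist_norm norm_minus_commute)
    then show ?thesis by (metis add.commute diff_add_cancel)
  qed
  ultimately show ?thesis by blast
qed

text \<open>
  Where the Jacobian is skew, \<open>b x - b y\<close> is orthogonal to \<open>x - y\<close> by the mean value theorem on the segment, so \<open>b\<close> is
  affine on every ball. The Jacobian is then locally constant, hence constant.
\<close>

lemma killing_imp_affine:
  fixes b :: "real^'n::finite \<Rightarrow> real^'n"
  assumes \<Omega>: "open \<Omega>" "connected \<Omega>" "\<Omega> \<noteq> {}"
    and der: "\<And>x. x \<in> \<Omega> \<Longrightarrow> (b has_derivative (\<lambda>h. J x *v h)) (at x)"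
    and skew: "\<And>x v. x \<in> \<Omega> \<Longrightarrow> (J x *v v) \<bullet> v = 0"
  shows "\<exists>A c. (\<forall>v. (A *v v) \<bullet> v = 0) \<and> (\<forall>x\<in>\<Omega>. b x = A *v x + c)"
proof -
  have mono: "(b x - b y) \<bullet> (x - y) = 0" if br: "ball a r \<subseteq> \<Omega>" and xy: "x \<in> ball a r" "y \<in> ball a r" for a r x y
  proof -
    have seg: "y + s *\<^sub>R (x - y) \<in> \<Omega>" if "0 \<le> s" "s \<le> 1" for s
    proof -
      have "y + s *\<^sub>R (x - y) = (1 - s) *\<^sub>R y + s *\<^sub>R x" by (simp add: algebra_simps)
      then show ?thesis using convexD[OF convex_ball xy(2,1), of "1 - s" s] that br by auto
    qed
    have "((\<lambda>s. b (y + s *\<^sub>R (x - y)) \<bullet> (x - y)) has_real_derivative 0) (at s)" if "0 \<le> s" "s \<le> 1" for s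
    proof -
      have "((\<lambda>s. y + s *\<^sub>R (x - y)) has_derivative (\<lambda>t. t *\<^sub>R (x - y))) (at s)" by (auto intro!: derivative_eq_intros)
      from diff_chain_at[OF this der[OF seg[OF that]]]
      have "((\<lambda>s. b (y + s *\<^sub>R (x - y))) has_derivative (\<lambda>t. J (y + s *\<^sub>R (x - y)) *v (t *\<^sub>R (x - y)))) (at s)" by (simp add: o_def)
      from has_derivative_inner_left[OF this, of "x - y"] show ?thesis
        using skew[OF seg[OF that], of "x - y"]
        by (simp add: has_field_derivative_def matrix_vector_mult_scaleR lambda_zero)
    qed
    from MVT2[of 0 1 "\<lambda>s. b (y + s *\<^sub>R (x - y)) \<bullet> (x - y)" "\<lambda>_. 0", OF _ this]
    have "b (y + 1 *\<^sub>R (x - y)) \<bullet> (x - y) = b (y + 0 *\<^sub>R (x - y)) \<bullet> (x - y)" by auto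
    then show ?thesis by (simp add: inner_diff_left)
  qed
  have loc: "\<exists>r>0. \<exists>A. ball a r \<subseteq> \<Omega> \<and> (\<forall>v. (A *v v) \<bullet> v = 0) \<and> (\<forall>x\<in>ball a r. b x = b a + A *v (x - a) \<and> J x = A)" if a: "a \<in> \<Omega>" for a
  proof -
    obtain r where r: "r > 0" "ball a r \<subseteq> \<Omega>" using \<Omega>(1) a openE by blast
    obtain A where A: "\<And>v. (A *v v) \<bullet> v = 0" "\<And>x. x \<in> ball a r \<Longrightarrow> b x = b a + A *v (x - a)"
      using killing_imp_affine_local[of r a b, OF r(1) mono[OF r(2)]] by blast
    have "J x = A" if x: "x \<in> ball a r" for x
    proof -
      have "((\<lambda>x. b a + A *v (x - a)) has_derivative (\<lambda>h. A *v h)) (at x)"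
        by (auto intro!: derivative_eq_intros bounded_linear.has_derivative[OF matrix_vector_mul_bounded_linear])
      then have "(b has_derivative (\<lambda>h. A *v h)) (at x)"
        by (rule has_derivative_transform_within_open[OF _ open_ball x]) (use A(2) in simp)
      from has_derivative_unique[OF this der] x r(2) have "(\<lambda>h. A *v h) = (\<lambda>h. J x *v h)" by blast
      then show ?thesis by (metis matrix_eq)
    qed
    with r A show ?thesis by blast
  qed
  obtain a where a: "a \<in> \<Omega>" using \<Omega>(3) by blast
  have J: "J x = J a" if x: "x \<in> \<Omega>" for x
  proof (rule connected_local_const[OF \<Omega>(2) x a], rule ballI)
    fix y assume y: "y \<in> \<Omega>"
    obtain r A where r: "r > 0" "\<And>x. x \<in> ball y r \<Longrightarrow> J x = A" using loc[OF y] by blast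
    then have "\<forall>z\<in>ball y r. J y = J z" by simp
    then show "\<forall>\<^sub>F z in at y within \<Omega>. J y = J z"
      unfolding eventually_at using r(1) by (intro exI[of _ r]) (auto simp: dist_commute)
  qed
  have "((\<lambda>x. b x - J a *v x) has_derivative (\<lambda>h. 0)) (at x)" if x: "x \<in> \<Omega>" for x
    using has_derivative_diff[OF der[OF x] bounded_linear_imp_has_derivative[OF matrix_vector_mul_bounded_linear[of "J a"]]] J[OF x] by simp
  then have "b x - J a *v x = b a - J a *v a" if "x \<in> \<Omega>" for x
    using has_derivative_zero_unique_connected[OF \<Omega>(1,2), of "\<lambda>x. b x - J a *v x" x a] that a by simp
  then have "\<forall>x\<in>\<Omega>. b x = J a *v x + (b a - J a *v a)" by (simp add: algebra_simps)
  then show ?thesis using skew[OF a] by blast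
qed

section \<open>Vanishing of the symmetric gradient\<close>

lemma cpartial_inside: "x \<in> \<Omega> \<Longrightarrow> cpartial \<Omega> j f x = partial_deriv j f x"
  by (simp add: cpartial_def)

context bounded_open
begin

text \<open>
  A null set that is open in \<open>\<Omega>\<close> is empty, so the equation holds everywhere and not just almost
  everywhere.
\<close>

lemma continuous_nonneg_integral_zero:
  assumes c: "continuous_on \<Omega> f" and nn: "\<And>x. x \<in> \<Omega> \<Longrightarrow> 0 \<le> f x" and i: "integrable M f"
    and z: "(\<integral>x. f x \<partial>M) = (0::real)" and x: "x \<in> \<Omega>"
  shows "f x = 0"
proof -
  define N where "N = \<Omega> \<inter> f -` (- {0})"
  have "open N" unfolding N_def using c op by (intro continuous_open_preimage) auto
  have "AE x in M. f x = 0" using z i nn by (subst (asm) integral_nonneg_eq_0_iff_AE) (auto intro!: AE_I2)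
  then have "AE x in lebesgue. x \<in> \<Omega> \<longrightarrow> f x = 0" using sets_Omega by (simp add: AE_restrict_space_iff)
  then have "AE x in lebesgue. x \<notin> N" by eventually_elim (auto simp: N_def)
  then have "N \<in> null_sets lebesgue" using \<open>open N\<close> borel_open[of N] by (subst AE_iff_null_sets) auto
  then have "negligible N" by (simp add: negligible_iff_null_sets)
  then have "N = {}" using \<open>open N\<close> open_not_negligible by blast
  with x show ?thesis by (auto simp: N_def)
qed

text \<open>
  Let \<open>S\<close> be the matrix with entries \<open>\<partial>\<^sub>i b\<^sup>j + \<partial>\<^sub>j b\<^sup>i\<close>. The divergence of the field \<open>F = S b\<close> is
  \<open>\<langle>\<Delta>b, b\<rangle> + \<langle>\<nabla>(div b), b\<rangle> + \<bar>S\<bar>\<^sup>2 / 2\<close>, of which only the last term is left. The boundary condition \<open>bc\<close>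
  says exactly that \<open>F\<close> is tangential, since its left-hand side is the product of \<open>F\<close> and the normal. So the
  integral of \<open>\<bar>S\<bar>\<^sup>2\<close> is \<open>0\<close>.
\<close>

theorem symmetric_gradient_vanishes:
  assumes sb: "smooth_boundary \<Omega>" and nu: "outer_unit_normal \<Omega> \<nu>"
    and C2: "Ck_closure_field 2 \<Omega> b"
    and div0: "\<And>x. x \<in> \<Omega> \<Longrightarrow> cdivergence \<Omega> b x = 0"
    and lap0: "\<And>x. x \<in> \<Omega> \<Longrightarrow> claplacian_field \<Omega> b x \<bullet> b x = 0"
    and bc: "\<And>x. x \<in> frontier \<Omega> \<Longrightarrow> cgradient_field \<Omega> b x (\<nu> x) \<bullet> b x + cgradient_field \<Omega> b x (b x) \<bullet> \<nu> x = 0"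
    and x: "x \<in> \<Omega>"
  shows "partial_deriv i (\<lambda>x. b x $ j) x + partial_deriv j (\<lambda>x. b x $ i) x = 0"
proof -
  define c1 where "c1 i j = cpartial \<Omega> i (\<lambda>x. b x $ j)" for i j
  define c2 where "c2 l i j = cpartial \<Omega> l (c1 i j)" for l i j
  have C: "Ck_closure (Suc (Suc 0)) \<Omega> (\<lambda>x. b x $ j)" for j
    using C2 by (simp add: Ck_closure_field_def numeral_2_eq_2 del: Ck_closure.simps)
  have cont0: "continuous_on (closure \<Omega>) (\<lambda>x. b x $ j)" for j using C[of j] by simp
  have cont1: "continuous_on (closure \<Omega>) (c1 i j)" for i j using C[of j] by (simp add: c1_def)
  have cont2: "continuous_on (closure \<Omega>) (c2 l i j)" for l i j using C[of j] by (simp add: c1_def c2_def)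
  have dif0: "(\<lambda>x. b x $ j) differentiable (at x)" if "x \<in> \<Omega>" for j x
    using C[of j] that op by (simp add: differentiable_on_eq_differentiable_at)
  have dif1: "c1 i j differentiable (at x)" if "x \<in> \<Omega>" for i j x
    using C[of j] that op by (simp add: differentiable_on_eq_differentiable_at c1_def)
  have c1: "c1 i j x = partial_deriv i (\<lambda>x. b x $ j) x" if "x \<in> \<Omega>" for i j x
    using that by (simp add: c1_def cpartial_inside)
  have c2: "c2 l i j x = partial_deriv l (c1 i j) x" if "x \<in> \<Omega>" for l i j x
    using that by (simp add: c2_def cpartial_inside)
  have c2': "c2 l i j x = partial_deriv l (partial_deriv i (\<lambda>x. b x $ j)) x" if "x \<in> \<Omega>" for l i j x
    unfolding c2[OF that] by (rule partial_deriv_cong_open[OF op that]) (rule c1)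
  have c2sym: "c2 l i j x = c2 i l j x" if "x \<in> \<Omega>" for l i j x
    unfolding c2'[OF that]
  proof (rule mixed_partials_symmetric[OF op that dif0])
    show "partial_deriv k (\<lambda>x. b x $ j) differentiable (at y)" if "y \<in> \<Omega>" for y k
      by (rule differentiable_cong_open[OF op that _ dif1[OF that, of k j]]) (rule c1)
    show "continuous_on \<Omega> (partial_deriv k (partial_deriv l (\<lambda>x. b x $ j)))" for k l
      by (rule continuous_on_eq[OF continuous_on_subset[OF cont2[of k l j] closure_subset]]) (rule c2')
  qed
  define F where "F x = (\<chi> i. \<Sum>j\<in>UNIV. (c1 i j x + c1 j i x) * b x $ j)" for x
  define DF where "DF x = (\<chi> i l. \<Sum>j\<in>UNIV. (c1 i j x + c1 j i x) * c1 l j x + (c2 l i j x + c2 l j i x) * b x $ j)" for x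
  have DFc: "continuous_on (closure \<Omega>) DF"
    unfolding DF_def[abs_def] using cont0 cont1 cont2
    by (intro continuous_on_vec_lambda continuous_on_sum continuous_on_add continuous_on_mult) auto
  obtain B where B: "\<And>x. x \<in> closure \<Omega> \<Longrightarrow> norm (DF x) \<le> B"
    by (rule continuous_on_compact_bounded[OF compact_closure_Omega DFc]) blast
  interpret T: tangential_field \<Omega> F DF "real CARD('n) * B"
  proof
    show "smooth_boundary \<Omega>" by (rule sb)
    show "continuous_on (closure \<Omega>) F"
      unfolding F_def[abs_def] using cont0 cont1
      by (intro continuous_on_vec_lambda continuous_on_sum continuous_on_add continuous_on_mult) auto
    show "continuous_on \<Omega> DF" by (rule continuous_on_subset[OF DFc closure_subset])
    show "(F has_derivative (\<lambda>h. DF x *v h)) (at x)" if x: "x \<in> \<Omega>" for x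
    proof (rule has_derivative_matrix)
      fix i
      have g: "gradient (\<lambda>x. b x $ j) x $ l = c1 l j x" "gradient (c1 k j) x $ l = c2 l k j x" for l k j
        using x by (simp_all add: gradient_def c1 c2)
      have "((\<lambda>x. \<Sum>j\<in>UNIV. (c1 i j x + c1 j i x) * b x $ j) has_derivative
        (\<lambda>h. \<Sum>j\<in>UNIV. (c1 i j x + c1 j i x) * (gradient (\<lambda>x. b x $ j) x \<bullet> h) + (gradient (c1 i j) x \<bullet> h + gradient (c1 j i) x \<bullet> h) * b x $ j)) (at x)"
        by (intro has_derivative_sum has_derivative_mult has_derivative_add gradient_has_derivative dif0 dif1 x)
      moreover have "(\<Sum>j\<in>UNIV. (c1 i j x + c1 j i x) * (gradient (\<lambda>x. b x $ j) x \<bullet> h) + (gradient (c1 i j) x \<bullet> h + gradient (c1 j i) x \<bullet> h) * b x $ j) = DF x $ i \<bullet> h" for h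
      proof -
        have "DF x $ i \<bullet> h = (\<Sum>l\<in>UNIV. \<Sum>j\<in>UNIV. ((c1 i j x + c1 j i x) * c1 l j x + (c2 l i j x + c2 l j i x) * b x $ j) * h $ l)"
          by (simp add: DF_def inner_vec_def sum_distrib_right)
        also have "\<dots> = (\<Sum>j\<in>UNIV. \<Sum>l\<in>UNIV. ((c1 i j x + c1 j i x) * c1 l j x + (c2 l i j x + c2 l j i x) * b x $ j) * h $ l)"
          by (rule sum.swap)
        also have "\<dots> = (\<Sum>j\<in>UNIV. (c1 i j x + c1 j i x) * (gradient (\<lambda>x. b x $ j) x \<bullet> h) + (gradient (c1 i j) x \<bullet> h + gradient (c1 j i) x \<bullet> h) * b x $ j)"
          by (rule sum.cong[OF refl])
            (simp add: inner_vec_def g sum_distrib_left sum_distrib_right sum.distrib[symmetric] algebra_simps)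
        finally show ?thesis by simp
      qed
      ultimately show "((\<lambda>x. F x $ i) has_derivative (\<lambda>h. DF x $ i \<bullet> h)) (at x)" by (simp add: F_def)
    qed
    show "norm (DF x *v h) \<le> real CARD('n) * B * norm h" if "x \<in> \<Omega>" for x h
    proof -
      have "norm (DF x) \<le> B" using B that closure_subset[of \<Omega>] by blast
      then have "real CARD('n) * norm (DF x) * norm h \<le> real CARD('n) * B * norm h"
        by (intro mult_right_mono mult_left_mono) auto
      then show ?thesis using norm_matrix_vector_le[of "DF x" h] by linarith
    qed
    show "tangential \<Omega> F"
    proof (rule tangentialI_normal[OF nu])
      fix z assume z: "z \<in> frontier \<Omega>"
      have 1: "cgradient_field \<Omega> b z v $ j = (\<Sum>k\<in>UNIV. c1 k j z * v $ k)" for v j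
        by (simp add: cgradient_field_def cgradient_def c1_def inner_vec_def)
      have "F z \<bullet> \<nu> z = (\<Sum>i\<in>UNIV. \<Sum>j\<in>UNIV. c1 i j z * \<nu> z $ i * b z $ j) + (\<Sum>i\<in>UNIV. \<Sum>j\<in>UNIV. c1 j i z * b z $ j * \<nu> z $ i)"
        by (simp add: F_def inner_vec_def sum_distrib_right sum_distrib_left sum.distrib[symmetric] algebra_simps)
      also have "(\<Sum>i\<in>UNIV. \<Sum>j\<in>UNIV. c1 i j z * \<nu> z $ i * b z $ j) = (\<Sum>j\<in>UNIV. \<Sum>i\<in>UNIV. c1 i j z * \<nu> z $ i * b z $ j)"
        by (rule sum.swap)
      also have "\<dots> = cgradient_field \<Omega> b z (\<nu> z) \<bullet> b z" by (simp add: inner_vec_def 1 sum_distrib_right)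
      also have "(\<Sum>i\<in>UNIV. \<Sum>j\<in>UNIV. c1 j i z * b z $ j * \<nu> z $ i) = cgradient_field \<Omega> b z (b z) \<bullet> \<nu> z"
        by (simp add: inner_vec_def 1 sum_distrib_right)
      finally show "F z \<bullet> \<nu> z = 0" using bc[OF z] by simp
    qed
  qed
  define S where "S i j x = c1 i j x + c1 j i x" for i j x
  have tr: "(\<Sum>i\<in>UNIV. DF x $ i $ i) = (\<Sum>i\<in>UNIV. \<Sum>j\<in>UNIV. (S i j x)\<^sup>2 / 2)" if x: "x \<in> \<Omega>" for x
  proof -
    (* The j-th derivative of div b = 0. *)
    have dz: "(\<Sum>i\<in>UNIV. c2 j i i x) = 0" for j
    proof -
      have "((\<lambda>x. \<Sum>i\<in>UNIV. c1 i i x) has_derivative (\<lambda>h. \<Sum>i\<in>UNIV. gradient (c1 i i) x \<bullet> h)) (at x)"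
        by (intro has_derivative_sum gradient_has_derivative dif1 x)
      from partial_deriv_eq[OF this, of j]
      have "partial_deriv j (\<lambda>x. \<Sum>i\<in>UNIV. c1 i i x) x = (\<Sum>i\<in>UNIV. c2 j i i x)"
        using x by (simp add: inner_axis gradient_def c2)
      moreover have "partial_deriv j (\<lambda>x. \<Sum>i\<in>UNIV. c1 i i x) x = partial_deriv j (\<lambda>x. 0) x"
        by (rule partial_deriv_cong_open[OF op x]) (use div0 in \<open>simp add: cdivergence_def c1_def\<close>)
      ultimately show ?thesis using partial_deriv_eq[OF has_derivative_const, of j 0 x] by simp
    qed
    have 0: "(\<Sum>i\<in>UNIV. DF x $ i $ i) = (\<Sum>i\<in>UNIV. \<Sum>j\<in>UNIV. S i j x * c1 i j x) + (\<Sum>i\<in>UNIV. \<Sum>j\<in>UNIV. c2 i i j x * b x $ j) + (\<Sum>i\<in>UNIV. \<Sum>j\<in>UNIV. c2 i j i x * b x $ j)"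
      by (simp add: DF_def S_def sum.distrib[symmetric] algebra_simps)
    have "(\<Sum>i\<in>UNIV. \<Sum>j\<in>UNIV. c2 i i j x * b x $ j) = (\<Sum>j\<in>UNIV. \<Sum>i\<in>UNIV. c2 i i j x * b x $ j)" by (rule sum.swap)
    also have "\<dots> = claplacian_field \<Omega> b x \<bullet> b x"
      by (simp add: claplacian_field_def inner_vec_def sum_distrib_right c2_def c1_def)
    finally have 1: "(\<Sum>i\<in>UNIV. \<Sum>j\<in>UNIV. c2 i i j x * b x $ j) = 0" using lap0[OF x] by simp
    have "(\<Sum>i\<in>UNIV. \<Sum>j\<in>UNIV. c2 i j i x * b x $ j) = (\<Sum>j\<in>UNIV. \<Sum>i\<in>UNIV. c2 i j i x * b x $ j)" by (rule sum.swap)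
    also have "\<dots> = (\<Sum>j\<in>UNIV. (\<Sum>i\<in>UNIV. c2 j i i x) * b x $ j)"
      unfolding sum_distrib_right by (intro sum.cong refl arg_cong2[of _ _ _ _ "(*)"] c2sym x)
    finally have 2: "(\<Sum>i\<in>UNIV. \<Sum>j\<in>UNIV. c2 i j i x * b x $ j) = 0" by (simp add: dz)
    (* S is symmetric, so it sees only the symmetric part of the gradient of b. *)
    have "(\<Sum>i\<in>UNIV. \<Sum>j\<in>UNIV. S i j x * c1 i j x) = (\<Sum>j\<in>UNIV. \<Sum>i\<in>UNIV. S i j x * c1 i j x)" by (rule sum.swap)
    also have "\<dots> = (\<Sum>i\<in>UNIV. \<Sum>j\<in>UNIV. S i j x * c1 j i x)" by (simp add: S_def add.commute)
    finally have "2 * (\<Sum>i\<in>UNIV. \<Sum>j\<in>UNIV. S i j x * c1 i j x) = (\<Sum>i\<in>UNIV. \<Sum>j\<in>UNIV. S i j x * c1 i j x) + (\<Sum>i\<in>UNIV. \<Sum>j\<in>UNIV. S i j x * c1 j i x)" by simp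
    also have "\<dots> = (\<Sum>i\<in>UNIV. \<Sum>j\<in>UNIV. (S i j x)\<^sup>2)"
      unfolding sum.distrib[symmetric] by (intro sum.cong refl) (simp add: S_def power2_eq_square algebra_simps)
    finally have 3: "(\<Sum>i\<in>UNIV. \<Sum>j\<in>UNIV. S i j x * c1 i j x) = (\<Sum>i\<in>UNIV. \<Sum>j\<in>UNIV. (S i j x)\<^sup>2 / 2)"
      by (simp add: sum_divide_distrib[symmetric])
    show ?thesis unfolding 0 1 2 3 by simp
  qed
  have Scl: "continuous_on (closure \<Omega>) (\<lambda>x. \<Sum>i\<in>UNIV. \<Sum>j\<in>UNIV. (S i j x)\<^sup>2 / 2)"
    unfolding S_def using cont1
    by (intro continuous_on_sum continuous_on_divide continuous_on_power continuous_on_add continuous_on_const) auto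
  note Sc = continuous_on_subset[OF Scl closure_subset]
  have z: "(\<integral>x. (\<Sum>i\<in>UNIV. \<Sum>j\<in>UNIV. (S i j x)\<^sup>2 / 2) \<partial>M) = 0"
  proof -
    have "(\<integral>x. (\<Sum>i\<in>UNIV. \<Sum>j\<in>UNIV. (S i j x)\<^sup>2 / 2) \<partial>M) = (\<integral>x. (\<Sum>j\<in>UNIV. DF x $ j $ j) \<partial>M)"
      by (rule Bochner_Integration.integral_cong[OF refl]) (use tr in simp)
    then show ?thesis using T.divergence_theorem_tangential by simp
  qed
  obtain B' where B': "\<And>x. x \<in> closure \<Omega> \<Longrightarrow> norm (\<Sum>i\<in>UNIV. \<Sum>j\<in>UNIV. (S i j x)\<^sup>2 / 2) \<le> B'"
    by (rule continuous_on_compact_bounded[OF compact_closure_Omega Scl]) blast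
  have int: "integrable M (\<lambda>x. \<Sum>i\<in>UNIV. \<Sum>j\<in>UNIV. (S i j x)\<^sup>2 / 2)"
    by (rule integrable_bounded[OF measurable_continuous[OF Sc], where B=B']) (use B' closure_subset[of \<Omega>] in force)
  have "(\<Sum>i\<in>UNIV. \<Sum>j\<in>UNIV. (S i j x)\<^sup>2 / 2) = 0"
    by (rule continuous_nonneg_integral_zero[OF Sc _ int z x]) (intro sum_nonneg, simp)
  then have "(\<Sum>j\<in>UNIV. (S i j x)\<^sup>2 / 2) = 0" by (subst (asm) sum_nonneg_eq_0_iff) (auto intro: sum_nonneg)
  then have "(S i j x)\<^sup>2 / 2 = 0" by (subst (asm) sum_nonneg_eq_0_iff) auto
  then show ?thesis using x by (simp add: S_def c1)
qed

theorem field_is_infinitesimal_isometry: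
  assumes sb: "smooth_boundary \<Omega>" and nu: "outer_unit_normal \<Omega> \<nu>" and conn: "connected \<Omega>" "\<Omega> \<noteq> {}"
    and C2: "Ck_closure_field 2 \<Omega> b"
    and div0: "\<And>x. x \<in> \<Omega> \<Longrightarrow> cdivergence \<Omega> b x = 0"
    and lap0: "\<And>x. x \<in> \<Omega> \<Longrightarrow> claplacian_field \<Omega> b x \<bullet> b x = 0"
    and bc: "\<And>x. x \<in> frontier \<Omega> \<Longrightarrow> cgradient_field \<Omega> b x (\<nu> x) \<bullet> b x + cgradient_field \<Omega> b x (b x) \<bullet> \<nu> x = 0"
  shows "\<exists>A c. (\<forall>v. (A *v v) \<bullet> v = 0) \<and> (\<forall>x\<in>closure \<Omega>. b x = A *v x + c)"
proof -
  have C: "Ck_closure (Suc (Suc 0)) \<Omega> (\<lambda>x. b x $ j)" for j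
    using C2 by (simp add: Ck_closure_field_def numeral_2_eq_2 del: Ck_closure.simps)
  define J :: "real^'n \<Rightarrow> real^'n^'n" where "J x = (\<chi> j. gradient (\<lambda>x. b x $ j) x)" for x
  have "\<exists>A c. (\<forall>v. (A *v v) \<bullet> v = 0) \<and> (\<forall>x\<in>\<Omega>. b x = A *v x + c)"
  proof (rule killing_imp_affine[OF op conn])
    fix x assume x: "x \<in> \<Omega>"
    have d: "(\<lambda>x. b x $ j) differentiable (at x)" for j
      using C[of j] x op by (simp add: differentiable_on_eq_differentiable_at)
    show "(b has_derivative (\<lambda>h. J x *v h)) (at x)"
      by (rule has_derivative_matrix) (use gradient_has_derivative[OF d] in \<open>simp add: J_def\<close>)
    have k: "partial_deriv i (\<lambda>x. b x $ j) x + partial_deriv j (\<lambda>x. b x $ i) x = 0" for i j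
      by (rule symmetric_gradient_vanishes[OF sb nu C2 div0 lap0 bc x])
    have s: "J x $ j $ i = - J x $ i $ j" for i j
      unfolding J_def gradient_def vec_lambda_beta using k[of i j] by linarith
    show "(J x *v v) \<bullet> v = 0" for v
    proof -
      have "(J x *v v) \<bullet> v = (\<Sum>i\<in>UNIV. \<Sum>j\<in>UNIV. J x $ i $ j * v $ j * v $ i)"
        by (simp add: inner_vec_def matrix_vector_mult_def sum_distrib_right)
      also have "\<dots> = (\<Sum>j\<in>UNIV. \<Sum>i\<in>UNIV. J x $ i $ j * v $ j * v $ i)" by (rule sum.swap)
      also have "\<dots> = - (\<Sum>j\<in>UNIV. \<Sum>i\<in>UNIV. J x $ j $ i * v $ i * v $ j)"
        unfolding sum_negf[symmetric]
      proof (intro sum.cong refl)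
        fix i j
        show "J x $ i $ j * v $ j * v $ i = - (J x $ j $ i * v $ i * v $ j)" using s[of i j] by simp
      qed
      finally show ?thesis by (simp add: inner_vec_def matrix_vector_mult_def sum_distrib_right)
    qed
  qed
  then obtain A c where A: "\<forall>v. (A *v v) \<bullet> v = 0" "\<And>x. x \<in> \<Omega> \<Longrightarrow> b x = A *v x + c" by blast
  have cb: "continuous_on (closure \<Omega>) b"
  proof -
    have "continuous_on (closure \<Omega>) (\<lambda>x. \<chi> j. b x $ j)"
      using C by (intro continuous_on_vec_lambda) simp
    then show ?thesis by simp
  qed
  have "b x = A *v x + c" if "x \<in> closure \<Omega>" for x
  proof -
    have "continuous_on (closure \<Omega>) (\<lambda>x. b x - (A *v x + c))"
      by (intro continuous_intros cb matrix_vector_mult_linear_continuous_on)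
    then have "b x - (A *v x + c) = 0"
      by (rule continuous_constant_on_closure[OF _ _ that]) (use A(2) in simp)
    then show ?thesis by simp
  qed
  with A(1) show ?thesis by blast
qed

end

section \<open>The flow of a skew affine field\<close>

locale skew_affine =
  fixes A :: "real^'n::finite^'n" and c :: "real^'n"
  assumes skew: "(A *v v) \<bullet> v = 0"
begin

primrec iter :: "real^'n \<Rightarrow> nat \<Rightarrow> real^'n" where
  "iter x 0 = A *v x + c"
| "iter x (Suc k) = A *v iter x k"

text \<open>
  For \<open>n \<ge> 1\<close> the \<open>n\<close>-th time derivative at \<open>0\<close> of the solution of \<open>x' = A x + c\<close> is \<open>A\<^sup>n\<^sup>-\<^sup>1 (A x + c)\<close>, which is
  \<open>iter x (n - 1)\<close>.
\<close>

definition coef :: "real^'n \<Rightarrow> 'n \<Rightarrow> nat \<Rightarrow> real" where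
  "coef x j n = (case n of 0 \<Rightarrow> x $ j | Suc k \<Rightarrow> iter x k $ j / fact n)"

definition flow :: "real \<Rightarrow> real^'n \<Rightarrow> real^'n" where
  "flow t x = (\<chi> j. \<Sum>n. coef x j n * t ^ n)"

lemma coef_summable: "summable (\<lambda>n. coef x j n * t ^ n)"
proof -
  define K where "K = max 1 (real CARD('n) * norm A)"
  define V where "V = norm x + norm (iter x 0)"
  have K: "K \<ge> 1" by (simp add: K_def)
  have it: "norm (iter x k) \<le> K ^ k * norm (iter x 0)" for k
  proof (induction k)
    case (Suc k)
    have "norm (iter x (Suc k)) \<le> real CARD('n) * norm A * norm (iter x k)" by (simp add: norm_matrix_vector_le)
    also have "\<dots> \<le> K * norm (iter x k)" by (intro mult_right_mono) (simp_all add: K_def)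
    also have "\<dots> \<le> K * (K ^ k * norm (iter x 0))" using Suc K by (intro mult_left_mono) auto
    finally show ?case by simp
  qed simp
  have cb: "\<bar>coef x j n\<bar> \<le> V * (K ^ n / fact n)" for n
  proof (cases n)
    case 0
    then show ?thesis using component_le_norm_cart[of x j] by (simp add: coef_def V_def add_increasing2)
  next
    case (Suc k)
    have "\<bar>iter x k $ j\<bar> \<le> norm (iter x k)" by (rule component_le_norm_cart)
    also have "\<dots> \<le> K ^ k * norm (iter x 0)" by (rule it)
    also have "\<dots> \<le> K ^ n * V" using K Suc by (intro mult_mono power_increasing) (auto simp: V_def)
    finally have "\<bar>iter x k $ j\<bar> / fact n \<le> K ^ n * V / fact n" by (intro divide_right_mono) auto
    then show ?thesis using Suc by (simp add: coef_def mult.commute abs_mult)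
  qed
  have "summable (\<lambda>n. V * (inverse (fact n) * (K * \<bar>t\<bar>) ^ n))" by (intro summable_mult summable_exp)
  then show ?thesis
  proof (rule summable_comparison_test')
    fix n assume "n \<ge> (0::nat)"
    have "norm (coef x j n * t ^ n) \<le> V * (K ^ n / fact n) * \<bar>t\<bar> ^ n"
      using mult_right_mono[OF cb[of n], of "\<bar>t\<bar> ^ n"] by (simp add: abs_mult power_abs)
    then show "norm (coef x j n * t ^ n) \<le> V * (inverse (fact n) * (K * \<bar>t\<bar>) ^ n)"
      by (simp add: power_mult_distrib field_simps)
  qed
qed

lemma flow_0: "flow 0 x = x"
proof -
  have "(\<Sum>n. coef x j n * 0 ^ n) = x $ j" for j
    using powser_zero[of "coef x j"] by (simp add: coef_def)
  then show ?thesis by (simp add: flow_def vec_eq_iff)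
qed

lemma flow_component_DERIV:
  "((\<lambda>t. flow t x $ j) has_real_derivative (A *v flow t x + c) $ j) (at t)"
proof -
  have "((\<lambda>t. \<Sum>n. coef x j n * t ^ n) has_real_derivative (\<Sum>n. diffs (coef x j) n * t ^ n)) (at t)"
    by (rule termdiffs_strong_converges_everywhere) (rule coef_summable)
  moreover have "(\<lambda>n. diffs (coef x j) n * t ^ n) sums (A *v flow t x + c) $ j"
  proof -
    have "(\<lambda>n. coef x l n * t ^ n) sums (flow t x $ l)" for l
      using summable_sums[OF coef_summable] by (simp add: flow_def)
    then have "(\<lambda>n. \<Sum>l\<in>UNIV. A $ j $ l * (coef x l n * t ^ n)) sums (\<Sum>l\<in>UNIV. A $ j $ l * flow t x $ l)"
      by (intro sums_sum sums_mult)
    moreover have "(\<lambda>n. if n = 0 then c $ j else 0) sums c $ j"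
      using sums_single[of 0 "\<lambda>_. c $ j"] by simp
    ultimately have "(\<lambda>n. (\<Sum>l\<in>UNIV. A $ j $ l * (coef x l n * t ^ n)) + (if n = 0 then c $ j else 0)) sums (A *v flow t x + c) $ j"
      by (simp add: sums_add matrix_vector_mult_def)
    moreover have "(\<Sum>l\<in>UNIV. A $ j $ l * (coef x l n * t ^ n)) + (if n = 0 then c $ j else 0) = diffs (coef x j) n * t ^ n" for n
    proof (cases n)
      case 0
      then show ?thesis by (simp add: diffs_def coef_def matrix_vector_mult_def)
    next
      case (Suc k)
      have "diffs (coef x j) n = real (Suc n) * (iter x n $ j / (real (Suc n) * fact n))"
        by (simp add: diffs_def coef_def del: iter.simps of_nat_Suc)
      also have "\<dots> = iter x n $ j / fact n" by (simp del: of_nat_Suc iter.simps)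
      also have "iter x n $ j = (\<Sum>l\<in>UNIV. A $ j $ l * iter x k $ l)" by (simp add: Suc matrix_vector_mult_def)
      finally have D: "diffs (coef x j) n = (\<Sum>l\<in>UNIV. A $ j $ l * iter x k $ l) / fact n" .
      have C: "coef x l n = iter x k $ l / fact n" for l by (simp add: coef_def Suc)
      have "n \<noteq> 0" using Suc by simp
      then show ?thesis unfolding D C by (simp add: sum_divide_distrib sum_distrib_right mult.assoc)
    qed
    ultimately show ?thesis by simp
  qed
  ultimately show ?thesis by (simp add: flow_def sums_unique[symmetric])
qed

lemma flow_derivative:
  "((\<lambda>t. flow t x) has_derivative (\<lambda>s. s *\<^sub>R (A *v flow t x + c))) (at t)"
proof -
  have "((\<lambda>t. \<chi> j. flow t x $ j) has_derivative (\<lambda>s. \<chi> j. s * (A *v flow t x + c) $ j)) (at t)"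
    unfolding has_derivative_componentwise_within[of "\<lambda>t. \<chi> j. flow t x $ j"]
  proof
    fix e :: "real^'n" assume "e \<in> Basis"
    then obtain i where "e = axis i 1" by (auto simp: Basis_vec_def)
    then show "((\<lambda>t. (\<chi> j. flow t x $ j) \<bullet> e) has_derivative (\<lambda>s. (\<chi> j. s * (A *v flow t x + c) $ j) \<bullet> e)) (at t)"
      using flow_component_DERIV[of x i t]
      by (simp add: inner_axis has_field_derivative_def mult.commute[of _ "(_ + _)"])
  qed
  moreover have "(\<lambda>s. \<chi> j. s * (A *v flow t x + c) $ j) = (\<lambda>s. s *\<^sub>R (A *v flow t x + c))"
    by (simp add: vec_eq_iff fun_eq_iff)
  ultimately show ?thesis by simp
qed

text \<open>
  The difference \<open>d\<close> of two solutions satisfies \<open>d' = A d\<close>, and \<open>(A d) \<bullet> d = 0\<close>. This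
  yields uniqueness of solutions as well as isometry of the flow.
\<close>

lemma solutions_isometric:
  assumes "\<And>t. (\<gamma> has_derivative (\<lambda>s. s *\<^sub>R (A *v \<gamma> t + c))) (at t)"
    and "\<And>t. (\<delta> has_derivative (\<lambda>s. s *\<^sub>R (A *v \<delta> t + c))) (at t)"
  shows "dist (\<gamma> t) (\<delta> t) = dist (\<gamma> 0) (\<delta> 0)"
proof -
  define q where "q t = (\<gamma> t - \<delta> t) \<bullet> (\<gamma> t - \<delta> t)" for t
  have "(q has_real_derivative 0) (at t)" for t
  proof -
    have "((\<lambda>t. \<gamma> t - \<delta> t) has_derivative (\<lambda>s. s *\<^sub>R (A *v (\<gamma> t - \<delta> t)))) (at t)"
      using has_derivative_diff[OF assms[of t]] by (simp add: matrix_vector_mult_diff_distrib algebra_simps)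
    from has_derivative_inner[OF this this] show ?thesis
      unfolding q_def[abs_def] by (simp add: has_field_derivative_def skew inner_commute[of _ "A *v _"] lambda_zero)
  qed
  then have "q t = q 0" using DERIV_isconst_all[of q t 0] by simp
  then have "sqrt (q t) = sqrt (q 0)" by simp
  then show ?thesis by (simp add: q_def dist_norm norm_eq_sqrt_inner)
qed

lemma flow_isometry: "dist (flow t x) (flow t y) = dist x y"
  using solutions_isometric[of "\<lambda>t. flow t x" "\<lambda>t. flow t y", OF flow_derivative flow_derivative] by (simp add: flow_0)

lemma flow_add: "flow (s + t) x = flow s (flow t x)"
proof -
  have "((\<lambda>s. flow (s + t) x) has_derivative (\<lambda>h. h *\<^sub>R (A *v flow (s + t) x + c))) (at s)" for s
  proof -
    have "((\<lambda>s. s + t) has_derivative (\<lambda>h. h)) (at s)" by (auto intro!: derivative_eq_intros)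
    from diff_chain_at[OF this flow_derivative] show ?thesis by (simp add: o_def)
  qed
  from solutions_isometric[of "\<lambda>s. flow (s + t) x" "\<lambda>s. flow s (flow t x)", OF this flow_derivative, of s]
  show ?thesis by (simp add: flow_0)
qed

lemma flow_inverse: "flow (- t) (flow t x) = x" "flow t (flow (- t) x) = x"
  using flow_add[of "-t" t x] flow_add[of t "-t" x] by (simp_all add: flow_0)

definition rot :: "real \<Rightarrow> real^'n^'n" where "rot t = matrix (\<lambda>v. flow t v - flow t 0)"

lemma flow_orthogonal: "orthogonal_transformation (\<lambda>v. flow t v - flow t 0)"
  unfolding orthogonal_transformation_isometry using flow_isometry by (simp add: dist_norm)

lemma flow_affine: "flow t x = rot t *v x + flow t 0"
proof -
  have "linear (\<lambda>v. flow t v - flow t 0)" using flow_orthogonal by (simp add: orthogonal_transformation_linear)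
  then have "rot t *v x = flow t x - flow t 0" unfolding rot_def by (subst matrix_works) (auto simp: linear_matrix_vector_mul_eq)
  then show ?thesis by simp
qed

lemma rot_isometry: "(rot t *v x) \<bullet> (rot t *v y) = x \<bullet> y"
proof -
  have "rot t *v x = flow t x - flow t 0" for x using flow_affine[of t x] by simp
  then show ?thesis using flow_orthogonal[of t] by (simp add: orthogonal_transformation_def)
qed

end

section \<open>Invariance of the domain\<close>

context tangential_field
begin

text \<open>
  At the first exit time \<open>t1\<close> the curve meets the boundary. Shortly before, \<open>\<rho>\<close> along the curve has a
  derivative of at most \<open>- C * \<rho>\<close> by the boundary estimate, so \<open>exp (C * s) * \<rho>\<close> cannot increase from a negative value
  to \<open>0\<close>.
\<close>

lemma tangential_curve_stays:
  fixes \<gamma> :: "real \<Rightarrow> real^'n"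
  assumes start: "\<gamma> 0 \<in> \<Omega>"
    and der: "\<And>t. \<gamma> t \<in> \<Omega> \<Longrightarrow> (\<gamma> has_derivative (\<lambda>s. s *\<^sub>R F (\<gamma> t))) (at t)"
    and cont: "continuous_on UNIV \<gamma>" and t: "t \<ge> 0"
  shows "\<gamma> t \<in> \<Omega>"
proof (rule ccontr)
  assume out: "\<gamma> t \<notin> \<Omega>"
  define T where "T = {0..} \<inter> \<gamma> -` (- \<Omega>)"
  have "closed T" unfolding T_def using cont op
    by (intro closed_Int closed_atLeast closed_vimage) auto
  moreover have Tne: "T \<noteq> {}" "bdd_below T" using out t by (auto simp: T_def intro!: bdd_belowI[of _ 0])
  ultimately have inT: "Inf T \<in> T" by (intro closed_contains_Inf) auto
  define t1 where "t1 = Inf T"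
  have t1: "t1 \<ge> 0" "\<gamma> t1 \<notin> \<Omega>" using inT by (auto simp: t1_def T_def)
  have before: "\<gamma> s \<in> \<Omega>" if "0 \<le> s" "s < t1" for s
  proof (rule ccontr)
    assume "\<gamma> s \<notin> \<Omega>"
    then have "s \<in> T" using that by (simp add: T_def)
    then have "t1 \<le> s" unfolding t1_def using Tne(2) by (rule cInf_lower)
    with that show False by simp
  qed
  have t1pos: "t1 > 0" using t1 start by (cases "t1 = 0") auto
  have ct: "isCont \<gamma> s" for s using cont by (simp add: continuous_on_eq_continuous_at)
  have "\<gamma> t1 \<in> closure \<Omega>"
  proof -
    have "(\<lambda>n. t1 - t1 / (real n + 1)) \<longlonglongrightarrow> t1" by real_asymp
    then have "(\<lambda>n. \<gamma> (t1 - t1 / (real n + 1))) \<longlonglongrightarrow> \<gamma> t1" using ct isCont_tendsto_compose by blast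
    moreover have "\<gamma> (t1 - t1 / (real n + 1)) \<in> closure \<Omega>" for n
    proof -
      have "t1 / (real n + 1) \<le> t1" "t1 / (real n + 1) > 0" using t1pos by (simp_all add: field_simps)
      then show ?thesis using before[of "t1 - t1 / (real n + 1)"] closure_subset[of \<Omega>] by auto
    qed
    ultimately show ?thesis by (rule closed_sequentially[OF closed_closure, rotated])
  qed
  then have fr: "\<gamma> t1 \<in> frontier \<Omega>" using t1(2) op by (simp add: frontier_def interior_open)
  obtain U \<rho> where U: "\<gamma> t1 \<in> U" and df: "defining_function \<Omega> U \<rho>" using sb fr unfolding smooth_boundary_def by blast
  obtain r C where r: "r > 0" and C: "C \<ge> 0" and rU: "ball (\<gamma> t1) r \<subseteq> U"
    and est: "\<And>y. y \<in> \<Omega> \<Longrightarrow> y \<in> ball (\<gamma> t1) r \<Longrightarrow> \<bar>F y \<bullet> gradient \<rho> y\<bar> \<le> C * (- \<rho> y)"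
    using boundary_estimate[OF df fr U] by blast
  have oU: "open U" and sm: "smooth_on U \<rho>" and inner: "\<Omega> \<inter> U = {y \<in> U. \<rho> y < 0}" and \<rho>1: "\<rho> (\<gamma> t1) = 0"
    using df fr U by (auto simp: defining_function_def)
  obtain d where d: "d > 0" "\<And>s. \<bar>s - t1\<bar> < d \<Longrightarrow> dist (\<gamma> s) (\<gamma> t1) < r"
    using ct[of t1] r unfolding continuous_at_eps_delta by (auto simp: dist_norm)
  define t0 where "t0 = max 0 (t1 - d / 2)"
  have t0: "0 \<le> t0" "t0 < t1" using t1pos d(1) by (auto simp: t0_def)
  have near: "\<gamma> s \<in> ball (\<gamma> t1) r" if "t0 \<le> s" "s \<le> t1" for s
    using d(2)[of s] that d(1) by (simp add: t0_def dist_commute abs_if max_def split: if_splits)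
  define g where "g s = exp (C * s) * \<rho> (\<gamma> s)" for s
  have gd: "\<exists>y. (g has_real_derivative y) (at s) \<and> y \<le> 0" if s: "t0 < s" "s < t1" for s
  proof -
    have sO: "\<gamma> s \<in> \<Omega>" using before[of s] s t0 by simp
    have sb: "\<gamma> s \<in> ball (\<gamma> t1) r" using near[of s] s by simp
    have sU: "\<gamma> s \<in> U" using sb rU by blast
    have "(\<rho> has_derivative (\<lambda>h. gradient \<rho> (\<gamma> s) \<bullet> h)) (at (\<gamma> s))"
      by (rule gradient_has_derivative[OF smooth_on_differentiable_at[OF sm oU sU]])
    from diff_chain_at[OF der[OF sO] this]
    have "((\<lambda>s. \<rho> (\<gamma> s)) has_real_derivative (F (\<gamma> s) \<bullet> gradient \<rho> (\<gamma> s))) (at s)"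
      by (simp add: o_def has_field_derivative_def inner_commute mult_commute_abs)
    then have "(g has_real_derivative (exp (C * s) * (C * \<rho> (\<gamma> s) + F (\<gamma> s) \<bullet> gradient \<rho> (\<gamma> s)))) (at s)"
      unfolding g_def[abs_def] by (auto intro!: derivative_eq_intros simp: algebra_simps)
    moreover have "C * \<rho> (\<gamma> s) + F (\<gamma> s) \<bullet> gradient \<rho> (\<gamma> s) \<le> 0" using est[OF sO sb] by simp
    then have "exp (C * s) * (C * \<rho> (\<gamma> s) + F (\<gamma> s) \<bullet> gradient \<rho> (\<gamma> s)) \<le> 0"
      by (simp add: mult_le_0_iff)
    ultimately show ?thesis by blast
  qed
  have "continuous_on {t0..t1} (\<lambda>s. \<rho> (\<gamma> s))"
    by (rule continuous_on_compose2[OF smooth_on_continuous[OF sm] continuous_on_subset[OF cont]]) (use near rU in auto)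
  then have gc: "continuous_on {t0..t1} g" unfolding g_def[abs_def] by (intro continuous_intros)
  have "g t0 \<ge> g t1" using DERIV_nonpos_imp_decreasing_open[OF less_imp_le[OF t0(2)] gd gc] by blast
  moreover have "g t1 = 0" by (simp add: g_def \<rho>1)
  moreover have "\<rho> (\<gamma> t0) < 0"
  proof -
    have "\<gamma> t0 \<in> \<Omega>" using before[OF t0] .
    moreover have "\<gamma> t0 \<in> U" using near[of t0] t0 rU by auto
    ultimately show ?thesis using inner by blast
  qed
  then have "g t0 < 0" by (simp add: g_def mult_less_0_iff)
  ultimately show False by simp
qed

end

section \<open>Isometries preserve Lebesgue measure\<close>

lemma nn_integral_lborel_translate:
  fixes g :: "'a::euclidean_space \<Rightarrow> ennreal"
  assumes [measurable]: "g \<in> borel_measurable borel"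
  shows "(\<integral>\<^sup>+x. g (a + x) \<partial>lborel) = (\<integral>\<^sup>+x. g x \<partial>lborel)"
proof -
  have "(\<integral>\<^sup>+x. g x \<partial>lborel) = (\<integral>\<^sup>+x. g x \<partial>distr lborel borel ((+) a))" by (simp add: lborel_distr_plus)
  also have "\<dots> = (\<integral>\<^sup>+x. g (a + x) \<partial>lborel)" by (rule nn_integral_distr) auto
  finally show ?thesis by simp
qed

text \<open>
  The image measure is invariant under translations by all \<open>f w\<close>, that is, by everything. Integrating
  \<open>1\<^sub>U x * 1\<^sub>S (x + f y)\<close> for the unit ball \<open>U\<close> in both orders compares it with Lebesgue measure: \<open>U\<close> is mapped
  to itself by \<open>f\<close>, which fixes the constant.
\<close>

lemma lborel_distr_orthogonal:
  fixes f :: "'a::euclidean_space \<Rightarrow> 'a"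
  assumes f: "orthogonal_transformation f"
  shows "distr lborel borel f = lborel"
proof (rule measure_eqI)
  fix S :: "'a set" assume "S \<in> sets (distr lborel borel f)"
  then have [measurable]: "S \<in> sets borel" by simp
  have lin: "linear f" using f by (simp add: orthogonal_transformation_linear)
  then have fc: "continuous_on UNIV f" by (simp add: linear_continuous_on linear_conv_bounded_linear)
  then have [measurable]: "f \<in> borel_measurable borel" by (rule borel_measurable_continuous_onI)
  have surj: "\<exists>w. f w = x" for x using orthogonal_transformation_surj[OF f] by (metis surjD)
  define U where "U = ball (0::'a) 1"
  have [measurable]: "U \<in> sets borel" by (simp add: U_def)
  have fadd: "f x + f y = f (x + y)" "f x - f y = f (x - y)" for x y using lin by (simp_all add: linear_add linear_diff)
  have nf: "norm (f x) = norm x" for x by (rule orthogonal_transformation_norm[OF f])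
  have e1: "(\<integral>\<^sup>+y. indicator S (x + f y) \<partial>lborel) = emeasure (distr lborel borel f) S" for x
  proof -
    obtain w where w: "f w = x" using surj by blast
    have "(\<integral>\<^sup>+y. indicator S (x + f y) \<partial>lborel) = (\<integral>\<^sup>+y. indicator S (f (w + y)) \<partial>lborel)"
      by (simp add: fadd flip: w)
    also have "\<dots> = (\<integral>\<^sup>+y. indicator S (f y) \<partial>lborel)" by (rule nn_integral_lborel_translate) measurable
    also have "\<dots> = (\<integral>\<^sup>+y. indicator S y \<partial>distr lborel borel f)" by (rule nn_integral_distr[symmetric]) measurable
    finally show ?thesis by simp
  qed
  have e2: "(\<integral>\<^sup>+y. indicator U (x - f y) \<partial>lborel) = emeasure lborel U" for x
  proof -
    obtain w where w: "f w = x" using surj by blast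
    have "(\<integral>\<^sup>+y. indicator U (x - f y) \<partial>lborel) = (\<integral>\<^sup>+y. indicator U (- w + y) \<partial>lborel)"
      by (rule nn_integral_cong) (simp add: U_def indicator_def fadd nf norm_minus_commute flip: w)
    also have "\<dots> = (\<integral>\<^sup>+y. indicator U y \<partial>lborel)" by (rule nn_integral_lborel_translate) measurable
    finally show ?thesis by simp
  qed
  have "emeasure lborel U * emeasure (distr lborel borel f) S = (\<integral>\<^sup>+x. \<integral>\<^sup>+y. indicator U x * indicator S (x + f y) \<partial>lborel \<partial>lborel)"
    by (simp add: nn_integral_cmult e1 nn_integral_multc)
  also have "\<dots> = (\<integral>\<^sup>+y. \<integral>\<^sup>+x. indicator U x * indicator S (x + f y) \<partial>lborel \<partial>lborel)"
    by (rule lborel_pair.Fubini'[symmetric]) measurable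
  (* Substitute x - f y for x. *)
  also have "\<dots> = (\<integral>\<^sup>+y. \<integral>\<^sup>+x. indicator U (x - f y) * indicator S x \<partial>lborel \<partial>lborel)"
  proof (rule nn_integral_cong)
    fix y
    have "(\<integral>\<^sup>+x. indicator U (- f y + x) * indicator S ((- f y + x) + f y) \<partial>lborel) = (\<integral>\<^sup>+x. indicator U x * indicator S (x + f y) \<partial>lborel)"
      by (rule nn_integral_lborel_translate) measurable
    then show "(\<integral>\<^sup>+x. indicator U x * indicator S (x + f y) \<partial>lborel) = (\<integral>\<^sup>+x. indicator U (x - f y) * indicator S x \<partial>lborel)"
      by simp
  qed
  also have "\<dots> = (\<integral>\<^sup>+x. \<integral>\<^sup>+y. indicator U (x - f y) * indicator S x \<partial>lborel \<partial>lborel)"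
    by (rule lborel_pair.Fubini') measurable
  also have "\<dots> = emeasure lborel U * emeasure lborel S"
    by (simp add: nn_integral_multc e2 nn_integral_cmult)
  finally have "emeasure lborel U * emeasure (distr lborel borel f) S = emeasure lborel U * emeasure lborel S" .
  moreover have "emeasure lborel U \<noteq> 0" using emeasure_lborel_ball_finite[of 0 1] open_not_negligible[of "ball (0::'a) 1"]
    by (auto simp: U_def negligible_iff_null_sets null_sets_def)
  moreover have "emeasure lborel U \<noteq> \<infinity>" using emeasure_lborel_ball_finite[of "0::'a" 1] by (simp add: U_def)
  ultimately show "emeasure (distr lborel borel f) S = emeasure lborel S"
    by (simp add: ennreal_mult_cancel_left)
qed simp

lemma lebesgue_distr_preserving:
  fixes f :: "'a::euclidean_space \<Rightarrow> 'a"
  assumes f[measurable]: "f \<in> borel_measurable borel" and d: "distr lborel borel f = lborel"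
  shows "f \<in> lebesgue \<rightarrow>\<^sub>M lebesgue" "distr lebesgue lebesgue f = lebesgue"
proof -
  have dd: "distr lebesgue lborel f = lborel"
  proof -
    have "distr lebesgue lborel f = distr lborel lborel f" by (rule distr_completion) simp
    also have "\<dots> = distr lborel borel f" by (rule distr_cong) auto
    finally show ?thesis using d by simp
  qed
  show "f \<in> lebesgue \<rightarrow>\<^sub>M lebesgue"
    by (simp add: completion.measurable_completion2 dd measurable_completion)
  have "completion (distr lebesgue lborel f) = distr lebesgue lebesgue f"
    by (rule completion.completion_distr_eq) (simp_all add: dd measurable_completion)
  then show "distr lebesgue lebesgue f = lebesgue" by (simp add: dd)
qed

context skew_affine
begin

lemma flow_space_continuous: "continuous_on S (flow t)"
proof -
  have "continuous_on S (\<lambda>x. rot t *v x + flow t 0)"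
    by (intro continuous_intros matrix_vector_mult_linear_continuous_on)
  then show ?thesis by (rule continuous_on_eq) (rule flow_affine[symmetric])
qed

lemma flow_lebesgue: "flow t \<in> lebesgue \<rightarrow>\<^sub>M lebesgue" "distr lebesgue lebesgue (flow t) = lebesgue"
proof -
  have [measurable]: "flow t \<in> borel_measurable borel"
    using flow_space_continuous by (rule borel_measurable_continuous_onI)
  have [measurable]: "(\<lambda>v. flow t v - flow t 0) \<in> borel_measurable borel" by measurable
  have "distr lborel borel (flow t) = distr lborel borel ((+) (flow t 0) \<circ> (\<lambda>v. flow t v - flow t 0))"
    by (simp add: o_def)
  also have "\<dots> = distr (distr lborel borel (\<lambda>v. flow t v - flow t 0)) borel ((+) (flow t 0))"
    by (rule distr_distr[symmetric]) measurable
  also have "\<dots> = lborel" by (simp add: lborel_distr_orthogonal[OF flow_orthogonal] lborel_distr_plus)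
  finally have "distr lborel borel (flow t) = lborel" .
  from lebesgue_distr_preserving[OF _ this]
  show "flow t \<in> lebesgue \<rightarrow>\<^sub>M lebesgue" "distr lebesgue lebesgue (flow t) = lebesgue" by simp_all
qed

lemma rot_transpose_isometry: "(transpose (rot t) *v x) \<bullet> (transpose (rot t) *v y) = x \<bullet> y"
proof -
  have ad: "(transpose (rot t) *v x) \<bullet> y = x \<bullet> (rot t *v y)" for x y
    by (simp add: transpose_matrix_vector dot_lmul_matrix)
  have "(transpose (rot t) ** rot t) *v x = mat 1 *v x" for x
  proof -
    have "((transpose (rot t) ** rot t) *v x) \<bullet> y = x \<bullet> y" for y
      by (simp add: dot_lmul_matrix rot_isometry flip: matrix_vector_mul_assoc)
    then have "(transpose (rot t) ** rot t) *v x = x" by (intro iffD1[OF vector_eq_rdot]) blast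
    then show ?thesis by simp
  qed
  then have "transpose (rot t) ** rot t = mat 1" by (simp add: matrix_eq)
  then have "rot t ** transpose (rot t) = mat 1" by (simp add: matrix_left_right_inverse)
  then have "rot t *v (transpose (rot t) *v y) = y" by (simp only: matrix_vector_mul_assoc matrix_vector_mul_lid)
  then show ?thesis by (simp only: ad)
qed

end

section \<open>Transport along the flow\<close>

locale isometric_flow = bounded_open \<Omega> + skew_affine A c
  for \<Omega> :: "(real^'n::finite) set" and A :: "real^'n^'n" and c :: "real^'n" +
  fixes b :: "real^'n \<Rightarrow> real^'n"
  assumes inv: "x \<in> \<Omega> \<Longrightarrow> flow t x \<in> \<Omega>"
    and b_affine: "x \<in> \<Omega> \<Longrightarrow> b x = A *v x + c"
begin

lemma flow_vimage: "flow t -` \<Omega> = \<Omega>"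
proof
  show "flow t -` \<Omega> \<subseteq> \<Omega>"
  proof
    fix x assume "x \<in> flow t -` \<Omega>"
    then have "flow t x \<in> \<Omega>" by simp
    from inv[OF this, of "-t"] show "x \<in> \<Omega>" by (simp add: flow_inverse)
  qed
qed (use inv in auto)

lemma flow_measurable: "flow t \<in> M \<rightarrow>\<^sub>M M"
proof (rule measurableI)
  fix S assume "S \<in> sets M"
  then have S: "S \<subseteq> \<Omega>" "S \<in> sets lebesgue" using sets_Omega by (simp_all add: sets_restrict_space_iff)
  have "flow t -` S \<in> sets lebesgue" using measurable_sets[OF flow_lebesgue(1) S(2), of t] by simp
  moreover have "flow t -` S \<subseteq> \<Omega>" using S(1) flow_vimage[of t] by blast
  ultimately show "flow t -` S \<inter> space M \<in> sets M" using sets_Omega by (simp add: sets_restrict_space_iff Int_absorb2)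
qed (use inv in simp)

lemma flow_distr: "distr M M (flow t) = M"
proof (rule measure_eqI)
  fix S assume "S \<in> sets (distr M M (flow t))"
  then have SM: "S \<in> sets M" by simp
  then have S: "S \<subseteq> \<Omega>" "S \<in> sets lebesgue" using sets_Omega by (simp_all add: sets_restrict_space_iff)
  have "flow t -` S \<subseteq> \<Omega>" using S(1) flow_vimage[of t] by blast
  then have "emeasure (distr M M (flow t)) S = emeasure lebesgue (flow t -` S)"
    using sets_Omega by (simp add: emeasure_distr[OF flow_measurable SM] Int_absorb2 emeasure_restrict_space)
  also have "\<dots> = emeasure (distr lebesgue lebesgue (flow t)) S"
    using S(2) flow_lebesgue(1) by (simp add: emeasure_distr)
  also have "\<dots> = emeasure M S" using sets_Omega S(1) by (simp add: flow_lebesgue(2) emeasure_restrict_space)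
  finally show "emeasure (distr M M (flow t)) S = emeasure M S" .
qed simp

lemma flow_integral: "f \<in> borel_measurable M \<Longrightarrow> (\<integral>x. f (flow t x) \<partial>M) = (\<integral>x. f x \<partial>M)"
  for f :: "real^'n \<Rightarrow> real"
  using integral_distr[OF flow_measurable, of f t] by (simp add: flow_distr)

text \<open>
  The group of operators \<open>u \<mapsto> u \<circ> flow t\<close> on functions on \<open>\<Omega>\<close>. The flow consists of isometries that
  map \<open>\<Omega>\<close> onto itself, so \<open>T\<close> preserves the inner products of \<open>L\<^sup>2(\<Omega>)\<close> and \<open>H\<^sup>1(\<Omega>)\<close>; its generator is \<open>B\<close>.
\<close>

definition T :: "real \<Rightarrow> (real^'n \<Rightarrow> real) \<Rightarrow> real^'n \<Rightarrow> real" where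
  "T t u = (\<lambda>x. u (flow t x))"

lemma T_inverse: "T t (T (- t) u) = u" "T (- t) (T t u) = u"
  by (simp_all add: T_def flow_inverse)

lemma T_0: "T 0 u = u" by (simp add: T_def flow_0)

lemma T_L2: assumes "u \<in> L2 \<Omega>" shows "T t u \<in> L2 \<Omega>"
proof -
  have "integrable (distr M M (flow t)) (\<lambda>x. (u x)\<^sup>2)" using L2_square[OF assms] by (simp add: flow_distr)
  then have "integrable M (\<lambda>x. (u (flow t x))\<^sup>2)"
    by (rule integrable_distr[OF flow_measurable])
  moreover have "(\<lambda>x. u (flow t x)) \<in> borel_measurable M"
    using measurable_compose[OF flow_measurable L2_measurable[OF assms]] .
  ultimately show ?thesis by (simp add: L2_def T_def)
qed

lemma T_inner:
  assumes "u \<in> L2 \<Omega>" "v \<in> L2 \<Omega>"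
  shows "L2_inner \<Omega> (T t u) (T t v) = L2_inner \<Omega> u v"
  unfolding L2_inner_def T_def
  by (rule flow_integral) (intro borel_measurable_times L2_measurable assms)

lemma T_adjoint:
  assumes "u \<in> L2 \<Omega>" "v \<in> L2 \<Omega>"
  shows "L2_inner \<Omega> (T t u) v = L2_inner \<Omega> u (T (- t) v)"
  using T_inner[OF assms(1) T_L2[OF assms(2)], of t "-t"] by (simp add: T_inverse)

lemma T_nrm: "u \<in> L2 \<Omega> \<Longrightarrow> L2.nrm (T t u) = L2.nrm u"
  by (simp add: L2.nrm_def T_inner)

lemma T_affine: "T t u = (\<lambda>x. u (rot t *v x + flow t 0))"
  by (rule ext) (simp only: T_def flow_affine[symmetric])

lemma T_test: assumes "\<phi> \<in> test_functions \<Omega>" shows "T t \<phi> \<in> test_functions \<Omega>"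
proof -
  obtain K where K: "compact K" "K \<subseteq> \<Omega>" "\<forall>x. x \<notin> K \<longrightarrow> \<phi> x = 0" using test_support[OF assms] by blast
  show ?thesis
  proof (rule test_functionsI)
    show "smooth_on UNIV (T t \<phi>)" unfolding T_affine by (rule smooth_affine[OF test_smooth[OF assms]])
    show "compact (flow (- t) ` K)" by (rule compact_continuous_image[OF flow_space_continuous K(1)])
    show "flow (- t) ` K \<subseteq> \<Omega>" using K(2) inv by auto
    fix x assume x: "x \<notin> flow (- t) ` K"
    have "flow t x \<notin> K"
    proof
      assume "flow t x \<in> K"
      then have "flow (- t) (flow t x) \<in> flow (- t) ` K" by (rule imageI)
      with x show False by (simp add: flow_inverse)
    qed
    then show "T t \<phi> x = 0" using K(3) by (simp add: T_def)
  qed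
qed

lemma T_partial:
  assumes "\<phi> \<in> test_functions \<Omega>"
  shows "partial_deriv j (T t \<phi>) = T t (\<lambda>x. \<Sum>k\<in>UNIV. rot t $ k $ j * partial_deriv k \<phi> x)"
proof
  fix x
  show "partial_deriv j (T t \<phi>) x = T t (\<lambda>x. \<Sum>k\<in>UNIV. rot t $ k $ j * partial_deriv k \<phi> x) x"
    unfolding T_affine by (rule partial_deriv_affine[OF smooth_on_differentiable[OF test_smooth[OF assms]]])
qed

text \<open>
  The chain rule for weak gradients follows from the one for test functions by moving \<open>T t\<close> to the other factor.
\<close>

lemma T_weak_gradient:
  assumes u: "u \<in> L2 \<Omega>" and g: "is_weak_gradient \<Omega> u g"
  shows "is_weak_gradient \<Omega> (T t u) (\<lambda>x. transpose (rot t) *v g (flow t x))"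
proof -
  have gL: "(\<lambda>x. g x $ k) \<in> L2 \<Omega>" for k using g by (simp add: is_weak_gradient_iff)
  have comp: "(\<lambda>x. (transpose (rot t) *v g (flow t x)) $ j) = (\<lambda>x. \<Sum>k\<in>UNIV. rot t $ k $ j * T t (\<lambda>x. g x $ k) x)" for j
    by (simp add: matrix_vector_mult_def transpose_def T_def)
  show ?thesis
    unfolding is_weak_gradient_iff
  proof (intro conjI allI ballI)
    show "(\<lambda>x. (transpose (rot t) *v g (flow t x)) $ j) \<in> L2 \<Omega>" for j
      unfolding comp by (intro L2_sum T_L2 gL)
    fix \<phi> j assume p: "\<phi> \<in> test_functions \<Omega>"
    define \<psi> where "\<psi> = T (- t) \<phi>"
    have q: "\<psi> \<in> test_functions \<Omega>" unfolding \<psi>_def by (rule T_test[OF p])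
    have \<phi>: "\<phi> = T t \<psi>" by (simp add: \<psi>_def T_inverse)
    note dL = test_L2[OF test_partial[OF q]]
    have "L2_inner \<Omega> (T t u) (partial_deriv j \<phi>) = L2_inner \<Omega> u (\<lambda>x. \<Sum>k\<in>UNIV. rot t $ k $ j * partial_deriv k \<psi> x)"
      unfolding \<phi> T_partial[OF q] by (rule T_inner[OF u L2_sum[OF dL]])
    also have "\<dots> = L2_inner \<Omega> (\<lambda>x. \<Sum>k\<in>UNIV. rot t $ k $ j * partial_deriv k \<psi> x) u"
      by (rule L2.sym[OF u L2_sum[OF dL]])
    also have "\<dots> = (\<Sum>k\<in>UNIV. rot t $ k $ j * L2_inner \<Omega> u (partial_deriv k \<psi>))"
      by (simp add: L2_inner_sum[OF dL u] L2.sym[OF dL u])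
    also have "\<dots> = - (\<Sum>k\<in>UNIV. rot t $ k $ j * L2_inner \<Omega> (\<lambda>x. g x $ k) \<psi>)"
      using g q by (simp add: is_weak_gradient_iff sum_negf)
    also have "\<dots> = - (\<Sum>k\<in>UNIV. rot t $ k $ j * L2_inner \<Omega> (T t (\<lambda>x. g x $ k)) \<phi>)"
      unfolding \<phi> by (simp add: T_inner[OF gL test_L2[OF q]])
    also have "\<dots> = - L2_inner \<Omega> (\<lambda>x. (transpose (rot t) *v g (flow t x)) $ j) \<phi>"
      unfolding comp by (simp add: L2_inner_sum[OF T_L2[OF gL] test_L2[OF p]])
    finally show "L2_inner \<Omega> (T t u) (partial_deriv j \<phi>) = - L2_inner \<Omega> (\<lambda>x. (transpose (rot t) *v g (flow t x)) $ j) \<phi>" .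
  qed
qed

lemma T_H1: "u \<in> H1 \<Omega> \<Longrightarrow> T t u \<in> H1 \<Omega>"
  using H1I[OF T_L2[OF H1_L2] T_weak_gradient[OF H1_L2 H1_weak_gradient]] by blast

lemma T_h1:
  assumes u: "u \<in> H1 \<Omega>" and v: "v \<in> H1 \<Omega>"
  shows "h1 (T t u) (T t v) = h1 u v"
proof -
  define G where "G w x = transpose (rot t) *v weak_gradient \<Omega> w (flow t x)" for w x
  have G: "is_weak_gradient \<Omega> (T t w) (G w)" if "w \<in> H1 \<Omega>" for w
    using T_weak_gradient[OF H1_L2[OF that] H1_weak_gradient[OF that], of t] by (simp add: G_def[abs_def])
  have GL: "(\<lambda>x. G w x $ j) \<in> L2 \<Omega>" if "w \<in> H1 \<Omega>" for w j using G[OF that] by (simp add: is_weak_gradient_iff)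
  have ae: "ae_eq \<Omega> (wd (T t w) j) (\<lambda>x. G w x $ j)" if "w \<in> H1 \<Omega>" for w j
    by (rule wd_unique[OF T_L2[OF H1_L2[OF that]] G[OF that]])
  have 1: "L2_inner \<Omega> (wd (T t u) j) (wd (T t v) j) = (\<integral>x. G u x $ j * G v x $ j \<partial>M)" for j
  proof -
    have "L2_inner \<Omega> (wd (T t u) j) (wd (T t v) j) = L2_inner \<Omega> (\<lambda>x. G u x $ j) (wd (T t v) j)"
      by (rule L2_inner_cong_AE[OF wd_L2[OF T_H1[OF u]] GL[OF u] wd_L2[OF T_H1[OF v]] ae[OF u]])
    also have "\<dots> = L2_inner \<Omega> (wd (T t v) j) (\<lambda>x. G u x $ j)" by (rule L2.sym[OF GL[OF u] wd_L2[OF T_H1[OF v]]])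
    also have "\<dots> = L2_inner \<Omega> (\<lambda>x. G v x $ j) (\<lambda>x. G u x $ j)"
      by (rule L2_inner_cong_AE[OF wd_L2[OF T_H1[OF v]] GL[OF v] GL[OF u] ae[OF v]])
    finally show ?thesis by (simp add: L2_inner_def mult.commute)
  qed
  have "(\<Sum>j\<in>UNIV. L2_inner \<Omega> (wd (T t u) j) (wd (T t v) j)) = (\<integral>x. G u x \<bullet> G v x \<partial>M)"
    unfolding 1 inner_vec_def inner_real_def
    by (rule Bochner_Integration.integral_sum[symmetric]) (rule L2_mult_integrable[OF GL[OF u] GL[OF v]])
  also have "\<dots> = (\<integral>x. weak_gradient \<Omega> u (flow t x) \<bullet> weak_gradient \<Omega> v (flow t x) \<partial>M)"
    by (simp only: G_def rot_transpose_isometry)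
  also have "\<dots> = (\<integral>x. weak_gradient \<Omega> u x \<bullet> weak_gradient \<Omega> v x \<partial>M)"
  proof (rule flow_integral)
    have "(\<lambda>x. \<Sum>j\<in>UNIV. wd u j x * wd v j x) \<in> borel_measurable M"
      by (intro borel_measurable_sum borel_measurable_times L2_measurable wd_L2 u v)
    then show "(\<lambda>x. weak_gradient \<Omega> u x \<bullet> weak_gradient \<Omega> v x) \<in> borel_measurable M"
      by (simp add: inner_vec_def wd_def)
  qed
  also have "\<dots> = (\<Sum>j\<in>UNIV. L2_inner \<Omega> (wd u j) (wd v j))" by (rule integral_weak_gradient_inner[OF u v])
  finally show ?thesis unfolding h1_def by (simp add: T_inner[OF H1_L2[OF u] H1_L2[OF v]])
qed

section \<open>The generator of the transport group\<close>

text \<open>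
  \<open>B\<close> in terms of classical derivatives and of the affine field, so that \<open>Bt \<phi>\<close> is defined in the whole
  space and is a test function again.
\<close>

definition Bt :: "(real^'n \<Rightarrow> real) \<Rightarrow> real^'n \<Rightarrow> real" where
  "Bt \<phi> = (\<lambda>x. \<Sum>k\<in>UNIV. (A *v x + c) $ k * partial_deriv k \<phi> x)"

abbreviation "B \<equiv> B_op \<Omega> b"

lemma smooth_coefficient: "smooth_on UNIV (\<lambda>x. (A *v x + c) $ k)"
proof -
  have "smooth_on UNIV (\<lambda>x::real^'n. (\<Sum>l\<in>UNIV. A $ k $ l * x $ l) + c $ k)"
    by (intro smooth_add smooth_sum smooth_mult smooth_const smooth_nth)
  then show ?thesis by (simp add: matrix_vector_mult_def)
qed

lemma Bt_test: "\<phi> \<in> test_functions \<Omega> \<Longrightarrow> Bt \<phi> \<in> test_functions \<Omega>"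
  unfolding Bt_def by (intro test_sum test_mult_left smooth_coefficient test_partial)

lemma coefficient_bounded: "\<exists>K. \<forall>x\<in>\<Omega>. \<bar>(A *v x + c) $ k\<bar> \<le> K"
proof -
  have "continuous_on (closure \<Omega>) (\<lambda>x. (A *v x + c) $ k)"
    by (rule continuous_on_subset[OF smooth_on_continuous[OF smooth_coefficient] subset_UNIV])
  then obtain K where "\<And>x. x \<in> closure \<Omega> \<Longrightarrow> norm ((A *v x + c) $ k) \<le> K"
    using continuous_on_compact_bounded[OF compact_closure_Omega] by blast
  then show ?thesis using closure_subset[of \<Omega>] by (intro exI[of _ K]) auto
qed

lemma coefficient_measurable: "(\<lambda>x. (A *v x + c) $ k) \<in> borel_measurable M"
  by (rule measurable_continuous[OF continuous_on_subset[OF smooth_on_continuous[OF smooth_coefficient]]]) simp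

lemma coefficient_L2: assumes "f \<in> L2 \<Omega>" shows "(\<lambda>x. (A *v x + c) $ k * f x) \<in> L2 \<Omega>"
proof -
  obtain K where "\<forall>x\<in>\<Omega>. \<bar>(A *v x + c) $ k\<bar> \<le> K" using coefficient_bounded by blast
  then show ?thesis using L2_bounded_mult[OF assms coefficient_measurable, of k K] by simp
qed

lemma B_on: "x \<in> \<Omega> \<Longrightarrow> B u x = (\<Sum>k\<in>UNIV. 1 * ((A *v x + c) $ k * wd u k x))"
  by (simp add: B_op_def b_affine inner_vec_def wd_def)

lemma B_L2: assumes "u \<in> H1 \<Omega>" shows "B u \<in> L2 \<Omega>"
proof (rule L2_cong_on)
  show "(\<lambda>x. \<Sum>k\<in>UNIV. 1 * ((A *v x + c) $ k * wd u k x)) \<in> L2 \<Omega>"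
    by (intro L2_sum coefficient_L2 wd_L2 assms)
qed (simp only: B_on)

lemma B_inner:
  assumes "u \<in> H1 \<Omega>" "v \<in> L2 \<Omega>"
  shows "L2_inner \<Omega> (B u) v = (\<Sum>k\<in>UNIV. L2_inner \<Omega> (\<lambda>x. (A *v x + c) $ k * wd u k x) v)"
proof -
  have "L2_inner \<Omega> (B u) v = L2_inner \<Omega> (\<lambda>x. \<Sum>k\<in>UNIV. 1 * ((A *v x + c) $ k * wd u k x)) v"
    unfolding L2_inner_def by (rule Bochner_Integration.integral_cong[OF refl]) (simp add: B_on)
  also have "\<dots> = (\<Sum>k\<in>UNIV. 1 * L2_inner \<Omega> (\<lambda>x. (A *v x + c) $ k * wd u k x) v)"
    by (intro L2_inner_sum coefficient_L2 wd_L2 assms)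
  finally show ?thesis by simp
qed

lemma diagonal_zero: "A $ k $ k = 0"
  using skew[of "axis k 1"] by (simp add: inner_axis matrix_vector_mult_basis column_def)

lemma coefficient_partial:
  assumes "\<phi> \<in> test_functions \<Omega>"
  shows "partial_deriv k (\<lambda>x. (A *v x + c) $ k * \<phi> x) x = (A *v x + c) $ k * partial_deriv k \<phi> x"
proof -
  have "((\<lambda>x. (A *v x + c) $ k) has_derivative (\<lambda>h. (A *v h) $ k)) (at x)"
    using has_derivative_compose[OF has_derivative_affine bounded_linear_imp_has_derivative[OF bounded_linear_vec_nth]] .
  from partial_deriv_eq[OF this, of k] have "partial_deriv k (\<lambda>x. (A *v x + c) $ k) x = 0"
    using diagonal_zero[of k] by (simp add: matrix_vector_mult_basis column_def)
  then show ?thesis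
    using partial_deriv_mult[OF smooth_on_differentiable[OF smooth_coefficient] smooth_on_differentiable[OF test_smooth[OF assms]], of k k x]
    by simp
qed

text \<open>
  No term without derivatives appears because the divergence of the affine field is the trace of
  a skew matrix.
\<close>

lemma B_parts:
  assumes u: "u \<in> H1 \<Omega>" and p: "\<phi> \<in> test_functions \<Omega>"
  shows "L2_inner \<Omega> (B u) \<phi> = - L2_inner \<Omega> u (Bt \<phi>)"
proof -
  have t: "(\<lambda>x. (A *v x + c) $ k * \<phi> x) \<in> test_functions \<Omega>" for k by (rule test_mult_left[OF smooth_coefficient p])
  have dL: "(\<lambda>x. (A *v x + c) $ k * partial_deriv k \<phi> x) \<in> L2 \<Omega>" for k by (rule coefficient_L2[OF test_L2[OF test_partial[OF p]]])
  have "L2_inner \<Omega> (B u) \<phi> = (\<Sum>k\<in>UNIV. L2_inner \<Omega> (wd u k) (\<lambda>x. (A *v x + c) $ k * \<phi> x))"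
    unfolding B_inner[OF u test_L2[OF p]] by (simp add: L2_inner_def mult_ac)
  also have "\<dots> = (\<Sum>k\<in>UNIV. - L2_inner \<Omega> u (\<lambda>x. (A *v x + c) $ k * partial_deriv k \<phi> x))"
  proof (rule sum.cong[OF refl])
    fix k
    have "partial_deriv k (\<lambda>x. (A *v x + c) $ k * \<phi> x) = (\<lambda>x. (A *v x + c) $ k * partial_deriv k \<phi> x)"
      by (rule ext) (rule coefficient_partial[OF p])
    then show "L2_inner \<Omega> (wd u k) (\<lambda>x. (A *v x + c) $ k * \<phi> x) = - L2_inner \<Omega> u (\<lambda>x. (A *v x + c) $ k * partial_deriv k \<phi> x)"
      using wd_parts[OF u t, of k k] by simp
  qed
  also have "\<dots> = - (\<Sum>k\<in>UNIV. 1 * L2_inner \<Omega> (\<lambda>x. (A *v x + c) $ k * partial_deriv k \<phi> x) u)"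
    by (simp only: sum_negf mult_1 L2.sym[OF H1_L2[OF u] dL])
  also have "\<dots> = - L2_inner \<Omega> (\<lambda>x. \<Sum>k\<in>UNIV. 1 * ((A *v x + c) $ k * partial_deriv k \<phi> x)) u"
    by (simp only: L2_inner_sum[OF dL H1_L2[OF u]])
  also have "\<dots> = - L2_inner \<Omega> u (Bt \<phi>)" by (simp add: Bt_def L2_inner_def mult.commute)
  finally show ?thesis .
qed

lemma Bt_flow_DERIV:
  assumes "\<phi> \<in> test_functions \<Omega>"
  shows "((\<lambda>t. \<phi> (flow t x)) has_real_derivative Bt \<phi> (flow t x)) (at t)"
proof -
  have "((\<lambda>t. \<phi> (flow t x)) has_derivative (\<lambda>s. gradient \<phi> (flow t x) \<bullet> (s *\<^sub>R (A *v flow t x + c)))) (at t)"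
    using diff_chain_at[OF flow_derivative gradient_has_derivative[OF smooth_on_differentiable[OF test_smooth[OF assms]]]]
    by (simp add: o_def)
  moreover have "gradient \<phi> (flow t x) \<bullet> (A *v flow t x + c) = Bt \<phi> (flow t x)"
    by (simp add: Bt_def inner_vec_def gradient_def mult.commute)
  ultimately show ?thesis by (simp add: has_field_derivative_def mult_commute_abs)
qed

lemma T_test_DERIV:
  assumes p: "\<phi> \<in> test_functions \<Omega>" and v: "v \<in> L2 \<Omega>"
  shows "((\<lambda>t. L2_inner \<Omega> (T t \<phi>) v) has_real_derivative L2_inner \<Omega> (T t (Bt \<phi>)) v) (at t)"
  unfolding DERIV_def tendsto_at_iff_sequentially comp_def
proof (intro allI impI)
  fix h :: "nat \<Rightarrow> real" assume h: "\<forall>i. h i \<in> UNIV - {0}" "h \<longlonglongrightarrow> 0"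
  obtain K where K: "\<And>x. \<bar>Bt \<phi> x\<bar> \<le> K" using test_bounded[OF Bt_test[OF p]] by blast
  note one = L2_one
  have vi: "integrable M (\<lambda>x. K * \<bar>v x\<bar>)" using L2_mult_integrable[OF v one] by simp
  have pm: "T s \<phi> \<in> L2 \<Omega>" for s by (rule T_L2[OF test_L2[OF p]])
  have q: "(L2_inner \<Omega> (T (t + h i) \<phi>) v - L2_inner \<Omega> (T t \<phi>) v) / h i = (\<integral>x. (T (t + h i) \<phi> x - T t \<phi> x) / h i * v x \<partial>M)" for i
    using L2.lin_diff[OF pm pm v, of "t + h i" t] by (simp add: L2_inner_def)
  show "(\<lambda>i. (L2_inner \<Omega> (T (t + h i) \<phi>) v - L2_inner \<Omega> (T t \<phi>) v) / h i) \<longlonglongrightarrow> L2_inner \<Omega> (T t (Bt \<phi>)) v"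
    unfolding q unfolding L2_inner_def
  proof (rule integral_dominated_convergence[where w="\<lambda>x. K * \<bar>v x\<bar>"])
    show "(\<lambda>x. T t (Bt \<phi>) x * v x) \<in> borel_measurable M"
      by (intro borel_measurable_times L2_measurable T_L2 test_L2 Bt_test p v)
    show "(\<lambda>x. (T (t + h i) \<phi> x - T t \<phi> x) / h i * v x) \<in> borel_measurable M" for i
      by (intro borel_measurable_times borel_measurable_divide borel_measurable_diff borel_measurable_const L2_measurable pm v)
    show "AE x in M. (\<lambda>i. (T (t + h i) \<phi> x - T t \<phi> x) / h i * v x) \<longlonglongrightarrow> T t (Bt \<phi>) x * v x"
    proof (rule AE_I2)
      fix x
      have "((\<lambda>s. (\<phi> (flow (t + s) x) - \<phi> (flow t x)) / s) \<longlongrightarrow> Bt \<phi> (flow t x)) (at 0)"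
        using Bt_flow_DERIV[OF p, of x t] by (simp add: DERIV_def)
      then have "(\<lambda>i. (\<phi> (flow (t + h i) x) - \<phi> (flow t x)) / h i) \<longlonglongrightarrow> Bt \<phi> (flow t x)"
        using h unfolding tendsto_at_iff_sequentially comp_def by blast
      then show "(\<lambda>i. (T (t + h i) \<phi> x - T t \<phi> x) / h i * v x) \<longlonglongrightarrow> T t (Bt \<phi>) x * v x"
        unfolding T_def by (rule tendsto_mult_right)
    qed
    show "AE x in M. norm ((T (t + h i) \<phi> x - T t \<phi> x) / h i * v x) \<le> K * \<bar>v x\<bar>" for i
    proof (rule AE_I2)
      fix x
      have "norm (\<phi> (flow (t + h i) x) - \<phi> (flow t x)) \<le> K * norm (t + h i - t)"
        by (rule field_differentiable_bound[of UNIV "\<lambda>s. \<phi> (flow s x)" "\<lambda>s. Bt \<phi> (flow s x)"])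
          (use Bt_flow_DERIV[OF p] K in auto)
      moreover have "\<bar>h i\<bar> > 0" using h(1) by auto
      ultimately have "\<bar>(\<phi> (flow (t + h i) x) - \<phi> (flow t x)) / h i\<bar> \<le> K" by (simp add: pos_divide_le_eq)
      then show "norm ((T (t + h i) \<phi> x - T t \<phi> x) / h i * v x) \<le> K * \<bar>v x\<bar>"
        unfolding T_def real_norm_def abs_mult by (rule mult_right_mono) simp
    qed
  qed (rule vi)
qed

lemma T_Bt: assumes "\<phi> \<in> test_functions \<Omega>" shows "Bt (T t \<phi>) = T t (Bt \<phi>)"
proof
  fix x
  have "((\<lambda>s. \<phi> (flow t (flow s x))) has_real_derivative Bt (T t \<phi>) x) (at 0)"
    using Bt_flow_DERIV[OF T_test[OF assms, of t], of x 0] by (simp add: T_def flow_0)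
  moreover have "((\<lambda>s. \<phi> (flow t (flow s x))) has_real_derivative Bt \<phi> (flow t x)) (at 0)"
  proof -
    have "((\<lambda>s. \<phi> (flow (s + t) x)) has_real_derivative Bt \<phi> (flow (0 + t) x)) (at 0)"
      using Bt_flow_DERIV[OF assms, of x "0 + t"] unfolding DERIV_shift .
    moreover have "flow (s + t) x = flow t (flow s x)" for s using flow_add[of t s x] by (simp add: add.commute)
    ultimately show ?thesis by (simp add: flow_0)
  qed
  ultimately show "Bt (T t \<phi>) x = T t (Bt \<phi>) x" unfolding T_def by (rule DERIV_unique)
qed

lemma T_H1_test_DERIV:
  assumes u: "u \<in> H1 \<Omega>" and p: "\<phi> \<in> test_functions \<Omega>"
  shows "((\<lambda>t. L2_inner \<Omega> (T t u) \<phi>) has_real_derivative L2_inner \<Omega> (T t (B u)) \<phi>) (at t)"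
proof -
  note uL = H1_L2[OF u] and pL = test_L2[OF p]
  have e: "L2_inner \<Omega> (T t u) \<phi> = L2_inner \<Omega> (T (- t) \<phi>) u" for t
    using T_adjoint[OF uL pL] L2.sym[OF uL T_L2[OF pL]] by simp
  have "((\<lambda>t. L2_inner \<Omega> (T (- t) \<phi>) u) has_real_derivative L2_inner \<Omega> (T (- t) (Bt \<phi>)) u * (- 1)) (at t)"
    by (rule DERIV_chain2[OF T_test_DERIV[OF p uL]]) (auto intro!: derivative_eq_intros)
  moreover have "L2_inner \<Omega> (T (- t) (Bt \<phi>)) u * (- 1) = L2_inner \<Omega> (T t (B u)) \<phi>"
  proof -
    have "L2_inner \<Omega> (T t (B u)) \<phi> = L2_inner \<Omega> (B u) (T (- t) \<phi>)" by (rule T_adjoint[OF B_L2[OF u] pL])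
    also have "\<dots> = - L2_inner \<Omega> u (Bt (T (- t) \<phi>))" by (rule B_parts[OF u T_test[OF p]])
    finally show ?thesis unfolding T_Bt[OF p] using L2.sym[OF uL T_L2[OF test_L2[OF Bt_test[OF p]]]] by simp
  qed
  ultimately show ?thesis by (simp add: e)
qed

text \<open>
  For a test function \<open>v\<close> this is the previous lemma. For \<open>v\<close> in \<open>L\<^sup>2(\<Omega>)\<close> approximate by test functions: the \<open>T t\<close>
  are isometries, so the derivatives converge uniformly in \<open>t\<close>.
\<close>

lemma T_H1_DERIV:
  assumes u: "u \<in> H1 \<Omega>" and v: "v \<in> L2 \<Omega>"
  shows "((\<lambda>t. L2_inner \<Omega> (T t u) v) has_real_derivative L2_inner \<Omega> (T t (B u)) v) (at t)"
proof -
  note uL = H1_L2[OF u] and BuL = B_L2[OF u]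
  have "\<exists>\<phi>. \<phi> \<in> test_functions \<Omega> \<and> L2.nrm (\<lambda>x. v x - \<phi> x) < inverse (real (Suc n))" for n
    using test_dense[OF v, of "inverse (real (Suc n))"] by auto
  then obtain \<phi> where p: "\<And>n. \<phi> n \<in> test_functions \<Omega>" and pn: "\<And>n. L2.nrm (\<lambda>x. v x - \<phi> n x) < inverse (real (Suc n))" by metis
  note pL = test_L2[OF p]
  have close: "\<bar>L2_inner \<Omega> (T t w) (\<phi> n) - L2_inner \<Omega> (T t w) v\<bar> \<le> L2.nrm w * inverse (real (Suc n))" if w: "w \<in> L2 \<Omega>" for w t n
  proof -
    have "L2_inner \<Omega> (T t w) v - L2_inner \<Omega> (T t w) (\<phi> n) = L2_inner \<Omega> (T t w) (\<lambda>x. v x - \<phi> n x)"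
      by (rule L2.lin2_diff[OF v pL T_L2[OF w], symmetric])
    then have "\<bar>L2_inner \<Omega> (T t w) (\<phi> n) - L2_inner \<Omega> (T t w) v\<bar> \<le> L2.nrm (T t w) * L2.nrm (\<lambda>x. v x - \<phi> n x)"
      using L2.cauchy_schwarz[OF T_L2[OF w, of t] L2.diff[OF v pL[of n]]] by linarith
    also have "\<dots> \<le> L2.nrm w * inverse (real (Suc n))"
      unfolding T_nrm[OF w] using pn[of n] L2.nrm_ge0[OF w] by (intro mult_left_mono) auto
    finally show ?thesis .
  qed
  have lim: "(\<lambda>n. L2_inner \<Omega> (T t w) (\<phi> n)) \<longlonglongrightarrow> L2_inner \<Omega> (T t w) v" if w: "w \<in> L2 \<Omega>" for w t
  proof (rule LIM_zero_cancel, rule Lim_null_comparison)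
    show "\<forall>\<^sub>F n in sequentially. norm (L2_inner \<Omega> (T t w) (\<phi> n) - L2_inner \<Omega> (T t w) v) \<le> L2.nrm w * inverse (real (Suc n))"
      using close[OF w] by simp
    show "(\<lambda>n. L2.nrm w * inverse (real (Suc n))) \<longlonglongrightarrow> 0"
      using tendsto_mult_right_zero[OF LIMSEQ_inverse_real_of_nat] .
  qed
  have "\<exists>g. \<forall>t\<in>UNIV. (\<lambda>n. L2_inner \<Omega> (T t u) (\<phi> n)) \<longlonglongrightarrow> g t \<and> (g has_derivative (\<lambda>h. L2_inner \<Omega> (T t (B u)) v * h)) (at t within UNIV)"
  proof (rule has_derivative_sequence[of UNIV "\<lambda>n t. L2_inner \<Omega> (T t u) (\<phi> n)" "\<lambda>n t h. L2_inner \<Omega> (T t (B u)) (\<phi> n) * h"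
      "\<lambda>t h. L2_inner \<Omega> (T t (B u)) v * h" 0 "L2_inner \<Omega> (T 0 u) v"])
    show "((\<lambda>t. L2_inner \<Omega> (T t u) (\<phi> n)) has_derivative (\<lambda>h. L2_inner \<Omega> (T t (B u)) (\<phi> n) * h)) (at t within UNIV)" for n t
      using T_H1_test_DERIV[OF u p] by (simp add: has_field_derivative_def)
    show "(\<lambda>n. L2_inner \<Omega> (T 0 u) (\<phi> n)) \<longlonglongrightarrow> L2_inner \<Omega> (T 0 u) v" by (rule lim[OF uL])
    fix e :: real assume "e > 0"
    have "(\<lambda>n. L2.nrm (B u) * inverse (real (Suc n))) \<longlonglongrightarrow> 0"
      using tendsto_mult_right_zero[OF LIMSEQ_inverse_real_of_nat] .
    then have "\<forall>\<^sub>F n in sequentially. L2.nrm (B u) * inverse (real (Suc n)) < e" using \<open>e > 0\<close> by (rule order_tendstoD(2))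
    then show "\<forall>\<^sub>F n in sequentially. \<forall>t\<in>UNIV. \<forall>h. norm (L2_inner \<Omega> (T t (B u)) (\<phi> n) * h - L2_inner \<Omega> (T t (B u)) v * h) \<le> e * norm h"
    proof eventually_elim
      case (elim n)
      show ?case
      proof (intro ballI allI)
        fix t h
        have "\<bar>L2_inner \<Omega> (T t (B u)) (\<phi> n) - L2_inner \<Omega> (T t (B u)) v\<bar> \<le> e" using close[OF BuL, of t n] elim by linarith
        then show "norm (L2_inner \<Omega> (T t (B u)) (\<phi> n) * h - L2_inner \<Omega> (T t (B u)) v * h) \<le> e * norm h"
          unfolding left_diff_distrib[symmetric] real_norm_def abs_mult by (rule mult_right_mono) simp
      qed
    qed
  qed simp_all
  then obtain g where g: "\<And>t. (\<lambda>n. L2_inner \<Omega> (T t u) (\<phi> n)) \<longlonglongrightarrow> g t"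
    "\<And>t. (g has_derivative (\<lambda>h. L2_inner \<Omega> (T t (B u)) v * h)) (at t)" by auto
  have "g = (\<lambda>t. L2_inner \<Omega> (T t u) v)" using LIMSEQ_unique[OF g(1) lim[OF uL]] by auto
  then show ?thesis using g(2) by (simp add: has_field_derivative_def)
qed

text \<open>
  Differentiate \<open>\<langle>T t u, v\<rangle> = \<langle>u, T (- t) v\<rangle>\<close> at \<open>t = 0\<close>.
\<close>

theorem B_skew_adjoint:
  assumes u: "u \<in> H1 \<Omega>" and v: "v \<in> H1 \<Omega>"
  shows "L2_inner \<Omega> (B u) v = - L2_inner \<Omega> u (B v)"
proof -
  note uL = H1_L2[OF u] and vL = H1_L2[OF v]
  have "((\<lambda>t. L2_inner \<Omega> (T t u) v) has_real_derivative L2_inner \<Omega> (B u) v) (at 0)"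
    using T_H1_DERIV[OF u vL, of 0] by (simp add: T_0)
  moreover have "L2_inner \<Omega> (T t u) v = L2_inner \<Omega> (T (- t) v) u" for t
    using T_adjoint[OF uL vL] L2.sym[OF uL T_L2[OF vL]] by simp
  moreover have "((\<lambda>t. L2_inner \<Omega> (T (- t) v) u) has_real_derivative L2_inner \<Omega> (T (- 0) (B v)) u * (- 1)) (at 0)"
    by (rule DERIV_chain2[OF T_H1_DERIV[OF v uL]]) (auto intro!: derivative_eq_intros)
  ultimately have "L2_inner \<Omega> (B u) v = L2_inner \<Omega> (T (- 0) (B v)) u * (- 1)" by (simp only: DERIV_unique)
  then show ?thesis using L2.sym[OF uL B_L2[OF v]] by (simp add: T_0)
qed

text \<open>
  With \<open>R = (1 - \<Delta>)\<^sup>-\<^sup>1\<close> the claim is \<open>B R f = R B f\<close>. Since \<open>T t\<close> preserves the inner product of \<open>H\<^sup>1(\<Omega>)\<close>, it commutes with \<open>R\<close>,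
  that is, \<open>\<langle>T t R f, \<phi>\<rangle> = \<langle>T t f, R \<phi>\<rangle>\<close>. Differentiating at \<open>t = 0\<close> gives
  \<open>\<langle>B R f, \<phi>\<rangle> = \<langle>B f, R \<phi>\<rangle> = \<langle>R B f, \<phi>\<rangle>\<close>. All differentiated functions lie in \<open>H\<^sup>1(\<Omega>)\<close>, so it
  is a conclusion that \<open>B R f\<close> is more regular than \<open>L\<^sup>2(\<Omega>)\<close>.
\<close>

theorem B_commutes_with_resolvent:
  assumes f: "f \<in> test_functions \<Omega>"
    and u: "u \<in> H1 \<Omega>" "\<And>v. v \<in> H1 \<Omega> \<Longrightarrow> h1 u v = L2_inner \<Omega> f v"
    and w: "w \<in> H1 \<Omega>" "\<And>v. v \<in> H1 \<Omega> \<Longrightarrow> h1 w v = L2_inner \<Omega> (B f) v"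
  shows "ae_eq \<Omega> (B u) w"
proof (rule ae_eq_if_test_eq[OF B_L2[OF u(1)] H1_L2[OF w(1)]])
  fix \<phi> assume p: "\<phi> \<in> test_functions \<Omega>"
  note pL = test_L2[OF p] and fL = test_L2[OF f] and uL = H1_L2[OF u(1)]
  obtain q where q: "q \<in> H1 \<Omega>" "\<And>v. v \<in> H1 \<Omega> \<Longrightarrow> h1 q v = L2_inner \<Omega> \<phi> v" using resolvent_exists[OF pL] by blast
  note qL = H1_L2[OF q(1)]
  have e: "L2_inner \<Omega> (T t u) \<phi> = L2_inner \<Omega> (T t f) q" for t
  proof -
    have "L2_inner \<Omega> (T t u) \<phi> = L2_inner \<Omega> \<phi> (T t u)" by (rule L2.sym[OF T_L2[OF uL] pL])
    also have "\<dots> = h1 q (T t u)" by (rule q(2)[symmetric, OF T_H1[OF u(1)]])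
    also have "\<dots> = h1 (T t (T (- t) q)) (T t u)" by (simp add: T_inverse)
    also have "\<dots> = h1 (T (- t) q) u" by (rule T_h1[OF T_H1[OF q(1)] u(1)])
    also have "\<dots> = h1 u (T (- t) q)" by (rule H1.sym[OF T_H1[OF q(1)] u(1)])
    also have "\<dots> = L2_inner \<Omega> f (T (- t) q)" by (rule u(2)[OF T_H1[OF q(1)]])
    also have "\<dots> = L2_inner \<Omega> (T t f) q" by (rule T_adjoint[OF fL qL, symmetric])
    finally show ?thesis .
  qed
  have "((\<lambda>t. L2_inner \<Omega> (T t u) \<phi>) has_real_derivative L2_inner \<Omega> (B u) \<phi>) (at 0)"
    using T_H1_DERIV[OF u(1) pL, of 0] by (simp add: T_0)
  moreover have "((\<lambda>t. L2_inner \<Omega> (T t f) q) has_real_derivative L2_inner \<Omega> (B f) q) (at 0)"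
    using T_H1_DERIV[OF test_H1[OF f] qL, of 0] by (simp add: T_0)
  ultimately have "L2_inner \<Omega> (B u) \<phi> = L2_inner \<Omega> (B f) q" unfolding e by (rule DERIV_unique)
  also have "\<dots> = h1 w q" by (rule w(2)[OF q(1), symmetric])
  also have "\<dots> = h1 q w" by (rule H1.sym[OF w(1) q(1)])
  also have "\<dots> = L2_inner \<Omega> \<phi> w" by (rule q(2)[OF w(1)])
  also have "\<dots> = L2_inner \<Omega> w \<phi>" by (rule L2.sym[OF pL H1_L2[OF w(1)]])
  finally show "L2_inner \<Omega> (B u) \<phi> = L2_inner \<Omega> w \<phi>" .
qed

section \<open>A core on which the operators commute\<close>

lemma B_comb:
  assumes "u \<in> H1 \<Omega>" "v \<in> H1 \<Omega>"
  shows "ae_eq \<Omega> (B (\<lambda>x. u x + k * v x)) (\<lambda>x. B u x + k * B v x)"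
proof -
  have "AE x in M. \<forall>j\<in>UNIV. wd (\<lambda>x. u x + k * v x) j x = wd u j x + k * wd v j x"
    using wd_comb[OF assms, of k] by (subst AE_finite_all) (auto simp: ae_eq_def)
  moreover have "AE x in M. x \<in> \<Omega>" by (rule AE_I2) simp
  ultimately show ?thesis unfolding ae_eq_def
    by eventually_elim (simp add: B_on sum.distrib[symmetric] sum_distrib_left algebra_simps)
qed

lemma B_cong:
  assumes "u \<in> L2 \<Omega>" "v \<in> L2 \<Omega>" "ae_eq \<Omega> u v"
  shows "B u = B v"
  unfolding B_op_def weak_gradient_def weak_gradient_cong[OF assms] ..

text \<open>
  The largest set on which both sides of the commutation relation make sense and agree.
\<close>

definition core :: "(real^'n \<Rightarrow> real) set" where
  "core = {u \<in> neumann_dom \<Omega>. weak_laplacian \<Omega> u \<in> H1 \<Omega> \<and> B u \<in> neumann_dom \<Omega> \<and>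
     ae_eq \<Omega> (B (weak_laplacian \<Omega> u)) (weak_laplacian \<Omega> (B u))}"

lemma core_comb:
  assumes u: "u \<in> core" and v: "v \<in> core"
  shows "(\<lambda>x. u x + k * v x) \<in> core"
proof -
  let ?z = "\<lambda>x. u x + k * v x" and ?L = "weak_laplacian \<Omega>"
  have un: "u \<in> neumann_dom \<Omega>" "?L u \<in> H1 \<Omega>" "B u \<in> neumann_dom \<Omega>" "ae_eq \<Omega> (B (?L u)) (?L (B u))"
    and vn: "v \<in> neumann_dom \<Omega>" "?L v \<in> H1 \<Omega>" "B v \<in> neumann_dom \<Omega>" "ae_eq \<Omega> (B (?L v)) (?L (B v))"
    using u v by (simp_all add: core_def)
  note z = neumann_comb[OF un(1) vn(1), of k]
  have LzL: "?L ?z \<in> L2 \<Omega>" by (rule neumann_domD(2)[OF z(1)])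
  have sH: "(\<lambda>x. ?L u x + k * ?L v x) \<in> H1 \<Omega>" by (rule H1_comb[OF un(2) vn(2)])
  have LzH: "?L ?z \<in> H1 \<Omega>" by (rule H1_cong[OF sH LzL ae_eq_sym[OF z(2)]])
  have BzL: "B ?z \<in> L2 \<Omega>" by (rule B_L2[OF neumann_domD(1)[OF z(1)]])
  have Bz: "ae_eq \<Omega> (B ?z) (\<lambda>x. B u x + k * B v x)" by (rule B_comb[OF neumann_domD(1)[OF un(1)] neumann_domD(1)[OF vn(1)]])
  note s = neumann_comb[OF un(3) vn(3), of k]
  note n = neumann_cong[OF s(1) BzL ae_eq_sym[OF Bz]]
  have Beq: "B (?L ?z) = B (\<lambda>x. ?L u x + k * ?L v x)" by (rule B_cong[OF LzL H1_L2[OF sH] z(2)])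
  have "ae_eq \<Omega> (B (\<lambda>x. ?L u x + k * ?L v x)) (\<lambda>x. B (?L u) x + k * B (?L v) x)" by (rule B_comb[OF un(2) vn(2)])
  then have "ae_eq \<Omega> (B (?L ?z)) (?L (B ?z))"
    using un(4) vn(4) s(2) n(2) unfolding ae_eq_def Beq by eventually_elim simp
  with z(1) LzH n(1) show ?thesis by (simp add: core_def)
qed

lemma core_cong:
  assumes u: "u \<in> core" and v: "v \<in> L2 \<Omega>" and e: "ae_eq \<Omega> u v"
  shows "v \<in> core"
proof -
  let ?L = "weak_laplacian \<Omega>"
  have un: "u \<in> neumann_dom \<Omega>" "?L u \<in> H1 \<Omega>" "B u \<in> neumann_dom \<Omega>" "ae_eq \<Omega> (B (?L u)) (?L (B u))"
    using u by (simp_all add: core_def)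
  note n = neumann_cong[OF un(1) v e]
  have LvL: "?L v \<in> L2 \<Omega>" by (rule neumann_domD(2)[OF n(1)])
  have "B u = B v" by (rule B_cong[OF H1_L2[OF neumann_domD(1)[OF un(1)]] v e])
  moreover have "B (?L u) = B (?L v)" by (rule B_cong[OF H1_L2[OF un(2)] LvL n(2)])
  moreover have "?L v \<in> H1 \<Omega>" by (rule H1_cong[OF un(2) LvL n(2)])
  ultimately show ?thesis using n(1) un(3,4) by (simp add: core_def)
qed

text \<open>
  For \<open>u = R f\<close> one has \<open>\<Delta>u = u - f\<close> and \<open>B u = R B f\<close>, whence
  \<open>\<Delta>(B u) = B u - B f = B(\<Delta>u)\<close>.
\<close>

lemma resolvent_in_core:
  assumes f: "f \<in> test_functions \<Omega>" and u: "u \<in> H1 \<Omega>" "\<And>v. v \<in> H1 \<Omega> \<Longrightarrow> h1 u v = L2_inner \<Omega> f v"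
  shows "u \<in> core"
proof -
  let ?L = "weak_laplacian \<Omega>"
  note fL = test_L2[OF f] and fH = test_H1[OF f]
  note n = neumann_resolvent[OF u(1) fL u(2)]
  have LuL: "?L u \<in> L2 \<Omega>" by (rule neumann_domD(2)[OF n(1)])
  have dH: "(\<lambda>x. u x - f x) \<in> H1 \<Omega>" by (rule H1.diff[OF u(1) fH])
  have LuH: "?L u \<in> H1 \<Omega>" by (rule H1_cong[OF dH LuL ae_eq_sym[OF n(2)]])
  have BfL: "B f \<in> L2 \<Omega>" by (rule B_L2[OF fH])
  obtain w where w: "w \<in> H1 \<Omega>" "\<And>v. v \<in> H1 \<Omega> \<Longrightarrow> h1 w v = L2_inner \<Omega> (B f) v" using resolvent_exists[OF BfL] by blast
  note nw = neumann_resolvent[OF w(1) BfL w(2)]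
  have Bu: "ae_eq \<Omega> (B u) w" by (rule B_commutes_with_resolvent[OF f u w])
  note nB = neumann_cong[OF nw(1) B_L2[OF u(1)] ae_eq_sym[OF Bu]]
  have Beq: "B (?L u) = B (\<lambda>x. u x - f x)" by (rule B_cong[OF LuL H1_L2[OF dH] n(2)])
  have "ae_eq \<Omega> (?L w) (\<lambda>x. w x - B f x)" by (rule nw(2))
  moreover have "ae_eq \<Omega> (?L w) (?L (B u))" by (rule nB(2))
  moreover have "ae_eq \<Omega> (B (\<lambda>x. u x - f x)) (\<lambda>x. B u x - B f x)" using B_comb[OF u(1) fH, of "-1"] by simp
  ultimately have "ae_eq \<Omega> (B (?L u)) (?L (B u))"
    using Bu unfolding ae_eq_def Beq by eventually_elim simp
  with n(1) LuH nB(1) show ?thesis by (simp add: core_def)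
qed

text \<open>
  The graph norm of \<open>R d\<close> is at most \<open>3\<close> times the norm of \<open>d\<close> in \<open>L\<^sup>2(\<Omega>)\<close>. Approximating \<open>u - \<Delta>u\<close> by a test
  function \<open>\<phi>\<close> therefore approximates \<open>u = R (u - \<Delta>u)\<close> by \<open>R \<phi>\<close>.
\<close>

lemma core_dense:
  assumes u: "u \<in> neumann_dom \<Omega>" and e: "e > 0"
  shows "\<exists>v\<in>core. neumann_graph_norm \<Omega> (\<lambda>x. u x - v x) < e"
proof -
  let ?L = "weak_laplacian \<Omega>"
  define f where "f x = u x - ?L u x" for x
  note uH = neumann_domD(1)[OF u]
  have fL: "f \<in> L2 \<Omega>" unfolding f_def[abs_def] by (rule L2.diff[OF H1_L2[OF uH] neumann_domD(2)[OF u]])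
  have "e / 3 > 0" using e by simp
  then obtain \<phi> where p: "\<phi> \<in> test_functions \<Omega>" and pn: "L2.nrm (\<lambda>x. f x - \<phi> x) < e / 3" using test_dense[OF fL] by blast
  note pL = test_L2[OF p]
  obtain v where v: "v \<in> H1 \<Omega>" "\<And>z. z \<in> H1 \<Omega> \<Longrightarrow> h1 v z = L2_inner \<Omega> \<phi> z" using resolvent_exists[OF pL] by blast
  let ?z = "\<lambda>x. u x - v x" and ?d = "\<lambda>x. f x - \<phi> x"
  have zH: "?z \<in> H1 \<Omega>" by (rule H1.diff[OF uH v(1)])
  have dL: "?d \<in> L2 \<Omega>" by (rule L2.diff[OF fL pL])
  have r: "h1 ?z y = L2_inner \<Omega> ?d y" if y: "y \<in> H1 \<Omega>" for y
    using H1.lin_diff[OF uH v(1) y] L2.lin_diff[OF fL pL H1_L2[OF y]] neumann_dom_h1[OF u y] v(2)[OF y]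
    by (simp add: f_def[abs_def])
  note n = neumann_resolvent[OF zH dL r]
  note zL = H1_L2[OF zH]
  have LzL: "?L ?z \<in> L2 \<Omega>" by (rule neumann_domD(2)[OF n(1)])
  have zn: "L2.nrm ?z \<le> L2.nrm ?d"
  proof -
    have "(L2.nrm ?z)\<^sup>2 \<le> (H1.nrm ?z)\<^sup>2" using L2_nrm_le_H1[OF zH] L2.nrm_ge0[OF zL] by (rule power_mono)
    also have "\<dots> = L2_inner \<Omega> ?d ?z" using H1.nrm_sq[OF zH] r[OF zH] by simp
    also have "\<dots> \<le> L2.nrm ?d * L2.nrm ?z" using L2.cauchy_schwarz[OF dL zL] by linarith
    finally have "L2.nrm ?z * L2.nrm ?z \<le> L2.nrm ?d * L2.nrm ?z" by (simp add: power2_eq_square)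
    then show ?thesis using L2.nrm_ge0[OF zL] L2.nrm_ge0[OF dL] by (cases "L2.nrm ?z = 0") (simp_all add: mult_le_cancel_right)
  qed
  have Lzn: "L2.nrm (?L ?z) \<le> 2 * L2.nrm ?d"
  proof -
    have "L2.nrm (?L ?z) = L2.nrm (\<lambda>x. ?z x - ?d x)" by (rule L2_nrm_cong_AE[OF LzL L2.diff[OF zL dL] n(2)])
    also have "\<dots> \<le> L2.nrm ?z + L2.nrm ?d"
      using L2.triangle3[OF zL L2_zero dL] L2.nrm_minus[OF L2_zero dL] by simp
    finally show ?thesis using zn by linarith
  qed
  have sq: "(L2.nrm w)\<^sup>2 = (\<integral>x. (w x)\<^sup>2 \<partial>M)" if "w \<in> L2 \<Omega>" for w
    unfolding L2.nrm_sq[OF that] L2_inner_def by (simp add: power2_eq_square)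
  have "(\<integral>x. (?L ?z x)\<^sup>2 + (?z x)\<^sup>2 \<partial>M) = (L2.nrm (?L ?z))\<^sup>2 + (L2.nrm ?z)\<^sup>2"
    unfolding sq[OF LzL] sq[OF zL] by (rule Bochner_Integration.integral_add[OF L2_square[OF LzL] L2_square[OF zL]])
  also have "\<dots> \<le> (2 * L2.nrm ?d)\<^sup>2 + (L2.nrm ?d)\<^sup>2"
    by (intro add_mono power_mono Lzn zn L2.nrm_ge0 LzL zL)
  also have "\<dots> \<le> (3 * L2.nrm ?d)\<^sup>2" by (simp add: power2_eq_square)
  finally have "neumann_graph_norm \<Omega> ?z \<le> sqrt ((3 * L2.nrm ?d)\<^sup>2)"
    unfolding neumann_graph_norm_def by (rule real_sqrt_le_mono)
  also have "\<dots> = 3 * L2.nrm ?d" unfolding real_sqrt_abs using L2.nrm_ge0[OF dL] by simp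
  also have "\<dots> < e" using pn by simp
  finally show ?thesis using resolvent_in_core[OF p v] by blast
qed

lemma core_subspace: "L2_subspace \<Omega> core"
proof -
  obtain r where r: "r \<in> H1 \<Omega>" "\<And>v. v \<in> H1 \<Omega> \<Longrightarrow> h1 r v = L2_inner \<Omega> (\<lambda>x. 0) v" using resolvent_exists[OF L2_zero] by blast
  have "r \<in> core" by (rule resolvent_in_core[OF test_zero r])
  from core_comb[OF this this, of "-1"] have z: "(\<lambda>x. 0) \<in> core" by simp
  have "core \<subseteq> L2 \<Omega>" using neumann_domD(1) H1_L2 by (auto simp: core_def)
  moreover have "(\<lambda>x. u x + v x) \<in> core" if "u \<in> core" "v \<in> core" for u v using core_comb[OF that, of 1] by simp
  moreover have "(\<lambda>x. k * u x) \<in> core" if "u \<in> core" for u k using core_comb[OF z that, of k] by simp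
  ultimately show ?thesis using z core_cong by (simp add: L2_subspace_def)
qed

theorem commuting_core:
  "\<exists>D. L2_subspace \<Omega> D \<and> D \<subseteq> neumann_dom \<Omega> \<and> weak_laplacian \<Omega> ` D \<subseteq> B_dom \<Omega> b \<and>
     B ` D \<subseteq> neumann_dom \<Omega> \<and> neumann_core \<Omega> D \<and> neumann_dom \<Omega> \<subseteq> B_dom \<Omega> b \<and>
     neumann_dom \<Omega> \<subseteq> adjoint_dom \<Omega> (B_dom \<Omega> b) B \<and>
     (\<forall>u\<in>D. ae_eq \<Omega> (B (weak_laplacian \<Omega> u)) (weak_laplacian \<Omega> (B u)))"
proof (intro exI[of _ core] conjI)
  show "L2_subspace \<Omega> core" by (rule core_subspace)
  show sub: "core \<subseteq> neumann_dom \<Omega>" "B ` core \<subseteq> neumann_dom \<Omega>" "weak_laplacian \<Omega> ` core \<subseteq> B_dom \<Omega> b"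
    "\<forall>u\<in>core. ae_eq \<Omega> (B (weak_laplacian \<Omega> u)) (weak_laplacian \<Omega> (B u))"
    by (auto simp: core_def B_dom_def)
  show "neumann_core \<Omega> core" using core_subspace sub(1) core_dense by (simp add: neumann_core_def)
  show "neumann_dom \<Omega> \<subseteq> B_dom \<Omega> b" using neumann_domD(1) by (auto simp: B_dom_def)
  show "neumann_dom \<Omega> \<subseteq> adjoint_dom \<Omega> (B_dom \<Omega> b) B"
  proof
    fix v assume "v \<in> neumann_dom \<Omega>"
    then have v: "v \<in> H1 \<Omega>" by (rule neumann_domD(1))
    have w: "(\<lambda>x. (-1) * B v x) \<in> L2 \<Omega>" by (rule L2.scale[OF B_L2[OF v]])
    have "L2_inner \<Omega> (B u) v = L2_inner \<Omega> u (\<lambda>x. (-1) * B v x)" if u: "u \<in> H1 \<Omega>" for u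
      unfolding B_skew_adjoint[OF u v] by (simp add: L2_inner_def)
    with w H1_L2[OF v] show "v \<in> adjoint_dom \<Omega> (B_dom \<Omega> b) B" unfolding adjoint_dom_def B_dom_def by blast
  qed
qed

end

theorem lemma2p10:
  fixes \<Omega> :: "(real^'n::finite) set"
    and \<nu> :: "real^'n \<Rightarrow> real^'n"
    and N :: nat
    and b :: "nat \<Rightarrow> real^'n \<Rightarrow> real^'n"
  assumes dim: "CARD('n) \<ge> 2"
    and domain: "open \<Omega>" "connected \<Omega>" "\<Omega> \<noteq> {}" "bounded \<Omega>" "smooth_boundary \<Omega>"
    and normal: "outer_unit_normal \<Omega> \<nu>"
    and N: "N \<ge> 1"
    and C2: "\<forall>i\<in>{1..N}. Ck_closure_field 2 \<Omega> (b i)"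
    and cond_i: "\<forall>i\<in>{1..N}. \<forall>x\<in>frontier \<Omega>. b i x \<bullet> \<nu> x = 0"
    and cond_ii: "N = 1 \<or>
      (\<forall>i\<in>{1..N}. \<forall>l\<in>{1..N}. i \<noteq> l \<longrightarrow> (\<forall>k j. \<forall>x\<in>closure \<Omega>.
         b i x $ k * cpartial \<Omega> k (\<lambda>y. b l y $ j) x = b l x $ k * cpartial \<Omega> k (\<lambda>y. b i y $ j) x))"
    and cond_iii: "\<forall>i\<in>{1..N}. \<forall>x\<in>closure \<Omega>.
      cdivergence \<Omega> (b i) x = 0 \<and> claplacian_field \<Omega> (b i) x \<bullet> b i x = 0"
    and cond_iv: "\<forall>i\<in>{1..N}. \<forall>x\<in>frontier \<Omega>.
      cgradient_field \<Omega> (b i) x (\<nu> x) \<bullet> b i x + cgradient_field \<Omega> (b i) x (b i x) \<bullet> \<nu> x = 0"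
  shows "\<forall>i\<in>{1..N}. \<exists>D. L2_subspace \<Omega> D \<and> D \<subseteq> neumann_dom \<Omega> \<and>
      weak_laplacian \<Omega> ` D \<subseteq> B_dom \<Omega> (b i) \<and>
      B_op \<Omega> (b i) ` D \<subseteq> neumann_dom \<Omega> \<and>
      neumann_core \<Omega> D \<and>
      neumann_dom \<Omega> \<subseteq> B_dom \<Omega> (b i) \<and>
      neumann_dom \<Omega> \<subseteq> adjoint_dom \<Omega> (B_dom \<Omega> (b i)) (B_op \<Omega> (b i)) \<and>
      (\<forall>u\<in>D. ae_eq \<Omega> (B_op \<Omega> (b i) (weak_laplacian \<Omega> u)) (weak_laplacian \<Omega> (B_op \<Omega> (b i) u)))"
proof
  fix i assume i: "i \<in> {1..N}"
  interpret bounded_open \<Omega> using domain by unfold_locales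
  have "\<exists>A c. (\<forall>v. (A *v v) \<bullet> v = 0) \<and> (\<forall>x\<in>closure \<Omega>. b i x = A *v x + c)"
  proof (rule field_is_infinitesimal_isometry[OF domain(5) normal domain(2,3)])
    show "Ck_closure_field 2 \<Omega> (b i)" using C2 i by blast
    show "cdivergence \<Omega> (b i) x = 0" "claplacian_field \<Omega> (b i) x \<bullet> b i x = 0" if "x \<in> \<Omega>" for x
      using cond_iii i that closure_subset[of \<Omega>] by blast+
    show "cgradient_field \<Omega> (b i) x (\<nu> x) \<bullet> b i x + cgradient_field \<Omega> (b i) x (b i x) \<bullet> \<nu> x = 0" if "x \<in> frontier \<Omega>" for x
      using cond_iv i that by blast
  qed
  then obtain A c where skew: "\<And>v. (A *v v) \<bullet> v = 0" and aff: "\<And>x. x \<in> closure \<Omega> \<Longrightarrow> b i x = A *v x + c" by blast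
  interpret skew_affine A c by unfold_locales (rule skew)
  have field: "tangential_field \<Omega> (\<lambda>x. s *\<^sub>R (A *v x + c)) (\<lambda>x. s *\<^sub>R A) (real CARD('n) * norm (s *\<^sub>R A))" for s
  proof unfold_locales
    show "continuous_on (closure \<Omega>) (\<lambda>x. s *\<^sub>R (A *v x + c))"
      by (intro continuous_intros matrix_vector_mult_linear_continuous_on)
    show "((\<lambda>x. s *\<^sub>R (A *v x + c)) has_derivative (\<lambda>h. (s *\<^sub>R A) *v h)) (at x)" for x
      using has_derivative_scaleR_right[OF has_derivative_affine[of A c x], of s] by (simp add: scaleR_matrix_vector_assoc)
    show "tangential \<Omega> (\<lambda>x. s *\<^sub>R (A *v x + c))"
    proof (rule tangentialI_normal[OF normal])
      fix z assume z: "z \<in> frontier \<Omega>"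
      then have "b i z = A *v z + c" by (intro aff) (simp add: frontier_def)
      moreover have "b i z \<bullet> \<nu> z = 0" using cond_i i z by blast
      ultimately show "(s *\<^sub>R (A *v z + c)) \<bullet> \<nu> z = 0" by simp
    qed
  qed (use domain norm_matrix_vector_le[of "s *\<^sub>R A"] in auto)
  have inv: "flow t x \<in> \<Omega>" if x: "x \<in> \<Omega>" for t x
  proof -
    (* Negative times are positive times for the field with the opposite sign. *)
    define s where "s = (if t \<ge> 0 then 1 else - 1 :: real)"
    have "flow (s * \<bar>t\<bar>) x \<in> \<Omega>"
    proof (rule tangential_field.tangential_curve_stays[OF field[of s], where \<gamma>="\<lambda>r. flow (s * r) x"])
      show "flow (s * 0) x \<in> \<Omega>" using x by (simp add: flow_0)
      have d: "((\<lambda>r. flow (s * r) x) has_derivative (\<lambda>h. h *\<^sub>R (s *\<^sub>R (A *v flow (s * r) x + c)))) (at r)" for r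
      proof -
        have "((\<lambda>r. s * r) has_derivative (\<lambda>h. s * h)) (at r)" by (auto intro!: derivative_eq_intros)
        from diff_chain_at[OF this flow_derivative] show ?thesis by (simp add: o_def mult.commute)
      qed
      then show "((\<lambda>r. flow (s * r) x) has_derivative (\<lambda>h. h *\<^sub>R (s *\<^sub>R (A *v flow (s * r) x + c)))) (at r)" for r .
      show "continuous_on UNIV (\<lambda>r. flow (s * r) x)"
        using has_derivative_continuous[OF d] by (auto intro: continuous_at_imp_continuous_on)
    qed simp
    moreover have "s * \<bar>t\<bar> = t" by (simp add: s_def)
    ultimately show ?thesis by simp
  qed
  interpret isometric_flow \<Omega> A c "b i"
    by unfold_locales (use inv aff closure_subset[of \<Omega>] in auto)
  show "\<exists>D. L2_subspace \<Omega> D \<and> D \<subseteq> neumann_dom \<Omega> \<and>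
      weak_laplacian \<Omega> ` D \<subseteq> B_dom \<Omega> (b i) \<and>
      B_op \<Omega> (b i) ` D \<subseteq> neumann_dom \<Omega> \<and>
      neumann_core \<Omega> D \<and>
      neumann_dom \<Omega> \<subseteq> B_dom \<Omega> (b i) \<and>
      neumann_dom \<Omega> \<subseteq> adjoint_dom \<Omega> (B_dom \<Omega> (b i)) (B_op \<Omega> (b i)) \<and>
      (\<forall>u\<in>D. ae_eq \<Omega> (B_op \<Omega> (b i) (weak_laplacian \<Omega> u)) (weak_laplacian \<Omega> (B_op \<Omega> (b i) u)))"
    by (rule commuting_core)
qed

end
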